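(* Let $\{V_j\}_{j\in\mathbb{Z}}$ be a multiresolution analysis (MRA) of $L^2(\mathbb{R}^n)$ having a continuous scaling function $\phi$ such that $\lim_{|\mathbf{x}|\to\infty}e^{M(l\mathbf{x})}\phi(\mathbf{x})=0$ for all $l\in\mathbb{N}$. Let $\mu$ be a (complex Radon) measure on $\mathbb{R}^n$ such that $\int_{\mathbb{R}^n}e^{-M(k\mathbf{x})}\,d|\mu|(\mathbf{x})<\infty$ for some $k\ge0$. Then $$\lim_{\lambda\to\infty}(q_\lambda\mu)(\mathbf{x}_0)=\gamma_{\mathbf{x}_0}$$ at every Lebesgue density point $\mathbf{x}_0$ of $\mu$, where $\gamma_{\mathbf{x}_0}$ is the number such that $\lim_{\nu\to\infty}\mu(B_\nu)/m(B_\nu)=\gamma_{\mathbf{x}_0}$ whenever $B_\nu\to\mathbf{x}_0$ regularly. In particular, the limit $\lim_{\lambda\to\infty}(q_\lambda\mu)(\mathbf{x}_0)=\gamma_{\mathbf{x}_0}$ exists and $\gamma_{\mathbf{x}_0}=f(\mathbf{x}_0)$ for almost every $\mathbf{x}_0$ (with respect to Lebesgue measure), where $d\mu=f\,dm+d\mu_s$ is the Lebesgue decomposition of $\mu$ ($f\in L^1_{loc}(\mathbb{R}^n)$, $\mu_s$ singular with respect to $m$).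
   Context: $M:[0,\infty)\to[0,\infty)$ is a continuous increasing function with $M(t)+M(s)\le M(t+s)$ and $M(t+s)\le M(2t)+M(2s)$ for all $t,s\ge0$; write $M(\mathbf{x})=M(|\mathbf{x}|)$ for $\mathbf{x}\in\mathbb{R}^n$. MRA: an increasing sequence $\{V_j\}_{j\in\mathbb{Z}}$ of closed linear subspaces of $L^2(\mathbb{R}^n)$ such that (i) $f\in V_j\Leftrightarrow f(2\,\cdot)\in V_{j+1}$; (ii) $f\in V_0\Leftrightarrow f(\cdot-\mathbf{m})\in V_0$ for $\mathbf{m}\in\mathbb{Z}^n$; (iii) $\bigcap_jV_j=\{0\}$ and $\overline{\bigcup_jV_j}=L^2(\mathbb{R}^n)$; (iv) there is $\phi\in L^2(\mathbb{R}^n)$, called a scaling function, such that $\{\phi(\cdot-\mathbf{m})\}_{\mathbf{m}\in\mathbb{Z}^n}$ is an orthonormal basis of $V_0$. Let $q_0(\mathbf{x},\mathbf{y})=\sum_{\mathbf{m}\in\mathbb{Z}^n}\phi(\mathbf{x}-\mathbf{m})\overline{\phi(\mathbf{y}-\mathbf{m})}$ and, for $\lambda\in\mathbb{R}$, $q_\lambda(\mathbf{x},\mathbf{y})=2^{n\lambda}q_0(2^\lambda\mathbf{x},2^\lambda\mathbf{y})$ and $(q_\lambda\mu)(\mathbf{x})=\int_{\mathbb{R}^n}q_\lambda(\mathbf{x},\mathbf{y})\,d\mu(\mathbf{y})$. $m$ is Lebesgue measure on $\mathbb{R}^n$, $|\mu|$ is the total variation measure, and $B(\mathbf{x}_0,\varepsilon)$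 is the Euclidean ball. A sequence of Borel sets $\{B_\nu\}_{\nu=0}^\infty$ shrinks regularly to $\mathbf{x}_0$ (written $B_\nu\to\mathbf{x}_0$ regularly) if there are radii $\varepsilon_\nu>0$ with $\varepsilon_\nu\to0$, $B_\nu\subseteq B(\mathbf{x}_0,\varepsilon_\nu)$ for all $\nu$, and a constant $a>0$ with $m(B_\nu)\ge a\varepsilon_\nu^n$ for all $\nu$. The point $\mathbf{x}_0$ is a Lebesgue density point of $\mu$ if there is a number $\gamma_{\mathbf{x}_0}$ with $\lim_{\nu\to\infty}\mu(B_\nu)/m(B_\nu)=\gamma_{\mathbf{x}_0}$ for every sequence $B_\nu\to\mathbf{x}_0$ regularly. *)

theory Defs
  imports "HOL-Analysis.Analysis"
begin

section \<open>The Hilbert space $L^2(R^n)$\<close>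

text \<open>Elements of $L^2$ are represented by functions rather than by classes modulo equality almost
  everywhere. A set of representatives that contains its own \<open>L2_closure\<close> is automatically closed
  under changes on null sets.\<close>

definition L2 :: "((real^'n) \<Rightarrow> complex) set" where
  "L2 = {f. f \<in> borel_measurable lebesgue \<and> integrable lebesgue (\<lambda>x. (cmod (f x))\<^sup>2)}"

definition L2_inner :: "((real^'n) \<Rightarrow> complex) \<Rightarrow> ((real^'n) \<Rightarrow> complex) \<Rightarrow> complex" where
  "L2_inner f g = (LINT x|lebesgue. f x * cnj (g x))"

definition L2_norm :: "((real^'n) \<Rightarrow> complex) \<Rightarrow> real" where
  "L2_norm f = sqrt (LINT x|lebesgue. (cmod (f x))\<^sup>2)"

definition L2_closure :: "((real^'n) \<Rightarrow> complex) set \<Rightarrow> ((real^'n) \<Rightarrow> complex) set" where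
  "L2_closure S = {f \<in> L2. \<forall>\<epsilon>>0. \<exists>g\<in>S. L2_norm (\<lambda>x. f x - g x) < \<epsilon>}"

definition L2_closed_subspace :: "((real^'n) \<Rightarrow> complex) set \<Rightarrow> bool" where
  "L2_closed_subspace S \<longleftrightarrow>
     S \<subseteq> L2 \<and>
     (\<lambda>x. 0) \<in> S \<and>
     (\<forall>f\<in>S. \<forall>g\<in>S. (\<lambda>x. f x + g x) \<in> S) \<and>
     (\<forall>c. \<forall>f\<in>S. (\<lambda>x. c * f x) \<in> S) \<and>
     L2_closure S \<subseteq> S"

definition L2_orthonormal_basis ::
    "'i set \<Rightarrow> ('i \<Rightarrow> (real^'n) \<Rightarrow> complex) \<Rightarrow> ((real^'n) \<Rightarrow> complex) set \<Rightarrow> bool" where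
  "L2_orthonormal_basis I e S \<longleftrightarrow>
     (\<forall>i\<in>I. e i \<in> L2) \<and>
     (\<forall>i\<in>I. \<forall>j\<in>I. L2_inner (e i) (e j) = (if i = j then 1 else 0)) \<and>
     L2_closure {(\<lambda>x. \<Sum>i\<in>F. c i * e i x) | F c. finite F \<and> F \<subseteq> I} = S"


section \<open>Multiresolution analyses\<close>

definition integer_points :: "(real^'n) set" where
  "integer_points = {m. \<forall>i. m $ i \<in> \<int>}"

definition scaling_function ::
    "(int \<Rightarrow> ((real^'n) \<Rightarrow> complex) set) \<Rightarrow> ((real^'n) \<Rightarrow> complex) \<Rightarrow> bool" where
  "scaling_function V \<phi> \<longleftrightarrow>
     \<phi> \<in> L2 \<and> L2_orthonormal_basis integer_points (\<lambda>m x. \<phi> (x - m)) (V 0)"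

definition MRA :: "(int \<Rightarrow> ((real^'n) \<Rightarrow> complex) set) \<Rightarrow> bool" where
  "MRA V \<longleftrightarrow>
     (\<forall>j. L2_closed_subspace (V j)) \<and>
     (\<forall>j. V j \<subseteq> V (j + 1)) \<and>
     (\<forall>j f. f \<in> V j \<longleftrightarrow> (\<lambda>x. f (2 *\<^sub>R x)) \<in> V (j + 1)) \<and>
     (\<forall>f. \<forall>m\<in>integer_points. f \<in> V 0 \<longleftrightarrow> (\<lambda>x. f (x - m)) \<in> V 0) \<and>
     (\<Inter>j. V j) = {f \<in> L2. AE x in lebesgue. f x = 0} \<and>
     L2_closure (\<Union>j. V j) = L2 \<and>
     (\<exists>\<phi>. scaling_function V \<phi>)"


section \<open>Complex Radon measures\<close>

text \<open>A complex Radon measure on $R^n$ may have infinite total variation, so it is a countably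
  additive set function on the bounded Borel sets only (regularity is automatic on $R^n$). The
  values of \<open>\<mu>\<close> on all other sets are irrelevant.\<close>

definition bounded_borel :: "(real^'n) set set" where
  "bounded_borel = {B. B \<in> sets borel \<and> bounded B}"

definition complex_radon_measure :: "((real^'n) set \<Rightarrow> complex) \<Rightarrow> bool" where
  "complex_radon_measure \<mu> \<longleftrightarrow>
     (\<forall>A :: nat \<Rightarrow> (real^'n) set.
        range A \<subseteq> bounded_borel \<longrightarrow> disjoint_family A \<longrightarrow> bounded (\<Union>i. A i) \<longrightarrow>
        (\<lambda>i. \<mu> (A i)) sums \<mu> (\<Union>i. A i))"

definition total_variation :: "((real^'n) set \<Rightarrow> complex) \<Rightarrow> (real^'n) measure" where
  "total_variation \<mu> = measure_of UNIV (sets borel)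
     (\<lambda>A. SUP P \<in> {P. finite P \<and> disjoint P \<and> P \<subseteq> bounded_borel \<and> \<Union>P \<subseteq> A}.
            \<Sum>B\<in>P. ennreal (cmod (\<mu> B)))"

text \<open>The positive part in the Jordan decomposition of a real set function; the truncation of
  \<open>ennreal\<close> at 0 is harmless because the empty set is among the competitors.\<close>

definition upper_variation :: "((real^'n) set \<Rightarrow> real) \<Rightarrow> (real^'n) measure" where
  "upper_variation \<nu> = measure_of UNIV (sets borel)
     (\<lambda>A. SUP B \<in> {B \<in> bounded_borel. B \<subseteq> A}. ennreal (\<nu> B))"

definition integral_radon ::
    "((real^'n) set \<Rightarrow> complex) \<Rightarrow> ((real^'n) \<Rightarrow> complex) \<Rightarrow> complex" where
  "integral_radon \<mu> g =
     (LINT y|upper_variation (\<lambda>B. Re (\<mu> B)). g y) -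
     (LINT y|upper_variation (\<lambda>B. - Re (\<mu> B)). g y) +
     \<i> * ((LINT y|upper_variation (\<lambda>B. Im (\<mu> B)). g y) -
          (LINT y|upper_variation (\<lambda>B. - Im (\<mu> B)). g y))"

definition singular_radon :: "((real^'n) set \<Rightarrow> complex) \<Rightarrow> bool" where
  "singular_radon \<mu> \<longleftrightarrow>
     (\<exists>N \<in> null_sets lborel. emeasure (total_variation \<mu>) (- N) = 0)"

definition L1_loc :: "((real^'n) \<Rightarrow> complex) set" where
  "L1_loc = {f. \<forall>K. compact K \<longrightarrow> set_integrable lebesgue K f}"

definition lebesgue_decomposition ::
    "((real^'n) set \<Rightarrow> complex) \<Rightarrow> ((real^'n) \<Rightarrow> complex) \<Rightarrow> ((real^'n) set \<Rightarrow> complex) \<Rightarrow> bool" where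
  "lebesgue_decomposition \<mu> f \<mu>s \<longleftrightarrow>
     f \<in> L1_loc \<and> complex_radon_measure \<mu>s \<and> singular_radon \<mu>s \<and>
     (\<forall>B\<in>bounded_borel. \<mu> B = (LINT x:B|lebesgue. f x) + \<mu>s B)"


section \<open>Lebesgue density points\<close>

definition shrinks_regularly :: "(nat \<Rightarrow> (real^'n) set) \<Rightarrow> real^'n \<Rightarrow> bool" where
  "shrinks_regularly B x0 \<longleftrightarrow>
     (\<forall>\<nu>. B \<nu> \<in> sets borel) \<and>
     (\<exists>\<epsilon> :: nat \<Rightarrow> real.
        (\<forall>\<nu>. \<epsilon> \<nu> > 0) \<and> \<epsilon> \<longlonglongrightarrow> 0 \<and>
        (\<forall>\<nu>. B \<nu> \<subseteq> ball x0 (\<epsilon> \<nu>)) \<and>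
        (\<exists>a>0. \<forall>\<nu>. measure lborel (B \<nu>) \<ge> a * \<epsilon> \<nu> ^ CARD('n)))"

text \<open>\<open>x0\<close> is a Lebesgue density point of \<open>\<mu>\<close> with density \<open>\<gamma>\<close>.\<close>

definition has_lebesgue_density ::
    "((real^'n) set \<Rightarrow> complex) \<Rightarrow> complex \<Rightarrow> real^'n \<Rightarrow> bool" where
  "has_lebesgue_density \<mu> \<gamma> x0 \<longleftrightarrow>
     (\<forall>B. shrinks_regularly B x0 \<longrightarrow>
        (\<lambda>\<nu>. \<mu> (B \<nu>) / complex_of_real (measure lborel (B \<nu>))) \<longlonglongrightarrow> \<gamma>)"


section \<open>The kernels of the multiresolution projections\<close>

definition q0 :: "((real^'n) \<Rightarrow> complex) \<Rightarrow> real^'n \<Rightarrow> real^'n \<Rightarrow> complex" where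
  "q0 \<phi> x y = (\<Sum>\<^sub>\<infinity>m\<in>integer_points. \<phi> (x - m) * cnj (\<phi> (y - m)))"

definition q :: "((real^'n) \<Rightarrow> complex) \<Rightarrow> real \<Rightarrow> real^'n \<Rightarrow> real^'n \<Rightarrow> complex" where
  "q \<phi> lam x y =
     complex_of_real (2 powr (real CARD('n) * lam)) *
     q0 \<phi> ((2 powr lam) *\<^sub>R x) ((2 powr lam) *\<^sub>R y)"

definition q_measure ::
    "((real^'n) \<Rightarrow> complex) \<Rightarrow> real \<Rightarrow> ((real^'n) set \<Rightarrow> complex) \<Rightarrow> real^'n \<Rightarrow> complex" where
  "q_measure \<phi> lam \<mu> x = integral_radon \<mu> (\<lambda>y. q \<phi> lam x y)"

end

theory Submission
  imports Defs
begin

text \<open>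
  With \<open>t = 2 powr \<lambda>\<close>, the growth hypotheses give
  \<open>cmod (q \<phi> \<lambda> x y) \<le> C * t ^ n * exp (- M (t * norm (x - y)))\<close>, and
  \<open>\<integral> q \<phi> \<lambda> x y dy = 1\<close>. Hence \<open>q_measure \<phi> \<lambda> \<mu> x0 - \<gamma>\<close> is the integral of the kernel
  against \<open>\<sigma> = \<mu> - \<gamma> * m\<close>. At a density point the total variation of \<open>\<sigma>\<close> on the ball of radius \<open>r\<close> is
  \<open>o(r ^ n)\<close>: for every Borel set \<open>D\<close>, one of \<open>ball x0 r \<inter> D\<close> and \<open>ball x0 r - D\<close> has at least half of the
  volume, hence shrinks regularly. Summing over the shells \<open>j \<le> t * norm (x0 - y) < j + 1\<close> shows that the
  integral tends to 0.

  That the kernel has integral 1 is where the multiresolution analysis enters. The function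
  \<open>G x = \<integral> q0 \<phi> x y dy\<close> is continuous and periodic. The projection to \<open>V 0\<close> of the indicator function of
  a large ball is close to this indicator function in mean square, because the union of the \<open>V j\<close> is
  dense, and close to \<open>G\<close> well inside of the ball. So the mean of \<open>(cmod (1 - G x))\<^sup>2\<close> over large balls
  is arbitrarily small, and periodicity forces \<open>G = 1\<close>.

  Almost every point is a density point by Vitali's covering theorem: a locally finite measure that
  vanishes on \<open>A\<close> has density 0 at almost every point of \<open>A\<close>.
\<close>


section \<open>Variation of complex Radon measures\<close>

text \<open>The density hypothesis speaks of values of \<open>\<mu>\<close> on sets, whereas
  \<open>integral_radon\<close> combines integrals against four variations. Both are expressed
  through densities with respect to one positive measure. The error becomes the integral of the
  kernel against a function, whose size on a ball is tested on the sets where the real part of a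
  rotation of it is positive. Such a set can be arbitrarily thin near \<open>x0\<close>, where the
  hypothesis says nothing about it; hence a set and its complement in the ball are treated together.
  The growth of \<open>\<mu>\<close> matters only far from \<open>x0\<close>. There superadditivity
  bounds \<open>M (t * r)\<close> below by \<open>M (2 * K * r)\<close>, which pays for that growth,
  plus \<open>M ((t - 2 * K) * r)\<close>, which grows at least linearly in \<open>t\<close> and
  beats the factor \<open>t ^ n\<close>. The total mass of the kernel at \<open>x0\<close> is
  \<open>G\<close> evaluated at \<open>t\<close> times \<open>x0\<close>. As \<open>x0\<close> is
  prescribed, \<open>G = 1\<close> is required at every point and not merely almost everywhere;
  continuity turns one bad point into a ball, and periodicity repeats that ball with positive
  density.\<close>

lemma SUP_add_SUP_le_ennreal:
  fixes f :: "'a \<Rightarrow> ennreal"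
  assumes "I \<noteq> {}" "J \<noteq> {}" "\<And>i j. i \<in> I \<Longrightarrow> j \<in> J \<Longrightarrow> f i + g j \<le> c"
  shows "(SUP i\<in>I. f i) + (SUP j\<in>J. g j) \<le> c"
proof -
  have "f i + (SUP j\<in>J. g j) \<le> c" if "i \<in> I" for i
    using assms that by (subst ennreal_SUP_add_right) (auto intro!: SUP_least)
  then have "(SUP i\<in>I. f i + (SUP j\<in>J. g j)) \<le> c"
    by (intro SUP_least)
  then show ?thesis
    using assms(1) by (subst (asm) ennreal_SUP_add_left) auto
qed

text \<open>Tailored to set functions defined by suprema: these are monotone and superadditive
  because competitors can be joined, and countably subadditive because a competitor can be cut along
  a partition. Superadditivity passes to finite unions, and monotonicity then bounds every partial
  sum.\<close>

lemma countably_additiveI_superadditive: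
  fixes f :: "'a set \<Rightarrow> ennreal"
  assumes "sigma_algebra \<Omega> S" "f {} = 0"
    and mono: "\<And>A B. A \<in> S \<Longrightarrow> B \<in> S \<Longrightarrow> A \<subseteq> B \<Longrightarrow> f A \<le> f B"
    and super: "\<And>A B. A \<in> S \<Longrightarrow> B \<in> S \<Longrightarrow> A \<inter> B = {} \<Longrightarrow> f A + f B \<le> f (A \<union> B)"
    and sub: "\<And>A :: nat \<Rightarrow> 'a set. range A \<subseteq> S \<Longrightarrow> disjoint_family A \<Longrightarrow> f (\<Union>i. A i) \<le> (\<Sum>i. f (A i))"
  shows "countably_additive S f"
  unfolding countably_additive_def
proof (intro allI impI antisym)
  interpret sigma_algebra \<Omega> S by fact
  fix A :: "nat \<Rightarrow> 'a set"
  assume A: "range A \<subseteq> S" "disjoint_family A" "(\<Union>i. A i) \<in> S"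
  have *: "(\<Sum>i<N. f (A i)) \<le> f (\<Union>i<N. A i)" for N
  proof (induction N)
    case (Suc N)
    have "(\<Sum>i<Suc N. f (A i)) \<le> f (\<Union>i<N. A i) + f (A N)"
      using Suc by (simp add: add_right_mono)
    also have "\<dots> \<le> f ((\<Union>i<N. A i) \<union> A N)"
      using A by (intro super) (auto simp: disjoint_family_on_def, metis IntI empty_iff less_irrefl)
    also have "(\<Union>i<N. A i) \<union> A N = (\<Union>i<Suc N. A i)"
      by (auto simp: lessThan_Suc)
    finally show ?case .
  qed (simp add: assms)
  have "f (\<Union>i<N. A i) \<le> f (\<Union>i. A i)" for N
    using A by (intro mono) auto
  with * show "(\<Sum>i. f (A i)) \<le> f (\<Union>i. A i)"
    unfolding suminf_eq_SUP by (meson SUP_least order_trans)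
qed (use sub in auto)

text \<open>The condition of \<open>complex_radon_measure\<close>, but polymorphic in the values, so
  that \<open>\<mu>\<close> and the real set functions obtained from its real and imaginary parts
  are covered by the same lemmas.\<close>

definition radon_additive :: "((real^'n) set \<Rightarrow> 'a::real_normed_vector) \<Rightarrow> bool" where
  "radon_additive \<nu> \<longleftrightarrow>
     (\<forall>A :: nat \<Rightarrow> (real^'n) set.
        range A \<subseteq> bounded_borel \<longrightarrow> disjoint_family A \<longrightarrow> bounded (\<Union>i. A i) \<longrightarrow>
        (\<lambda>i. \<nu> (A i)) sums \<nu> (\<Union>i. A i))"

lemma complex_radon_measure_eq: "complex_radon_measure = radon_additive"
  unfolding complex_radon_measure_def radon_additive_def by (rule ext) simp

lemma radon_additive_Re: "radon_additive \<mu> \<Longrightarrow> radon_additive (\<lambda>B. Re (\<mu> B))"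
  and radon_additive_Im: "radon_additive \<mu> \<Longrightarrow> radon_additive (\<lambda>B. Im (\<mu> B))"
  and radon_additive_minus: "radon_additive \<nu> \<Longrightarrow> radon_additive (\<lambda>B. - \<nu> B)"
  unfolding radon_additive_def by (simp_all add: sums_Re sums_Im sums_minus)

lemma bounded_borelD: "B \<in> bounded_borel \<Longrightarrow> B \<in> sets borel \<and> bounded B"
  by (auto simp: bounded_borel_def)

lemma empty_bounded_borel [simp]: "{} \<in> bounded_borel"
  by (simp add: bounded_borel_def)

lemma bounded_borel_Int: "A \<in> bounded_borel \<Longrightarrow> B \<in> sets borel \<Longrightarrow> A \<inter> B \<in> bounded_borel"
  and bounded_borel_Diff: "A \<in> bounded_borel \<Longrightarrow> B \<in> sets borel \<Longrightarrow> A - B \<in> bounded_borel"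
  and bounded_borel_Un: "A \<in> bounded_borel \<Longrightarrow> C \<in> bounded_borel \<Longrightarrow> A \<union> C \<in> bounded_borel"
  by (auto simp: bounded_borel_def bounded_Int bounded_diff)

text \<open>The value at the empty set is not prescribed; it is forced because a constant series
  converges only if its terms are 0.\<close>

lemma radon_additive_empty:
  assumes "radon_additive \<nu>" shows "\<nu> {} = 0"
proof -
  have "(\<lambda>i::nat. \<nu> {}) sums \<nu> (\<Union>i::nat. {})"
    using assms[unfolded radon_additive_def, rule_format, of "\<lambda>_. {}"]
    by (auto simp: disjoint_family_on_def)
  then show ?thesis
    using summable_const_iff sums_summable by blast
qed

lemma radon_additive_Un:
  assumes "radon_additive \<nu>" "A \<in> bounded_borel" "B \<in> bounded_borel" "A \<inter> B = {}"
  shows "\<nu> (A \<union> B) = \<nu> A + \<nu> B"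
proof -
  have "(\<lambda>i. \<nu> (binaryset A B i)) sums \<nu> (\<Union>i. binaryset A B i)"
    using assms bounded_borel_Un[of A B]
    by (intro assms(1)[unfolded radon_additive_def, rule_format])
       (auto simp: range_binaryset_eq UN_binaryset_eq disjoint_family_on_def binaryset_def
                   bounded_borel_def split: if_splits)
  moreover have "(\<lambda>i. \<nu> (binaryset A B i)) sums (\<nu> A + \<nu> B)"
    by (rule binaryset_sums) (rule radon_additive_empty[OF assms(1)])
  ultimately show ?thesis
    by (simp add: UN_binaryset_eq sums_unique2)
qed

lemma radon_additive_Diff:
  assumes "radon_additive \<nu>" "A \<in> bounded_borel" "B \<in> sets borel"
  shows "\<nu> A = \<nu> (A \<inter> B) + \<nu> (A - B)"
proof -
  have "A = (A \<inter> B) \<union> (A - B)" by blast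
  then show ?thesis
    using radon_additive_Un[OF assms(1) bounded_borel_Int[OF assms(2,3)] bounded_borel_Diff[OF assms(2,3)]]
    by auto
qed

text \<open>Only \<open>B\<close> has to be bounded: the pieces may be unbounded, as happens when a
  bounded competitor is cut along a partition of an arbitrary Borel set.\<close>

lemma radon_additive_sums_Int:
  assumes "radon_additive \<nu>" "B \<in> bounded_borel" "B \<subseteq> (\<Union>i. A i)" "range A \<subseteq> sets borel"
    "disjoint_family (A :: nat \<Rightarrow> (real^'n) set)"
  shows "(\<lambda>i. \<nu> (B \<inter> A i)) sums \<nu> B"
proof -
  have "(\<lambda>i. \<nu> (B \<inter> A i)) sums \<nu> (\<Union>i. B \<inter> A i)"
  proof (intro assms(1)[unfolded radon_additive_def, rule_format])
    show "range (\<lambda>i. B \<inter> A i) \<subseteq> bounded_borel"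
      using assms by (auto intro: bounded_borel_Int)
    show "disjoint_family (\<lambda>i. B \<inter> A i)"
      using assms(5) by (auto simp: disjoint_family_on_def)
    show "bounded (\<Union>i. B \<inter> A i)"
      using bounded_borelD[OF assms(2)] by (meson Int_lower1 UN_least bounded_subset)
  qed
  also have "(\<Union>i. B \<inter> A i) = B"
    using assms(3) by auto
  finally show ?thesis .
qed

lemma ennreal_norm_le_suminf:
  assumes "f sums (x :: 'a::banach)"
  shows "ennreal (norm x) \<le> (\<Sum>i. ennreal (norm (f i)))"
proof (cases "summable (\<lambda>i. norm (f i))")
  case True
  then have "(\<Sum>i. ennreal (norm (f i))) = ennreal (\<Sum>i. norm (f i))"
    by (intro suminf_ennreal2) auto
  moreover have "norm x \<le> (\<Sum>i. norm (f i))"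
    using summable_norm[OF True] sums_unique[OF assms] by simp
  ultimately show ?thesis
    by (simp add: ennreal_leI)
next
  case False
  then have "(\<Sum>i. ennreal (norm (f i))) = top"
    by (metis summable_suminf_not_top norm_ge_zero)
  then show ?thesis by simp
qed

text \<open>Since \<open>ennreal\<close> truncates negative terms to 0, the right-hand side sums the
  positive parts; if these diverge it is infinite.\<close>

lemma ennreal_le_suminf_pos:
  assumes "f sums (x :: real)"
  shows "ennreal x \<le> (\<Sum>i. ennreal (f i))"
proof -
  have eq: "ennreal (f i) = ennreal (max 0 (f i))" for i
    by (simp add: max_def ennreal_neg)
  show ?thesis
  proof (cases "summable (\<lambda>i. max 0 (f i))")
    case True
    then have "(\<Sum>i. ennreal (f i)) = ennreal (\<Sum>i. max 0 (f i))"
      unfolding eq by (intro suminf_ennreal2) auto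
    moreover have "x \<le> (\<Sum>i. max 0 (f i))"
      using assms True by (auto simp: sums_iff intro: suminf_le)
    ultimately show ?thesis by (simp add: ennreal_leI)
  next
    case False
    then have "(\<Sum>i. ennreal (f i)) = top"
      unfolding eq by (metis summable_suminf_not_top max.cobounded1)
    then show ?thesis by simp
  qed
qed

text \<open>\<open>measure_of\<close> returns the prescribed values only for a countably additive
  set function, so the content is that the supremum is a measure, possibly with infinite
  values.\<close>

lemma emeasure_upper_variation:
  fixes \<nu> :: "(real^'n) set \<Rightarrow> real"
  assumes \<nu>: "radon_additive \<nu>" and A: "A \<in> sets borel"
  shows "emeasure (upper_variation \<nu>) A = (SUP B \<in> {B \<in> bounded_borel. B \<subseteq> A}. ennreal (\<nu> B))"
proof -
  define U where "U A = (SUP B \<in> {B \<in> bounded_borel. B \<subseteq> A}. ennreal (\<nu> B))" for A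
  have sa: "sigma_algebra UNIV (sets borel :: (real^'n) set set)"
    by (metis sets.sigma_algebra_axioms space_borel)
  have U0: "U {} = 0"
    unfolding U_def by (rule antisym) (auto intro!: SUP_least simp: radon_additive_empty[OF \<nu>])
  have upper: "ennreal (\<nu> B) \<le> U A" if "B \<in> bounded_borel" "B \<subseteq> A" for A B
    unfolding U_def using that by (intro SUP_upper) auto
  have "countably_additive (sets borel) U"
  proof (rule countably_additiveI_superadditive[where f = U, OF sa U0])
    show "U A \<le> U B" if "A \<subseteq> B" for A B
      unfolding U_def using that by (intro SUP_subset_mono) auto
    show "U A + U B \<le> U (A \<union> B)" if "A \<inter> B = {}" for A B
      unfolding U_def[of A] U_def[of B]
    proof (rule SUP_add_SUP_le_ennreal)
      fix C D assume C: "C \<in> {B \<in> bounded_borel. B \<subseteq> A}" and D: "D \<in> {D \<in> bounded_borel. D \<subseteq> B}"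
      have "\<nu> (C \<union> D) = \<nu> C + \<nu> D"
        using C D that by (intro radon_additive_Un \<nu>) auto
      \<comment> \<open>If one of the two values is negative, \<open>ennreal\<close> replaces it by
        0 and the other set alone serves as competitor.\<close>
      moreover have "ennreal (\<nu> (C \<union> D)) \<le> U (A \<union> B)" "ennreal (\<nu> C) \<le> U (A \<union> B)"
          "ennreal (\<nu> D) \<le> U (A \<union> B)"
        using C D by (auto intro!: upper bounded_borel_Un)
      ultimately show "ennreal (\<nu> C) + ennreal (\<nu> D) \<le> U (A \<union> B)"
        by (cases "\<nu> C \<ge> 0"; cases "\<nu> D \<ge> 0") (auto simp: ennreal_neg ennreal_plus[symmetric] simp del: ennreal_plus)
    qed (auto intro: exI[of _ "{}"])
    show "U (\<Union>i. A i) \<le> (\<Sum>i. U (A i))" if A: "range A \<subseteq> sets borel" "disjoint_family A" for A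
      unfolding U_def[of "\<Union>i. A i"]
    proof (rule SUP_least)
      fix B assume B: "B \<in> {B \<in> bounded_borel. B \<subseteq> (\<Union>i. A i)}"
      have "ennreal (\<nu> B) \<le> (\<Sum>i. ennreal (\<nu> (B \<inter> A i)))"
        using B A by (intro ennreal_le_suminf_pos radon_additive_sums_Int[OF \<nu>]) auto
      also have "\<dots> \<le> (\<Sum>i. U (A i))"
        using A B by (intro suminf_le upper bounded_borel_Int) auto
      finally show "ennreal (\<nu> B) \<le> (\<Sum>i. U (A i))" .
    qed
  qed
  then have "emeasure (upper_variation \<nu>) A = U A"
    unfolding upper_variation_def U_def[symmetric]
    by (intro emeasure_measure_of_sigma sa A) (auto simp: positive_def U0)
  then show ?thesis by (simp add: U_def)
qed

lemma emeasure_total_variation: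
  fixes \<mu> :: "(real^'n) set \<Rightarrow> complex"
  assumes \<mu>: "radon_additive \<mu>" and A: "A \<in> sets borel"
  shows "emeasure (total_variation \<mu>) A =
    (SUP P \<in> {P. finite P \<and> disjoint P \<and> P \<subseteq> bounded_borel \<and> \<Union>P \<subseteq> A}. \<Sum>B\<in>P. ennreal (cmod (\<mu> B)))"
proof -
  define fam where "fam A = {P. finite P \<and> disjoint P \<and> P \<subseteq> bounded_borel \<and> \<Union>P \<subseteq> A}" for A :: "(real^'n) set"
  define U where "U A = (SUP P \<in> fam A. \<Sum>B\<in>P. ennreal (cmod (\<mu> B)))" for A
  have sa: "sigma_algebra UNIV (sets borel :: (real^'n) set set)"
    by (metis sets.sigma_algebra_axioms space_borel)
  have \<mu>0: "\<mu> {} = 0" by (rule radon_additive_empty[OF \<mu>])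
  have U0: "U {} = 0"
    unfolding U_def
  proof (rule antisym[OF SUP_least])
    fix P :: "(real^'n) set set" assume "P \<in> fam {}"
    then have "P \<subseteq> {{}}" unfolding fam_def by blast
    then have "P = {} \<or> P = {{}}" by (rule subset_singletonD)
    then show "(\<Sum>B\<in>P. ennreal (cmod (\<mu> B))) \<le> 0" using \<mu>0 by auto
  qed simp
  have upper: "(\<Sum>B\<in>P. ennreal (cmod (\<mu> B))) \<le> U A" if "P \<in> fam A" for A P
    unfolding U_def using that by (intro SUP_upper) auto
  have "countably_additive (sets borel) U"
  proof (rule countably_additiveI_superadditive[where f = U, OF sa U0])
    show "U A \<le> U B" if "A \<subseteq> B" for A B
      unfolding U_def using that by (intro SUP_subset_mono) (auto simp: fam_def)
    show "U A + U B \<le> U (A \<union> B)" if "A \<inter> B = {}" for A B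
      unfolding U_def[of A] U_def[of B]
    proof (rule SUP_add_SUP_le_ennreal)
      fix P Q assume P: "P \<in> fam A" and Q: "Q \<in> fam B"
      \<comment> \<open>\<open>P\<close> and \<open>Q\<close> may both contain the empty set, their
        only possible common member; it contributes 0 to either sum.\<close>
      have "(\<Sum>B\<in>P. ennreal (cmod (\<mu> B))) + (\<Sum>B\<in>Q. ennreal (cmod (\<mu> B)))
          = (\<Sum>B\<in>P \<union> Q. ennreal (cmod (\<mu> B)))"
      proof (rule sum.union_inter_neutral[symmetric])
        show "\<forall>B\<in>P \<inter> Q. ennreal (cmod (\<mu> B)) = 0"
        proof
          fix C assume "C \<in> P \<inter> Q"
          then have "C = {}" using P Q that unfolding fam_def by blast
          then show "ennreal (cmod (\<mu> C)) = 0" using \<mu>0 by simp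
        qed
      qed (use P Q in \<open>auto simp: fam_def\<close>)
      also have "\<dots> \<le> U (A \<union> B)"
      proof (rule upper)
        have "disjoint (P \<union> Q)"
        proof (rule disjoint_union)
          show "\<Union>P \<inter> \<Union>Q = {}" using P Q that unfolding fam_def by blast
        qed (use P Q in \<open>auto simp: fam_def\<close>)
        then show "P \<union> Q \<in> fam (A \<union> B)" using P Q by (auto simp: fam_def)
      qed
      finally show "(\<Sum>B\<in>P. ennreal (cmod (\<mu> B))) + (\<Sum>B\<in>Q. ennreal (cmod (\<mu> B))) \<le> U (A \<union> B)" .
    next
      have "{} \<in> fam C" for C by (simp add: fam_def)
      then show "fam A \<noteq> {}" "fam B \<noteq> {}" by blast+
    qed
    show "U (\<Union>i. A i) \<le> (\<Sum>i. U (A i))" if A: "range A \<subseteq> sets borel" "disjoint_family A" for A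
      unfolding U_def[of "\<Union>i. A i"]
    proof (rule SUP_least)
      fix P assume P: "P \<in> fam (\<Union>i. A i)"
      have "(\<Sum>B\<in>P. ennreal (cmod (\<mu> B))) \<le> (\<Sum>B\<in>P. \<Sum>i. ennreal (cmod (\<mu> (B \<inter> A i))))"
        using P A by (intro sum_mono ennreal_norm_le_suminf radon_additive_sums_Int[OF \<mu>]) (auto simp: fam_def)
      also have "\<dots> = (\<Sum>i. \<Sum>B\<in>P. ennreal (cmod (\<mu> (B \<inter> A i))))"
        by (rule suminf_sum[symmetric]) simp
      also have "\<dots> \<le> (\<Sum>i. U (A i))"
      proof (intro suminf_le)
        fix i
        have dis: "disjoint P" "finite P" "P \<subseteq> bounded_borel" using P by (auto simp: fam_def)
        \<comment> \<open>Distinct members of \<open>P\<close> can have the same trace on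
          \<open>A i\<close> only if that trace is empty, so passing to the set of traces loses
          nothing.\<close>
        have "(\<Sum>B\<in>P. ennreal (cmod (\<mu> (B \<inter> A i)))) = (\<Sum>C\<in>(\<lambda>B. B \<inter> A i) ` P. ennreal (cmod (\<mu> C)))"
        proof (subst sum.reindex_nontrivial)
          fix B C assume "B \<in> P" "C \<in> P" "B \<noteq> C" "B \<inter> A i = C \<inter> A i"
          then have "B \<inter> A i = {}" using disjointD[OF dis(1), of B C] by auto
          then show "ennreal (cmod (\<mu> (B \<inter> A i))) = 0" using \<mu>0 by simp
        qed (use dis in auto)
        also have "\<dots> \<le> U (A i)"
        proof (rule upper)
          have "disjoint ((\<lambda>B. B \<inter> A i) ` P)"
            using dis(1) unfolding disjoint_def by blast
          then show "(\<lambda>B. B \<inter> A i) ` P \<in> fam (A i)"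
            using dis A by (auto simp: fam_def intro!: bounded_borel_Int)
        qed
        finally show "(\<Sum>B\<in>P. ennreal (cmod (\<mu> (B \<inter> A i)))) \<le> U (A i)" .
      qed auto
      finally show "(\<Sum>B\<in>P. ennreal (cmod (\<mu> B))) \<le> (\<Sum>i. U (A i))" .
    qed
  qed
  then have "emeasure (total_variation \<mu>) A = U A"
    unfolding total_variation_def fam_def[symmetric] U_def[symmetric]
    by (intro emeasure_measure_of_sigma sa A) (auto simp: positive_def U0)
  then show ?thesis by (simp add: U_def fam_def)
qed

section \<open>Comparison of the variations and the Jordan decomposition\<close>

lemma sets_upper_variation [simp, measurable_cong]: "sets (upper_variation \<nu>) = sets borel"
  and space_upper_variation [simp]: "space (upper_variation \<nu>) = UNIV"
  and sets_total_variation [simp, measurable_cong]: "sets (total_variation \<mu>) = sets borel"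
  and space_total_variation [simp]: "space (total_variation \<mu>) = UNIV"
  unfolding upper_variation_def total_variation_def
  by (simp_all add: sets.sigma_sets_eq[of borel, simplified])

lemma cmod_le_total_variation:
  assumes "radon_additive \<mu>" "B \<in> bounded_borel" "B \<subseteq> A" "A \<in> sets borel"
  shows "ennreal (cmod (\<mu> B)) \<le> emeasure (total_variation \<mu>) A"
proof -
  have "(\<Sum>C\<in>{B}. ennreal (cmod (\<mu> C))) \<le> emeasure (total_variation \<mu>) A"
    unfolding emeasure_total_variation[OF assms(1,4)]
    using assms(2,3) by (intro SUP_upper) auto
  then show ?thesis by simp
qed

lemma upper_variation_le_total_variation:
  assumes "radon_additive \<mu>" "radon_additive \<nu>" "A \<in> sets borel" "\<And>B. \<nu> B \<le> cmod (\<mu> B)"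
  shows "emeasure (upper_variation \<nu>) A \<le> emeasure (total_variation \<mu>) A"
  unfolding emeasure_upper_variation[OF assms(2,3)]
proof (rule SUP_least)
  fix B assume "B \<in> {B \<in> bounded_borel. B \<subseteq> A}"
  then show "ennreal (\<nu> B) \<le> emeasure (total_variation \<mu>) A"
    using cmod_le_total_variation[OF assms(1) _ _ assms(3), of B] assms(4)[of B]
    by (auto intro: order_trans[OF ennreal_leI])
qed

text \<open>For \<open>B\<close> inside \<open>A\<close>, \<open>- \<nu> B\<close> equals
  \<open>\<nu> (A - B) - \<nu> A\<close>, which is at most the upper variation of \<open>A\<close>
  minus \<open>\<nu> A\<close>. The supremum over \<open>B\<close> bounds the upper variation of
  \<open>- \<nu>\<close> and gives one inequality; the other is the same statement for
  \<open>- \<nu>\<close>.\<close>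

lemma jordan_decomposition:
  fixes \<nu> :: "(real^'n) set \<Rightarrow> real"
  assumes \<nu>: "radon_additive \<nu>" and A: "A \<in> bounded_borel"
    and fin: "emeasure (upper_variation \<nu>) A < \<infinity>" "emeasure (upper_variation (\<lambda>B. - \<nu> B)) A < \<infinity>"
  shows "\<nu> A = measure (upper_variation \<nu>) A - measure (upper_variation (\<lambda>B. - \<nu> B)) A"
proof -
  have *: "\<nu> A \<le> measure (upper_variation \<nu>) A - measure (upper_variation (\<lambda>B. - \<nu> B)) A"
    if \<nu>: "radon_additive \<nu>"
      and fin: "emeasure (upper_variation \<nu>) A < \<infinity>" "emeasure (upper_variation (\<lambda>B. - \<nu> B)) A < \<infinity>"
    for \<nu> :: "(real^'n) set \<Rightarrow> real"
  proof -
    have bor: "A \<in> sets borel" using A by (simp add: bounded_borel_def)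
    note e = emeasure_upper_variation[OF \<nu> bor]
      emeasure_upper_variation[OF radon_additive_minus[OF \<nu>] bor]
    have up: "\<nu> B \<le> measure (upper_variation \<nu>) A" if "B \<in> bounded_borel" "B \<subseteq> A" for B
    proof -
      have "ennreal (\<nu> B) \<le> emeasure (upper_variation \<nu>) A"
        unfolding e using that by (intro SUP_upper) auto
      also have "\<dots> = ennreal (measure (upper_variation \<nu>) A)"
        using fin(1) by (intro emeasure_eq_ennreal_measure) auto
      finally show ?thesis by simp
    qed
    have "emeasure (upper_variation (\<lambda>B. - \<nu> B)) A \<le> ennreal (measure (upper_variation \<nu>) A - \<nu> A)"
      unfolding e(2)
    proof (rule SUP_least)
      fix B assume B: "B \<in> {B \<in> bounded_borel. B \<subseteq> A}"
      then have "A \<inter> B = B" "A - B \<in> bounded_borel" "B \<in> sets borel"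
        using A by (auto intro: bounded_borel_Diff simp: bounded_borel_def bounded_diff)
      then show "ennreal (- \<nu> B) \<le> ennreal (measure (upper_variation \<nu>) A - \<nu> A)"
        using radon_additive_Diff[OF \<nu> A \<open>B \<in> sets borel\<close>] up[of "A - B"] by (intro ennreal_leI) auto
    qed
    moreover have "\<nu> A \<le> measure (upper_variation \<nu>) A"
      using A by (intro up) auto
    moreover have "emeasure (upper_variation (\<lambda>B. - \<nu> B)) A = ennreal (measure (upper_variation (\<lambda>B. - \<nu> B)) A)"
      using fin(2) by (intro emeasure_eq_ennreal_measure) auto
    ultimately show ?thesis by simp
  qed
  have "- \<nu> A \<le> measure (upper_variation (\<lambda>B. - \<nu> B)) A - measure (upper_variation \<nu>) A"
    using *[OF radon_additive_minus[OF \<nu>]] fin by simp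
  with *[OF \<nu> fin] show ?thesis by simp
qed


section \<open>Densities and the Lebesgue decomposition\<close>

lemma sigma_finite_measure_bounded_borel:
  fixes M :: "(real^'n) measure"
  assumes sets: "sets M = sets borel" and fin: "\<And>B. B \<in> bounded_borel \<Longrightarrow> emeasure M B < \<infinity>"
  shows "sigma_finite_measure M"
proof
  let ?A = "range (\<lambda>n::nat. ball (0::real^'n) (real n))"
  have "(\<Union>n::nat. ball (0::real^'n) (real n)) = UNIV"
    by (auto simp: reals_Archimedean2)
  moreover have "space M = UNIV"
    using sets_eq_imp_space_eq[OF sets] by simp
  moreover have "emeasure M (ball 0 (real n)) \<noteq> \<infinity>" for n
    using fin[of "ball 0 (real n)"] by (auto simp: bounded_borel_def)
  ultimately show "\<exists>A. countable A \<and> A \<subseteq> sets M \<and> \<Union>A = space M \<and> (\<forall>a\<in>A. emeasure M a \<noteq> \<infinity>)"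
    by (intro exI[of _ ?A]) (auto simp: sets)
qed

lemma sum_measure_exists:
  assumes "sets M = sets borel" "sets N = sets (borel :: 'a::topological_space measure)"
  obtains T where "sets T = sets borel"
    "\<And>A. A \<in> sets borel \<Longrightarrow> emeasure T A = emeasure M A + emeasure N A"
proof -
  define T where "T = measure_of UNIV (sets borel :: 'a set set) (\<lambda>A. emeasure M A + emeasure N A)"
  have sa: "sigma_algebra UNIV (sets borel :: 'a set set)"
    by (metis sets.sigma_algebra_axioms space_borel)
  have "countably_additive (sets borel) (\<lambda>A. emeasure M A + emeasure N A)"
    unfolding countably_additive_def
  proof (intro allI impI)
    fix A :: "nat \<Rightarrow> 'a set" assume A: "range A \<subseteq> sets borel" "disjoint_family A"
    have "(\<Sum>i. emeasure M (A i) + emeasure N (A i)) = (\<Sum>i. emeasure M (A i)) + (\<Sum>i. emeasure N (A i))"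
      by (rule suminf_add[symmetric]) auto
    then show "(\<Sum>i. emeasure M (A i) + emeasure N (A i)) = emeasure M (\<Union>i. A i) + emeasure N (\<Union>i. A i)"
      using A assms by (simp add: suminf_emeasure)
  qed
  then have "emeasure T A = emeasure M A + emeasure N A" if "A \<in> sets borel" for A
    unfolding T_def using that sa by (intro emeasure_measure_of_sigma) (auto simp: positive_def)
  moreover have "sets T = sets borel"
    unfolding T_def by (simp add: sets.sigma_sets_eq[of borel, simplified])
  ultimately show thesis using that by blast
qed

text \<open>Domination gives absolute continuity and makes \<open>P\<close> sigma-finite. Hence the
  Radon-Nikodym derivative is finite almost everywhere, and \<open>enn2real\<close> changes it on a
  null set only.\<close>

lemma density_exists:
  fixes P T :: "(real^'n) measure"
  assumes T: "sets T = sets borel" "\<And>B. B \<in> bounded_borel \<Longrightarrow> emeasure T B < \<infinity>"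
    and P: "sets P = sets borel" "\<And>A. A \<in> sets borel \<Longrightarrow> emeasure P A \<le> emeasure T A"
  obtains p :: "real^'n \<Rightarrow> real" where "p \<in> borel_measurable borel" "\<And>x. 0 \<le> p x"
    "P = density T (\<lambda>x. ennreal (p x))"
proof -
  interpret T: sigma_finite_measure T
    by (rule sigma_finite_measure_bounded_borel[OF T])
  have P': "sigma_finite_measure P"
  proof (rule sigma_finite_measure_bounded_borel[OF P(1)])
    fix B :: "(real^'n) set" assume "B \<in> bounded_borel"
    then show "emeasure P B < \<infinity>"
      using T(2)[of B] P(2)[of B] by (auto simp: bounded_borel_def intro: order_le_less_trans)
  qed
  have ac: "absolutely_continuous T P"
    unfolding absolutely_continuous_def
  proof
    fix A assume "A \<in> null_sets T"
    then show "A \<in> null_sets P"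
      using P(2)[of A] T(1) P(1) by (auto simp: null_sets_def)
  qed
  have sP: "sets P = sets T" using T P by simp
  let ?p = "\<lambda>x. enn2real (RN_deriv T P x)"
  show thesis
  proof (rule that[of ?p])
    show "?p \<in> borel_measurable borel"
      using borel_measurable_RN_deriv[of T P] T(1)
      by (metis borel_measurable_enn2real measurable_cong_sets)
    have "density T (RN_deriv T P) = density T (\<lambda>x. ennreal (?p x))"
    proof (rule density_cong)
      show "AE x in T. RN_deriv T P x = ennreal (?p x)"
        using T.RN_deriv_finite[OF P' ac sP] by eventually_elim (auto simp: less_top)
    qed simp_all
    then show "P = density T (\<lambda>x. ennreal (?p x))"
      using T.density_RN_deriv[OF ac sP] by simp
  qed simp
qed

text \<open>A common dominating measure \<open>T\<close> turns statements about the set function \<open>\<mu>\<close> relative to Lebesgue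
  measure into statements about the two densities \<open>s\<close> and \<open>h\<close>.\<close>

definition radon_density ::
    "((real^'n) set \<Rightarrow> complex) \<Rightarrow> (real^'n) measure \<Rightarrow> (real^'n \<Rightarrow> real) \<Rightarrow> (real^'n \<Rightarrow> complex) \<Rightarrow> bool" where
  "radon_density \<mu> T h s \<longleftrightarrow> sets T = sets borel \<and>
     h \<in> borel_measurable borel \<and> (\<forall>x. 0 \<le> h x) \<and> lborel = density T (\<lambda>x. ennreal (h x)) \<and>
     s \<in> borel_measurable borel \<and>
     (\<forall>B\<in>bounded_borel. integrable T (\<lambda>x. indicator B x * s x) \<and> \<mu> B = (LINT x|T. indicator B x * s x))"

lemma radon_densityD:
  assumes "radon_density \<mu> T h s"
  shows "sets T = sets borel"
    "h \<in> borel_measurable borel" "0 \<le> h x" "lborel = density T (\<lambda>x. ennreal (h x))"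
    "s \<in> borel_measurable borel"
    "B \<in> bounded_borel \<Longrightarrow> integrable T (\<lambda>x. indicator B x * s x)"
    "B \<in> bounded_borel \<Longrightarrow> \<mu> B = (LINT x|T. indicator B x * s x)"
  using assms unfolding radon_density_def by blast+

text \<open>With \<open>T\<close> the sum of the total variation and Lebesgue measure, each of the
  four variations in \<open>integral_radon\<close> has a density, and \<open>s\<close> is their
  complex combination. The constant 4 counts these four measures, each at most the total variation.
  The last clause asks for integrability because otherwise a single one of the four integrals could
  take the default value 0.\<close>

lemma radon_representation:
  fixes \<mu> :: "(real^'n) set \<Rightarrow> complex"
  assumes \<mu>: "radon_additive \<mu>"
    and fin: "\<And>B. B \<in> bounded_borel \<Longrightarrow> emeasure (total_variation \<mu>) B < \<infinity>"
  obtains T h s where "radon_density \<mu> T h s"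
    "\<And>u. u \<in> borel_measurable borel \<Longrightarrow>
       (\<integral>\<^sup>+x. u x * ennreal (cmod (s x)) \<partial>T) \<le> 4 * (\<integral>\<^sup>+x. u x \<partial>total_variation \<mu>)"
    "\<And>g. g \<in> borel_measurable borel \<Longrightarrow> (\<integral>\<^sup>+x. ennreal (cmod (g x)) \<partial>total_variation \<mu>) < \<infinity> \<Longrightarrow>
       integrable T (\<lambda>x. g x * s x) \<and> integral_radon \<mu> g = (LINT x|T. g x * s x)"
proof -
  obtain T where T: "sets T = sets borel"
    "\<And>A. A \<in> sets borel \<Longrightarrow> emeasure T A = emeasure (total_variation \<mu>) A + emeasure lborel A"
    using sum_measure_exists[OF sets_total_variation sets_lborel] by blast
  have finT: "emeasure T B < \<infinity>" if "B \<in> bounded_borel" for B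
    using fin[OF that] that emeasure_bounded_finite[of B] T(2)[of B] by (auto simp: bounded_borel_def)
  obtain h where h: "h \<in> borel_measurable borel" "\<And>x. 0 \<le> h x" "lborel = density T (\<lambda>x. ennreal (h x))"
    by (rule density_exists[OF T(1) finT, of lborel]) (auto simp: T(2))
  have part: "\<exists>p. p \<in> borel_measurable borel \<and> (\<forall>x. 0 \<le> p x) \<and>
      upper_variation \<nu> = density T (\<lambda>x. ennreal (p x))"
    if "radon_additive \<nu>" "\<And>B. \<nu> B \<le> cmod (\<mu> B)" for \<nu>
    by (rule density_exists[OF T(1) finT, of "upper_variation \<nu>"])
       (auto simp: T(2) intro: add_increasing2 upper_variation_le_total_variation[OF \<mu> that(1) _ that(2)])
  have le: "(\<integral>\<^sup>+x. u x \<partial>upper_variation \<nu>) \<le> (\<integral>\<^sup>+x. u x \<partial>total_variation \<mu>)"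
    if "radon_additive \<nu>" "\<And>B. \<nu> B \<le> cmod (\<mu> B)" for \<nu> u
    by (rule nn_integral_mono_measure)
       (auto simp: le_measure intro: upper_variation_le_total_variation[OF \<mu> that(1) _ that(2)])
  have c: "Re z \<le> cmod z" "- Re z \<le> cmod z" "Im z \<le> cmod z" "- Im z \<le> cmod z" for z
    using complex_Re_le_cmod[of z] complex_Re_le_cmod[of "-z"]
      abs_Im_le_cmod[of z] by auto
  define \<nu>1 where "\<nu>1 = (\<lambda>B. Re (\<mu> B))"
  define \<nu>2 where "\<nu>2 = (\<lambda>B. - Re (\<mu> B))"
  define \<nu>3 where "\<nu>3 = (\<lambda>B. Im (\<mu> B))"
  define \<nu>4 where "\<nu>4 = (\<lambda>B. - Im (\<mu> B))"
  note \<nu>_def = \<nu>1_def \<nu>2_def \<nu>3_def \<nu>4_def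
  have \<nu>: "radon_additive \<nu>1" "radon_additive \<nu>2" "radon_additive \<nu>3" "radon_additive \<nu>4"
    unfolding \<nu>_def
    using radon_additive_Re[OF \<mu>] radon_additive_Im[OF \<mu>]
    by (auto intro: radon_additive_minus)
  have \<nu>le: "\<nu>1 B \<le> cmod (\<mu> B)" "\<nu>2 B \<le> cmod (\<mu> B)" "\<nu>3 B \<le> cmod (\<mu> B)" "\<nu>4 B \<le> cmod (\<mu> B)" for B
    unfolding \<nu>_def by (rule c)+
  obtain p1 p2 p3 p4 where
      p1: "p1 \<in> borel_measurable borel" "\<And>x. 0 \<le> p1 x" "upper_variation \<nu>1 = density T (\<lambda>x. ennreal (p1 x))"
    and p2: "p2 \<in> borel_measurable borel" "\<And>x. 0 \<le> p2 x" "upper_variation \<nu>2 = density T (\<lambda>x. ennreal (p2 x))"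
    and p3: "p3 \<in> borel_measurable borel" "\<And>x. 0 \<le> p3 x" "upper_variation \<nu>3 = density T (\<lambda>x. ennreal (p3 x))"
    and p4: "p4 \<in> borel_measurable borel" "\<And>x. 0 \<le> p4 x" "upper_variation \<nu>4 = density T (\<lambda>x. ennreal (p4 x))"
    using part[OF \<nu>(1) \<nu>le(1)] part[OF \<nu>(2) \<nu>le(2)] part[OF \<nu>(3) \<nu>le(3)] part[OF \<nu>(4) \<nu>le(4)]
    by metis
  note [measurable_cong] = T(1)
  note [measurable] = p1(1) p2(1) p3(1) p4(1) h(1)
  define s where "s x = complex_of_real (p1 x - p2 x) + \<i> * complex_of_real (p3 x - p4 x)" for x
  have [measurable]: "s \<in> borel_measurable borel"
    unfolding s_def by measurable
  have s: "cmod (s x) \<le> p1 x + p2 x + p3 x + p4 x" for x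
  proof -
    have "cmod (s x) \<le> \<bar>p1 x - p2 x\<bar> + \<bar>p3 x - p4 x\<bar>"
      unfolding s_def by (rule order_trans[OF norm_triangle_ineq]) (simp add: norm_mult del: of_real_diff)
    then show ?thesis using p1(2)[of x] p2(2)[of x] p3(2)[of x] p4(2)[of x] by linarith
  qed
  have dens: "(\<integral>\<^sup>+x. u x * ennreal (p x) \<partial>T) \<le> (\<integral>\<^sup>+x. u x \<partial>total_variation \<mu>)"
    if u: "u \<in> borel_measurable borel" and [measurable]: "p \<in> borel_measurable borel"
      and "upper_variation \<nu> = density T (\<lambda>x. ennreal (p x))"
      "radon_additive \<nu>" "\<And>B. \<nu> B \<le> cmod (\<mu> B)" for p u \<nu>
    using le[OF that(4,5), of u] that(3) u by (simp add: nn_integral_density mult.commute)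
  have bound: "(\<integral>\<^sup>+x. u x * ennreal (cmod (s x)) \<partial>T) \<le> 4 * (\<integral>\<^sup>+x. u x \<partial>total_variation \<mu>)"
    if u[measurable]: "u \<in> borel_measurable borel" for u
  proof -
    have "(\<integral>\<^sup>+x. u x * ennreal (cmod (s x)) \<partial>T) \<le>
        (\<integral>\<^sup>+x. u x * ennreal (p1 x) + u x * ennreal (p2 x) + u x * ennreal (p3 x) + u x * ennreal (p4 x) \<partial>T)"
      using s p1(2) p2(2) p3(2) p4(2)
      by (intro nn_integral_mono) (auto simp: distrib_left[symmetric] ennreal_plus[symmetric]
          simp del: ennreal_plus intro!: mult_left_mono ennreal_leI)
    also have "\<dots> = (\<integral>\<^sup>+x. u x * ennreal (p1 x) \<partial>T) + (\<integral>\<^sup>+x. u x * ennreal (p2 x) \<partial>T)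
        + (\<integral>\<^sup>+x. u x * ennreal (p3 x) \<partial>T) + (\<integral>\<^sup>+x. u x * ennreal (p4 x) \<partial>T)"
      by (simp add: nn_integral_add)
    also have "\<dots> \<le> (\<integral>\<^sup>+x. u x \<partial>total_variation \<mu>) + (\<integral>\<^sup>+x. u x \<partial>total_variation \<mu>)
        + (\<integral>\<^sup>+x. u x \<partial>total_variation \<mu>) + (\<integral>\<^sup>+x. u x \<partial>total_variation \<mu>)"
      by (intro add_mono dens[OF u p1(1,3) \<nu>(1) \<nu>le(1)] dens[OF u p2(1,3) \<nu>(2) \<nu>le(2)]
          dens[OF u p3(1,3) \<nu>(3) \<nu>le(3)] dens[OF u p4(1,3) \<nu>(4) \<nu>le(4)])
    also have "\<dots> = 4 * (\<integral>\<^sup>+x. u x \<partial>total_variation \<mu>)"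
    proof -
      have "(4::ennreal) = 1 + 1 + 1 + 1" by simp
      then show ?thesis by (simp only: distrib_right mult_1)
    qed
    finally show ?thesis .
  qed
  have int: "integrable T (\<lambda>x. g x * s x) \<and> integral_radon \<mu> g = (LINT x|T. g x * s x)"
    if g[measurable]: "g \<in> borel_measurable borel"
      and gfin: "(\<integral>\<^sup>+x. ennreal (cmod (g x)) \<partial>total_variation \<mu>) < \<infinity>" for g
  proof -
    have i: "integrable T (\<lambda>x. p x *\<^sub>R g x) \<and> (LINT x|upper_variation \<nu>. g x) = (LINT x|T. p x *\<^sub>R g x)"
      if [measurable]: "p \<in> borel_measurable borel" and pos: "\<And>x. 0 \<le> p x"
        and eq: "upper_variation \<nu> = density T (\<lambda>x. ennreal (p x))"
        "radon_additive \<nu>" "\<And>B. \<nu> B \<le> cmod (\<mu> B)" for p \<nu>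
    proof
      have "(\<integral>\<^sup>+x. ennreal (cmod (g x)) * ennreal (p x) \<partial>T) < \<infinity>"
        using dens[OF _ that(1) eq, of "\<lambda>x. ennreal (cmod (g x))"] gfin by (auto intro: order_le_less_trans)
      then show "integrable T (\<lambda>x. p x *\<^sub>R g x)"
        using pos by (intro integrableI_bounded) (auto simp: ennreal_mult' mult.commute)
      show "(LINT x|upper_variation \<nu>. g x) = (LINT x|T. p x *\<^sub>R g x)"
        unfolding eq(1) using pos by (intro integral_density) auto
    qed
    note i1 = i[OF p1 \<nu>(1) \<nu>le(1)] and i2 = i[OF p2 \<nu>(2) \<nu>le(2)]
      and i3 = i[OF p3 \<nu>(3) \<nu>le(3)] and i4 = i[OF p4 \<nu>(4) \<nu>le(4)]
    have eq: "g x * s x = (p1 x *\<^sub>R g x - p2 x *\<^sub>R g x) + \<i> * (p3 x *\<^sub>R g x - p4 x *\<^sub>R g x)" for x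
      unfolding s_def by (simp add: scaleR_conv_of_real algebra_simps)
    have "integral_radon \<mu> g = (LINT x|T. p1 x *\<^sub>R g x) - (LINT x|T. p2 x *\<^sub>R g x)
        + \<i> * ((LINT x|T. p3 x *\<^sub>R g x) - (LINT x|T. p4 x *\<^sub>R g x))"
      unfolding integral_radon_def \<nu>_def[symmetric] using i1 i2 i3 i4 by simp
    then show ?thesis
      unfolding eq using i1 i2 i3 i4 by simp
  qed
  have ind: "integrable T (\<lambda>x. indicator B x * s x) \<and> \<mu> B = (LINT x|T. indicator B x * s x)"
    if B: "B \<in> bounded_borel" for B
  proof -
    have Bm: "B \<in> sets borel" using B by (simp add: bounded_borel_def)
    have "(\<integral>\<^sup>+x. ennreal (cmod (indicator B x)) \<partial>total_variation \<mu>) = emeasure (total_variation \<mu>) B"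
    proof -
      have "ennreal (cmod (indicator B x)) = indicator B x" for x
        by (simp add: indicator_def)
      then show ?thesis using Bm by simp
    qed
    then have i: "integrable T (\<lambda>x. indicator B x * s x)"
        "integral_radon \<mu> (indicator B) = (LINT x|T. indicator B x * s x)"
      using int[of "indicator B"] fin[OF B] Bm by auto
    have f: "emeasure (upper_variation \<nu>) B < \<infinity>"
      if "radon_additive \<nu>" "\<And>B. \<nu> B \<le> cmod (\<mu> B)" for \<nu>
      using upper_variation_le_total_variation[OF \<mu> that(1) Bm that(2)] fin[OF B] by (rule order_le_less_trans)
    have li: "(LINT x|upper_variation \<nu>. indicator B x :: complex) = complex_of_real (measure (upper_variation \<nu>) B)" for \<nu>
    proof -
      have "(LINT x|upper_variation \<nu>. indicator B x :: complex)
          = (LINT x|upper_variation \<nu>. complex_of_real (indicat_real B x))"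
        by (intro Bochner_Integration.integral_cong) (auto simp: indicator_def)
      then show ?thesis using Bm by simp
    qed
    have "Re (\<mu> B) = measure (upper_variation \<nu>1) B - measure (upper_variation \<nu>2) B"
      using jordan_decomposition[OF \<nu>(1) B] f[OF \<nu>(1) \<nu>le(1)] f[OF \<nu>(2) \<nu>le(2)]
      by (simp add: \<nu>_def)
    moreover have "Im (\<mu> B) = measure (upper_variation \<nu>3) B - measure (upper_variation \<nu>4) B"
      using jordan_decomposition[OF \<nu>(3) B] f[OF \<nu>(3) \<nu>le(3)] f[OF \<nu>(4) \<nu>le(4)]
      by (simp add: \<nu>_def)
    \<comment> \<open>The Jordan decompositions of the real and imaginary parts turn the combination
      of variations back into the value of \<open>\<mu>\<close>.\<close>
    ultimately have "integral_radon \<mu> (indicator B) = \<mu> B"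
      unfolding integral_radon_def \<nu>_def[symmetric] li
      by (simp add: complex_eq_iff)
    with i show ?thesis by simp
  qed
  show thesis
  proof (rule that)
    show "radon_density \<mu> T h s"
      unfolding radon_density_def using T(1) h ind by auto
  qed (use bound int in auto)
qed

lemma compact_bounded_borel: "compact K \<Longrightarrow> K \<in> bounded_borel"
  by (simp add: bounded_borel_def compact_imp_bounded borel_compact)

text \<open>The zero set \<open>Z\<close> of the density \<open>h\<close> of Lebesgue measure is
  Lebesgue null and carries the singular part; off \<open>Z\<close> one may divide by
  \<open>h\<close>, and \<open>s / h\<close> is the density of the remaining part.\<close>

lemma lebesgue_decomposition_exists:
  fixes \<mu> :: "(real^'n) set \<Rightarrow> complex"
  assumes \<mu>: "complex_radon_measure \<mu>"
    and fin: "\<And>B. B \<in> bounded_borel \<Longrightarrow> emeasure (total_variation \<mu>) B < \<infinity>"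
  shows "\<exists>f \<mu>s. lebesgue_decomposition \<mu> f \<mu>s"
proof -
  have \<mu>': "radon_additive \<mu>" using \<mu> by (simp add: complex_radon_measure_eq)
  obtain T h s where rd: "radon_density \<mu> T h s"
    by (rule radon_representation[OF \<mu>' fin])
  note T = radon_densityD(1)[OF rd] and h = radon_densityD(2-4)[OF rd]
    and s = radon_densityD(5)[OF rd] and ind = radon_densityD(6,7)[OF rd]
  note [measurable_cong] = T
  note [measurable] = h(1) s(1)
  define Z where "Z = {x. h x = 0}"
  have Z [measurable]: "Z \<in> sets borel" unfolding Z_def by measurable
  define f where "f x = s x / complex_of_real (h x)" for x
  have [measurable]: "f \<in> borel_measurable borel" unfolding f_def by measurable
  define \<mu>s where "\<mu>s B = \<mu> (B \<inter> Z)" for B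
  have f: "integrable lborel (\<lambda>x. indicator B x *\<^sub>R f x)"
      "(LINT x|lborel. indicator B x *\<^sub>R f x) = \<mu> (B - Z)"
    if B: "B \<in> bounded_borel" for B
  proof -
    have [measurable]: "B \<in> sets borel" using B by (simp add: bounded_borel_def)
    have eq: "h x *\<^sub>R (indicator B x *\<^sub>R f x) = indicator (B - Z) x * s x" for x
      by (auto simp: f_def Z_def indicator_def scaleR_conv_of_real)
    note BZ = ind[OF bounded_borel_Diff[OF B Z]]
    show "integrable lborel (\<lambda>x. indicator B x *\<^sub>R f x)"
      unfolding h(3) using h(2) BZ by (subst integrable_density) (auto simp: eq simp del: scaleR_scaleR)
    show "(LINT x|lborel. indicator B x *\<^sub>R f x) = \<mu> (B - Z)"
      unfolding h(3) using h(2) BZ by (subst integral_density) (auto simp: eq simp del: scaleR_scaleR)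
  qed
  have "f \<in> L1_loc"
    unfolding L1_loc_def set_integrable_def
    using f(1) compact_bounded_borel by (auto intro!: integrable_completion[THEN iffD2] borel_measurable_integrable)
  moreover have radon: "radon_additive \<mu>s"
    unfolding radon_additive_def \<mu>s_def
  proof (intro allI impI)
    fix A :: "nat \<Rightarrow> (real^'n) set"
    assume A: "range A \<subseteq> bounded_borel" "disjoint_family A" "bounded (\<Union>i. A i)"
    have "(\<lambda>i. \<mu> (A i \<inter> Z)) sums \<mu> (\<Union>i. A i \<inter> Z)"
    proof (intro \<mu>'[unfolded radon_additive_def, rule_format])
      show "range (\<lambda>i. A i \<inter> Z) \<subseteq> bounded_borel"
        using A(1) bounded_borel_Int[OF _ Z] by blast
      show "disjoint_family (\<lambda>i. A i \<inter> Z)"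
        using A(2) by (auto simp: disjoint_family_on_def)
      show "bounded (\<Union>i. A i \<inter> Z)"
        by (rule bounded_subset[OF A(3)]) auto
    qed
    then show "(\<lambda>i. \<mu> (A i \<inter> Z)) sums \<mu> ((\<Union>i. A i) \<inter> Z)" by simp
  qed
  moreover have "singular_radon \<mu>s"
    unfolding singular_radon_def
  proof
    have "emeasure lborel Z = 0"
    proof -
      have "ennreal (h x) * indicator Z x = 0" for x
        by (cases "h x = 0") (auto simp: Z_def indicator_def)
      then show ?thesis
        unfolding h(3) using Z by (subst emeasure_density) (simp_all del: mult_eq_0_iff)
    qed
    then show "Z \<in> null_sets lborel" by auto
    have "- Z \<in> sets borel" using Z by (rule borel_comp)
    note e = emeasure_total_variation[OF radon this]
    show "emeasure (total_variation \<mu>s) (- Z) = 0"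
      unfolding e
    proof (rule antisym[OF SUP_least])
      fix P assume P: "P \<in> {P. finite P \<and> disjoint P \<and> P \<subseteq> bounded_borel \<and> \<Union> P \<subseteq> - Z}"
      have "cmod (\<mu>s B) = 0" if "B \<in> P" for B
      proof -
        have "B \<inter> Z = {}" using P that by blast
        then show ?thesis by (simp add: \<mu>s_def radon_additive_empty[OF \<mu>'])
      qed
      then show "(\<Sum>B\<in>P. ennreal (cmod (\<mu>s B))) \<le> 0" by simp
    qed simp
  qed
  moreover have "\<mu> B = (LINT x:B|lebesgue. f x) + \<mu>s B" if B: "B \<in> bounded_borel" for B
  proof -
    have "(LINT x:B|lebesgue. f x) = (LINT x|lborel. indicator B x *\<^sub>R f x)"
      unfolding set_lebesgue_integral_def
      by (rule integral_completion) (use B in \<open>auto simp: bounded_borel_def\<close>)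
    then show ?thesis
      using f(2)[OF B] radon_additive_Diff[OF \<mu>' B Z] by (simp add: \<mu>s_def)
  qed
  ultimately show ?thesis
    unfolding lebesgue_decomposition_def complex_radon_measure_eq by blast
qed


section \<open>Differentiation of measures\<close>

text \<open>Where the ratio exceeds \<open>c\<close> at arbitrarily small radii, Vitali's theorem
  selects disjoint balls with that property inside an open set of small
  \<open>\<rho>\<close>-measure, which exists by outer regularity since \<open>\<rho>\<close>
  vanishes on \<open>A\<close>. Summing over the balls, \<open>c\<close> times their volume is at
  most the \<open>\<rho>\<close>-measure of the open set, so the exceptional set has arbitrarily
  small outer measure.\<close>

lemma null_set_zero_density:
  fixes \<rho> :: "(real^'n) measure"
  assumes sets: "sets \<rho> = sets borel" and fin: "\<And>B. B \<in> bounded_borel \<Longrightarrow> emeasure \<rho> B < \<infinity>"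
    and A: "A \<in> sets borel" "emeasure \<rho> A = 0"
  shows "\<exists>N. negligible N \<and> (\<forall>x\<in>A - N. \<forall>e>0. \<exists>d>0. \<forall>r. 0 < r \<longrightarrow> r < d \<longrightarrow>
           emeasure \<rho> (cball x r) \<le> ennreal e * emeasure lborel (cball x r))"
proof -
  define E where "E c k = {x \<in> A \<inter> ball 0 (real k). \<forall>d>0. \<exists>r. 0 < r \<and> r < d \<and>
      ennreal c * emeasure lborel (cball x r) < emeasure \<rho> (cball x r)}" for c :: real and k :: nat
  note [simp] = sets sets_eq_imp_space_eq[OF sets]
  have neg: "negligible (E c k)" if "c > 0" for c k
    \<comment> \<open>\<open>E c k\<close> is not shown to be measurable; it is enclosed in a
      measurable set of measure at most \<open>e\<close>, namely the selected balls together with a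
      negligible remainder.\<close>
    unfolding negligible_outer_le
  proof (intro allI impI)
    fix e :: real assume "e > 0"
    \<comment> \<open>Outer regularity is applied to a finite measure, hence the restriction to a
      ball; this is the purpose of the index \<open>k\<close>.\<close>
    define \<rho>k where "\<rho>k = density \<rho> (indicator (ball 0 (real k)))"
    have em: "emeasure \<rho>k B = emeasure \<rho> (ball 0 (real k) \<inter> B)" if "B \<in> sets borel" for B
      unfolding \<rho>k_def using that by (subst emeasure_density) (auto simp: indicator_inter_arith[symmetric] intro!: borel_measurable_indicator)
    have "emeasure \<rho>k A = (INF U\<in>{U. A \<subseteq> U \<and> open U}. emeasure \<rho>k U)"
    proof (rule outer_regular)
      show "sets \<rho>k = sets borel" by (simp add: \<rho>k_def)
      have "ball 0 (real k) \<in> (bounded_borel :: (real^'n) set set)"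
        by (simp add: bounded_borel_def)
      from fin[OF this] show "emeasure \<rho>k (space \<rho>k) \<noteq> \<infinity>"
        using em[of UNIV] by (simp add: \<rho>k_def)
    qed fact
    moreover have "emeasure \<rho>k A = 0"
      using A em[OF A(1)] by (metis Int_lower2 emeasure_mono le_zero_eq sets)
    ultimately have "(INF U\<in>{U. A \<subseteq> U \<and> open U}. emeasure \<rho>k U) < ennreal (c * e)"
      using \<open>c > 0\<close> \<open>e > 0\<close> by simp
    then obtain U where U: "A \<subseteq> U" "open U" "emeasure \<rho>k U < ennreal (c * e)"
      unfolding INF_less_iff by blast
    define U' where "U' = ball 0 (real k) \<inter> U"
    have U': "open U'" "emeasure \<rho> U' < ennreal (c * e)" "E c k \<subseteq> U'"
      using U em[of U] by (auto simp: U'_def E_def)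
    define K where "K = {(x, r). 0 < r \<and> cball x r \<subseteq> U' \<and>
      ennreal c * emeasure lborel (cball x r) < emeasure \<rho> (cball x r)}"
    obtain C where C: "countable C" "C \<subseteq> K"
     "pairwise (\<lambda>i j. disjnt (cball (fst i) (snd i)) (cball (fst j) (snd j))) C"
     "negligible (E c k - (\<Union>i \<in> C. cball (fst i) (snd i)))"
    proof (rule Vitali_covering_theorem_cballs[of K snd "E c k" fst])
      show "0 < snd i" if "i \<in> K" for i using that by (auto simp: K_def)
      fix x d assume x: "x \<in> E c k" and "0 < (d::real)"
      obtain d' where d': "d' > 0" "cball x d' \<subseteq> U'"
        using U'(1,3) x open_contains_cball by blast
      have "min d d' > 0" using \<open>0 < d\<close> d' by simp
      then obtain r where r: "0 < r" "r < min d d'"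
        "ennreal c * emeasure lborel (cball x r) < emeasure \<rho> (cball x r)"
        using x unfolding E_def by blast
      then have "cball x r \<subseteq> U'" using d' by (auto intro: order_trans[OF subset_cball])
      then have "(x, r) \<in> K" using r by (auto simp: K_def)
      then show "\<exists>i. i \<in> K \<and> x \<in> cball (fst i) (snd i) \<and> snd i < d"
        using r by (intro exI[of _ "(x, r)"]) auto
    qed blast
    define W where "W = (\<Union>i \<in> C. cball (fst i) (snd i))"
    have W: "W \<in> sets borel" unfolding W_def using C(1) by (intro sets.countable_UN') auto
    have dis: "disjoint_family_on (\<lambda>i. cball (fst i) (snd i)) C"
      using C(3) by (auto simp: disjoint_family_on_def pairwise_def disjnt_def)
    have "cball (fst i) (snd i) \<subseteq> U'" if "i \<in> C" for i
    proof -
      have "i \<in> K" using C(2) that by blast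
      then show ?thesis by (cases i) (simp add: K_def)
    qed
    then have WU: "W \<subseteq> U'" unfolding W_def by blast
    have "ennreal c * emeasure lborel W
        = (\<integral>\<^sup>+i. ennreal c * emeasure lborel (cball (fst i) (snd i)) \<partial>count_space C)"
      unfolding W_def using C(1) dis by (subst emeasure_UN_countable) (auto simp: nn_integral_cmult)
    also have "\<dots> \<le> (\<integral>\<^sup>+i. emeasure \<rho> (cball (fst i) (snd i)) \<partial>count_space C)"
      using C(2) by (intro nn_integral_mono) (auto simp: K_def)
    also have "\<dots> = emeasure \<rho> W"
      unfolding W_def using C(1) dis by (subst emeasure_UN_countable) auto
    also have "\<dots> \<le> emeasure \<rho> U'"
      using WU U'(1) by (intro emeasure_mono) auto
    finally have "ennreal c * emeasure lborel W \<le> ennreal (c * e)"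
      using U'(2) by simp
    then have "ennreal c * emeasure lborel W \<le> ennreal c * ennreal e"
      using \<open>c > 0\<close> \<open>e > 0\<close> by (simp add: ennreal_mult)
    then have We: "emeasure lborel W \<le> ennreal e"
      using \<open>c > 0\<close> by (subst (asm) ennreal_mult_le_mult_iff) auto
    have Wl: "W \<in> lmeasurable" using W We by (intro fmeasurableI) (auto simp: top_unique intro: le_less_trans)
    show "\<exists>T. E c k \<subseteq> T \<and> T \<in> lmeasurable \<and> measure lebesgue T \<le> e"
    proof (intro exI[of _ "W \<union> (E c k - W)"] conjI)
      show "W \<union> (E c k - W) \<in> lmeasurable"
        by (rule fmeasurable.Un[OF Wl negligible_imp_measurable[OF C(4)[folded W_def]]])
      have "measure lebesgue (W \<union> (E c k - W)) \<le> measure lebesgue W + measure lebesgue (E c k - W)"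
        using Wl C(4) by (intro measure_Un_le) (auto simp: W_def dest: negligible_imp_sets fmeasurableD)
      also have "\<dots> = measure lborel W"
        using C(4) W by (simp add: W_def[symmetric] negligible_imp_measure0)
      also have "\<dots> \<le> e" using We \<open>e > 0\<close> by (simp add: measure_def enn2real_leI)
      finally show "measure lebesgue (W \<union> (E c k - W)) \<le> e" .
    qed auto
  qed
  define N where "N = (\<Union>j. \<Union>k. E (1 / real (Suc j)) k)"
  have "negligible N"
    unfolding N_def by (intro negligible_countable_Union) (auto intro!: negligible_countable_Union neg)
  moreover have "\<exists>d>0. \<forall>r. 0 < r \<longrightarrow> r < d \<longrightarrow>
        emeasure \<rho> (cball x r) \<le> ennreal e * emeasure lborel (cball x r)"
    if x: "x \<in> A - N" and e: "e > 0" for x and e :: real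
  proof -
    obtain j where j: "1 / real (Suc j) < e" using e by (rule nat_approx_posE)
    obtain k where "norm x < real k" using reals_Archimedean2 by blast
    then have "x \<notin> E (1 / real (Suc j)) k" "x \<in> A \<inter> ball 0 (real k)" using x by (auto simp: N_def)
    then obtain d where "d > 0" "\<not> (\<exists>r. 0 < r \<and> r < d \<and>
        ennreal (1 / real (Suc j)) * emeasure lborel (cball x r) < emeasure \<rho> (cball x r))"
      unfolding E_def by blast
    then have d: "d > 0" "\<And>r. 0 < r \<Longrightarrow> r < d \<Longrightarrow>
        emeasure \<rho> (cball x r) \<le> ennreal (1 / real (Suc j)) * emeasure lborel (cball x r)"
      by (auto simp: not_less[symmetric] simp del: of_nat_Suc)
    have "ennreal (1 / real (Suc j)) * emeasure lborel (cball x r) \<le> ennreal e * emeasure lborel (cball x r)" for r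
      using j by (intro mult_right_mono ennreal_leI) auto
    then show ?thesis using d by (meson order_trans)
  qed
  ultimately show ?thesis by blast
qed

text \<open>Approximate \<open>g x\<close> by a constant \<open>c\<close> from a countable dense
  set. The part of the measure with density \<open>cmod (g - c)\<close> that lies where this density
  exceeds \<open>1 / (j + 1)\<close> has zero density at almost every other point. Only countably
  many null sets are removed, although \<open>g\<close> may take uncountably many values.\<close>

lemma lebesgue_points:
  fixes g :: "real^'n \<Rightarrow> complex"
  assumes g: "g \<in> borel_measurable borel"
    and fin: "\<And>B. B \<in> bounded_borel \<Longrightarrow> (\<integral>\<^sup>+y\<in>B. ennreal (cmod (g y)) \<partial>lborel) < \<infinity>"
  shows "\<exists>N. negligible N \<and> (\<forall>x\<in>- N. \<forall>e>0. \<exists>d>0. \<forall>r. 0 < r \<longrightarrow> r < d \<longrightarrow>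
           (\<integral>\<^sup>+y\<in>cball x r. ennreal (cmod (g y - g x)) \<partial>lborel)
             \<le> ennreal e * emeasure lborel (cball x r))"
proof -
  note [measurable] = g
  obtain C :: "complex set" where C: "countable C" "\<And>X. open X \<Longrightarrow> X \<noteq> {} \<Longrightarrow> \<exists>d\<in>C. d \<in> X"
    using countable_dense_setE by blast
  define A where "A c j = {x. cmod (g x - c) \<le> 1 / real (Suc j)}" for c :: complex and j :: nat
  have [measurable]: "A c j \<in> sets borel" for c j unfolding A_def by measurable
  define \<rho> where "\<rho> c j = density lborel (\<lambda>y. ennreal (cmod (g y - c)) * indicator (- A c j) y)" for c j
  have \<rho>: "emeasure (\<rho> c j) B = (\<integral>\<^sup>+y\<in>B. ennreal (cmod (g y - c)) * indicator (- A c j) y \<partial>lborel)"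
    if "B \<in> sets borel" for B c j
    unfolding \<rho>_def using that by (subst emeasure_density) auto
  have finc: "(\<integral>\<^sup>+y\<in>B. ennreal (cmod (g y - c)) \<partial>lborel) < \<infinity>" if B: "B \<in> bounded_borel" for B c
  proof -
    have [measurable]: "B \<in> sets borel" using B by (simp add: bounded_borel_def)
    have "(\<integral>\<^sup>+y\<in>B. ennreal (cmod (g y - c)) \<partial>lborel) \<le>
       (\<integral>\<^sup>+y. ennreal (cmod (g y)) * indicator B y + ennreal (cmod c) * indicator B y \<partial>lborel)"
      by (intro nn_integral_mono) (auto simp: indicator_def ennreal_plus[symmetric] norm_triangle_ineq4
          simp del: ennreal_plus)
    also have "\<dots> = (\<integral>\<^sup>+y\<in>B. ennreal (cmod (g y)) \<partial>lborel) + ennreal (cmod c) * emeasure lborel B"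
      by (subst nn_integral_add) (auto simp: nn_integral_cmult)
    also have "\<dots> < \<infinity>"
      using fin[OF B] emeasure_bounded_finite[of B] B by (auto simp: bounded_borel_def ennreal_mult_less_top)
    finally show ?thesis .
  qed
  have "\<exists>N. negligible N \<and> (\<forall>x\<in>A c j - N. \<forall>e>0. \<exists>d>0. \<forall>r. 0 < r \<longrightarrow> r < d \<longrightarrow>
           emeasure (\<rho> c j) (cball x r) \<le> ennreal e * emeasure lborel (cball x r))" for c j
  proof (rule null_set_zero_density)
    show "sets (\<rho> c j) = sets borel" by (simp add: \<rho>_def)
    fix B :: "(real^'n) set" assume B: "B \<in> bounded_borel"
    have "emeasure (\<rho> c j) B \<le> (\<integral>\<^sup>+y\<in>B. ennreal (cmod (g y - c)) \<partial>lborel)"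
      using B by (subst \<rho>) (auto simp: bounded_borel_def indicator_def intro!: nn_integral_mono)
    also have "\<dots> < \<infinity>" by (rule finc[OF B])
    finally show "emeasure (\<rho> c j) B < \<infinity>" .
  next
    have "ennreal (cmod (g y - c)) * indicator (- A c j) y * indicator (A c j) y = 0" for y
      by (simp add: indicator_def)
    then show "emeasure (\<rho> c j) (A c j) = 0"
      by (subst \<rho>) (simp_all del: mult_eq_0_iff)
  qed measurable
  then obtain N where N: "\<And>c j. negligible (N c j)" "\<And>c j x e. x \<in> A c j - N c j \<Longrightarrow> e > 0 \<Longrightarrow>
     \<exists>d>0. \<forall>r. 0 < r \<longrightarrow> r < d \<longrightarrow>
           emeasure (\<rho> c j) (cball x r) \<le> ennreal e * emeasure lborel (cball x r)"
    by metis
  have "negligible (\<Union>c\<in>C. \<Union>j. N c j)"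
    using C(1) N(1) by (intro negligible_countable_Union) (auto intro!: negligible_countable_Union)
  moreover have "\<exists>d>0. \<forall>r. 0 < r \<longrightarrow> r < d \<longrightarrow>
           (\<integral>\<^sup>+y\<in>cball x r. ennreal (cmod (g y - g x)) \<partial>lborel)
             \<le> ennreal e * emeasure lborel (cball x r)"
    if x: "x \<in> - (\<Union>c\<in>C. \<Union>j. N c j)" and e: "e > 0" for x and e :: real
  proof -
    have "e / 3 > 0" using e by simp
    \<comment> \<open>One third of \<open>e\<close> pays for the distance from \<open>g x\<close> to
      \<open>c\<close>, one for the distance from \<open>g y\<close> to \<open>c\<close> when
      \<open>y\<close> lies in \<open>A c j\<close>, and one for the remaining \<open>y\<close>,
      where the zero density is used.\<close>
    then obtain j where j: "1 / real (Suc j) < e / 3" by (rule nat_approx_posE)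
    define \<delta> where "\<delta> = 1 / real (Suc j)"
    have \<delta>: "\<delta> > 0" "\<delta> < e / 3" using j by (auto simp: \<delta>_def)
    obtain c where c: "c \<in> C" "c \<in> ball (g x) \<delta>" using C(2)[of "ball (g x) \<delta>"] \<delta> by auto
    then have xA: "x \<in> A c j - N c j" using x by (auto simp: A_def \<delta>_def dist_norm)
    obtain d where d: "d > 0" "\<And>r. 0 < r \<Longrightarrow> r < d \<Longrightarrow>
        emeasure (\<rho> c j) (cball x r) \<le> ennreal (e / 3) * emeasure lborel (cball x r)"
      using N(2)[OF xA, of "e / 3"] e by auto
    show ?thesis
    proof (intro exI[of _ d] conjI allI impI)
      fix r assume r: "0 < r" "r < d"
      have [measurable]: "cball x r \<in> sets borel" by simp
      have "(\<integral>\<^sup>+y\<in>cball x r. ennreal (cmod (g y - g x)) \<partial>lborel) \<le>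
        (\<integral>\<^sup>+y. ennreal (cmod (g y - c)) * indicator (- A c j) y * indicator (cball x r) y
           + ennreal (e / 3 + e / 3) * indicator (cball x r) y \<partial>lborel)"
      proof (rule nn_integral_mono)
        fix y
        have "cmod (g y - g x) \<le> cmod (g y - c) + cmod (g x - c)"
          using norm_triangle_ineq4[of "g y - c" "g x - c"] by simp
        moreover have "cmod (g x - c) < e / 3" using c(2) \<delta> by (simp add: dist_norm)
        moreover have "y \<in> A c j \<Longrightarrow> cmod (g y - c) \<le> e / 3" using \<delta> by (auto simp: A_def \<delta>_def)
        ultimately show "ennreal (cmod (g y - g x)) * indicator (cball x r) y \<le>
          ennreal (cmod (g y - c)) * indicator (- A c j) y * indicator (cball x r) y
           + ennreal (e / 3 + e / 3) * indicator (cball x r) y"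
          using e by (cases "y \<in> A c j") (auto simp: indicator_def ennreal_plus[symmetric] intro!: ennreal_leI
             simp del: ennreal_plus)
      qed
      also have "\<dots> = emeasure (\<rho> c j) (cball x r) + ennreal (e / 3 + e / 3) * emeasure lborel (cball x r)"
        by (subst nn_integral_add) (simp_all add: nn_integral_cmult_indicator \<rho>)
      also have "\<dots> \<le> ennreal (e / 3) * emeasure lborel (cball x r) + ennreal (e / 3 + e / 3) * emeasure lborel (cball x r)"
        by (intro add_right_mono d(2) r)
      also have "\<dots> = ennreal e * emeasure lborel (cball x r)"
      proof -
        have "ennreal (e / 3) + ennreal (e / 3 + e / 3) = ennreal (e / 3 + (e / 3 + e / 3))"
          using e by (intro ennreal_plus[symmetric]) auto
        also have "e / 3 + (e / 3 + e / 3) = e" by simp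
        finally show ?thesis by (simp only: distrib_right[symmetric])
      qed
      finally show "(\<integral>\<^sup>+y\<in>cball x r. ennreal (cmod (g y - g x)) \<partial>lborel)
             \<le> ennreal e * emeasure lborel (cball x r)" .
    qed (rule d)
  qed
  ultimately show ?thesis by blast
qed

section \<open>Borel representatives of locally integrable functions\<close>

lemma complex_completion_ex_borel_measurable:
  fixes f :: "'a \<Rightarrow> complex"
  assumes "f \<in> borel_measurable (completion M)"
  shows "\<exists>g\<in>borel_measurable M. AE x in M. f x = g x"
proof -
  have "(\<lambda>x. Re (f x)) \<in> borel_measurable (completion M)" "(\<lambda>x. Im (f x)) \<in> borel_measurable (completion M)"
    using assms by measurable
  from this[THEN completion_ex_borel_measurable_real]
  obtain a b where [measurable]: "a \<in> borel_measurable M" "b \<in> borel_measurable M"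
    and ae: "AE x in M. Re (f x) = a x" "AE x in M. Im (f x) = b x"
    by blast
  have "AE x in M. f x = Complex (a x) (b x)"
    using ae by eventually_elim (simp add: complex_eq_iff)
  moreover have "(\<lambda>x. complex_of_real (a x) + \<i> * complex_of_real (b x)) \<in> borel_measurable M"
    by measurable
  ultimately show ?thesis
    by (intro bexI[of _ "\<lambda>x. Complex (a x) (b x)"]) (auto simp: Complex_eq)
qed

lemma L1_loc_borel_measurable:
  fixes f :: "real^'n \<Rightarrow> complex"
  assumes "f \<in> L1_loc"
  shows "f \<in> borel_measurable lebesgue"
proof (rule borel_measurable_LIMSEQ_metric)
  fix i :: nat
  have "set_integrable lebesgue (cball 0 (real i)) f"
    using assms by (auto simp: L1_loc_def)
  then show "(\<lambda>x. indicator (cball 0 (real i)) x *\<^sub>R f x) \<in> borel_measurable lebesgue"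
    unfolding set_integrable_def by (rule borel_measurable_integrable)
next
  fix x :: "real^'n"
  obtain k :: nat where "norm x < real k" using reals_Archimedean2 by blast
  then have "\<forall>i\<ge>k. indicator (cball 0 (real i)) x *\<^sub>R f x = f x"
    by (auto simp: indicator_def)
  then have "\<forall>\<^sub>F i in sequentially. indicator (cball 0 (real i)) x *\<^sub>R f x = f x"
    using eventually_sequentially by blast
  then show "(\<lambda>i. indicator (cball 0 (real i)) x *\<^sub>R f x) \<longlonglongrightarrow> f x"
    by (rule tendsto_eventually)
qed

text \<open>Local integrability yields Lebesgue measurability only, while the differentiation lemmas
  concern Borel functions and \<open>lborel\<close>; this is the bridge between the two.\<close>

lemma L1_loc_borel_representative:
  fixes f :: "real^'n \<Rightarrow> complex"
  assumes f: "f \<in> L1_loc"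
  obtains g where "g \<in> borel_measurable borel" "AE x in lebesgue. f x = g x"
    "\<And>B. B \<in> bounded_borel \<Longrightarrow> (\<integral>\<^sup>+y\<in>B. ennreal (cmod (g y)) \<partial>lborel) < \<infinity>"
    "\<And>B. B \<in> bounded_borel \<Longrightarrow> integrable lborel (\<lambda>y. indicator B y *\<^sub>R g y)"
    "\<And>B. B \<in> bounded_borel \<Longrightarrow> (LINT x:B|lebesgue. f x) = (LINT y|lborel. indicator B y *\<^sub>R g y)"
proof -
  obtain g where g: "g \<in> borel_measurable lborel" "AE x in lborel. f x = g x"
    using complex_completion_ex_borel_measurable[OF L1_loc_borel_measurable[OF f]] by blast
  have [measurable]: "g \<in> borel_measurable borel" using g(1) by simp
  have ae: "AE x in lebesgue. f x = g x"
    using AE_completion[OF g(2)] .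
  have fm: "f \<in> borel_measurable lebesgue" by (rule L1_loc_borel_measurable[OF f])
  have gm: "g \<in> borel_measurable lebesgue" using g(1) by (rule measurable_completion)
  have int: "integrable lborel (\<lambda>y. indicator B y *\<^sub>R g y)" if B: "B \<in> bounded_borel" for B
  proof -
    have [measurable]: "B \<in> sets borel" using B by (simp add: bounded_borel_def)
    have K: "compact (closure B)" using B by (simp add: bounded_borel_def)
    have "set_integrable lebesgue (closure B) f" using f K by (auto simp: L1_loc_def)
    then have "set_integrable lebesgue B f"
      by (rule set_integrable_subset) (auto simp: closure_subset)
    then have "integrable lebesgue (\<lambda>y. indicator B y *\<^sub>R g y)"
      unfolding set_integrable_def
      by (rule integrable_cong_AE_imp) (use ae gm in \<open>auto elim!: eventually_mono intro!: borel_measurable_scaleR borel_measurable_indicator\<close>)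
    then show ?thesis
      by (subst (asm) integrable_completion) auto
  qed
  show thesis
  proof (rule that[of g])
    fix B :: "(real^'n) set" assume B: "B \<in> bounded_borel"
    then have [measurable]: "B \<in> sets borel" by (simp add: bounded_borel_def)
    show "(\<integral>\<^sup>+y\<in>B. ennreal (cmod (g y)) \<partial>lborel) < \<infinity>"
    proof -
      have "(\<integral>\<^sup>+y. ennreal (norm (indicator B y *\<^sub>R g y)) \<partial>lborel) < \<infinity>"
        using int[OF B] by (simp add: integrable_iff_bounded)
      moreover have "ennreal (norm (indicator B y *\<^sub>R g y)) = ennreal (cmod (g y)) * indicator B y" for y
        by (simp add: indicator_def)
      ultimately show ?thesis by simp
    qed
    have "(LINT x:B|lebesgue. f x) = (LINT y|lebesgue. indicator B y *\<^sub>R g y)"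
      unfolding set_lebesgue_integral_def using ae fm gm
      by (intro integral_cong_AE) (auto elim!: eventually_mono intro!: borel_measurable_scaleR borel_measurable_indicator)
    then show "(LINT x:B|lebesgue. f x) = (LINT y|lborel. indicator B y *\<^sub>R g y)"
      by (subst (asm) integral_completion) auto
  qed (use ae int in auto)
qed

text \<open>Competitor by competitor, the total variation of the singular part is at most that of
  \<open>\<mu>\<close> plus the measure with density \<open>cmod f\<close>. This supplies the local
  finiteness under which a measure vanishing on a set has zero density almost everywhere on
  it.\<close>

lemma total_variation_singular_part_finite:
  fixes \<mu> :: "(real^'n) set \<Rightarrow> complex"
  assumes \<mu>: "complex_radon_measure \<mu>" and dec: "lebesgue_decomposition \<mu> f \<mu>s"
    and fin: "\<And>B. B \<in> bounded_borel \<Longrightarrow> emeasure (total_variation \<mu>) B < \<infinity>"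
    and A: "A \<in> bounded_borel"
  shows "emeasure (total_variation \<mu>s) A < \<infinity>"
proof -
  have f: "f \<in> L1_loc" and \<mu>s: "radon_additive \<mu>s"
    and eq: "\<And>B. B \<in> bounded_borel \<Longrightarrow> \<mu> B = (LINT x:B|lebesgue. f x) + \<mu>s B"
    using dec by (auto simp: lebesgue_decomposition_def complex_radon_measure_eq)
  have \<mu>': "radon_additive \<mu>" using \<mu> by (simp add: complex_radon_measure_eq)
  have Ab: "A \<in> sets borel" using A by (simp add: bounded_borel_def)
  obtain g where g [measurable]: "g \<in> borel_measurable borel" and "AE x in lebesgue. f x = g x"
    and gfin: "\<And>B. B \<in> bounded_borel \<Longrightarrow> (\<integral>\<^sup>+y\<in>B. ennreal (cmod (g y)) \<partial>lborel) < \<infinity>"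
    and gint: "\<And>B. B \<in> bounded_borel \<Longrightarrow> integrable lborel (\<lambda>y. indicator B y *\<^sub>R g y)"
    and geq: "\<And>B. B \<in> bounded_borel \<Longrightarrow> (LINT x:B|lebesgue. f x) = (LINT y|lborel. indicator B y *\<^sub>R g y)"
    by (rule L1_loc_borel_representative[OF f], rule that, assumption+)
  define \<eta> where "\<eta> = density lborel (\<lambda>y. ennreal (cmod (g y)))"
  have \<eta>: "emeasure \<eta> B = (\<integral>\<^sup>+y\<in>B. ennreal (cmod (g y)) \<partial>lborel)" if "B \<in> sets borel" for B
    unfolding \<eta>_def using that by (subst emeasure_density) auto
  have "emeasure (total_variation \<mu>s) A \<le> emeasure (total_variation \<mu>) A + emeasure \<eta> A"
    unfolding emeasure_total_variation[OF \<mu>s Ab]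
  proof (rule SUP_least)
    fix P assume P: "P \<in> {P. finite P \<and> disjoint P \<and> P \<subseteq> bounded_borel \<and> \<Union> P \<subseteq> A}"
    have Pb: "B \<in> bounded_borel" "B \<in> sets borel" if "B \<in> P" for B
      using P that by (auto simp: bounded_borel_def)
    have "ennreal (cmod (\<mu>s B)) \<le> ennreal (cmod (\<mu> B)) + emeasure \<eta> B" if "B \<in> P" for B
    proof -
      have "ennreal (cmod (LINT y|lborel. indicator B y *\<^sub>R g y)) \<le> (\<integral>\<^sup>+y. ennreal (norm (indicator B y *\<^sub>R g y)) \<partial>lborel)"
        by (rule integral_norm_bound_ennreal[OF gint[OF Pb(1)[OF that]]])
      also have "\<dots> = emeasure \<eta> B"
        unfolding \<eta>[OF Pb(2)[OF that]] by (intro nn_integral_cong) (simp add: indicator_def)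
      finally have "ennreal (cmod (LINT x:B|lebesgue. f x)) \<le> emeasure \<eta> B"
        using geq[OF Pb(1)[OF that]] by simp
      moreover have "ennreal (cmod (\<mu>s B)) \<le> ennreal (cmod (\<mu> B)) + ennreal (cmod (LINT x:B|lebesgue. f x))"
        using eq[OF Pb(1)[OF that]] norm_triangle_ineq4[of "\<mu> B" "LINT x:B|lebesgue. f x"]
        by (simp add: ennreal_plus[symmetric] del: ennreal_plus)
      ultimately show ?thesis by (meson add_left_mono order_trans)
    qed
    then have "(\<Sum>B\<in>P. ennreal (cmod (\<mu>s B))) \<le> (\<Sum>B\<in>P. ennreal (cmod (\<mu> B)) + emeasure \<eta> B)"
      by (rule sum_mono)
    also have "\<dots> = (\<Sum>B\<in>P. ennreal (cmod (\<mu> B))) + (\<Sum>B\<in>P. emeasure \<eta> B)"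
      by (rule sum.distrib)
    also have "(\<Sum>B\<in>P. emeasure \<eta> B) = emeasure \<eta> (\<Union>P)"
    proof -
      have "disjoint_family_on (\<lambda>B. B) P" using P by (auto simp: disjoint_family_on_def disjoint_def)
      then have "(\<Sum>B\<in>P. emeasure \<eta> B) = emeasure \<eta> (\<Union>B\<in>P. B)"
        using P Pb by (intro sum_emeasure) (auto simp: \<eta>_def)
      then show ?thesis by simp
    qed
    also have "(\<Sum>B\<in>P. ennreal (cmod (\<mu> B))) \<le> emeasure (total_variation \<mu>) A"
      unfolding emeasure_total_variation[OF \<mu>' Ab] by (rule SUP_upper) (use P in simp)
    also have "emeasure \<eta> (\<Union>P) \<le> emeasure \<eta> A"
      using P Ab by (intro emeasure_mono) (auto simp: \<eta>_def)
    finally show "(\<Sum>B\<in>P. ennreal (cmod (\<mu>s B))) \<le> emeasure (total_variation \<mu>) A + emeasure \<eta> A"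
      by (simp add: add_left_mono add_right_mono)
  qed
  also have "\<dots> < \<infinity>"
    using fin[OF A] gfin[OF A] \<eta>[OF Ab] by simp
  finally show ?thesis .
qed

lemma measure_ball_eq:
  "measure lborel (ball (x::real^'n) r) = measure lborel (ball (0::real^'n) 1) * r ^ CARD('n)" if "r \<ge> 0"
  using content_ball_conv_unit_ball[of r x] that by (simp add: mult.commute)

text \<open>Off a null set, \<open>x\<close> is a Lebesgue point of a Borel representative of
  \<open>f\<close> and a point of zero density for the total variation of \<open>\<mu>s\<close>.
  Both facts control balls; since each \<open>B \<nu>\<close> fills at least a fixed positive
  fraction of its ball, they control \<open>B \<nu>\<close> as well.\<close>

lemma AE_has_lebesgue_density:
  fixes \<mu> :: "(real^'n) set \<Rightarrow> complex"
  assumes \<mu>: "complex_radon_measure \<mu>" and dec: "lebesgue_decomposition \<mu> f \<mu>s"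
    and fin: "\<And>B. B \<in> bounded_borel \<Longrightarrow> emeasure (total_variation \<mu>) B < \<infinity>"
  shows "AE x0 in lebesgue. has_lebesgue_density \<mu> (f x0) x0"
proof -
  have f: "f \<in> L1_loc" and \<mu>s: "radon_additive \<mu>s" and sing: "singular_radon \<mu>s"
    and eq: "\<And>B. B \<in> bounded_borel \<Longrightarrow> \<mu> B = (LINT x:B|lebesgue. f x) + \<mu>s B"
    using dec by (auto simp: lebesgue_decomposition_def complex_radon_measure_eq)
  obtain g where g [measurable]: "g \<in> borel_measurable borel" and fg: "AE x in lebesgue. f x = g x"
    and gfin: "\<And>B. B \<in> bounded_borel \<Longrightarrow> (\<integral>\<^sup>+y\<in>B. ennreal (cmod (g y)) \<partial>lborel) < \<infinity>"
    and gint: "\<And>B. B \<in> bounded_borel \<Longrightarrow> integrable lborel (\<lambda>y. indicator B y *\<^sub>R g y)"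
    and geq: "\<And>B. B \<in> bounded_borel \<Longrightarrow> (LINT x:B|lebesgue. f x) = (LINT y|lborel. indicator B y *\<^sub>R g y)"
    by (rule L1_loc_borel_representative[OF f], rule that, assumption+)
  obtain Z where Z: "Z \<in> null_sets lborel" "emeasure (total_variation \<mu>s) (- Z) = 0"
    using sing by (auto simp: singular_radon_def)
  have "- Z \<in> sets borel" using Z(1) by (auto simp: null_sets_def)
  then obtain N1 where N1: "negligible N1" "\<And>x e. x \<in> - Z - N1 \<Longrightarrow> e > 0 \<Longrightarrow> \<exists>d>0. \<forall>r. 0 < r \<longrightarrow> r < d \<longrightarrow>
           emeasure (total_variation \<mu>s) (cball x r) \<le> ennreal e * emeasure lborel (cball x r)"
    using null_set_zero_density[OF sets_total_variation total_variation_singular_part_finite[OF \<mu> dec fin], of "- Z"] Z(2)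
    by blast
  obtain N2 where N2: "negligible N2" "\<And>x e. x \<in> - N2 \<Longrightarrow> e > 0 \<Longrightarrow> \<exists>d>0. \<forall>r. 0 < r \<longrightarrow> r < d \<longrightarrow>
           (\<integral>\<^sup>+y\<in>cball x r. ennreal (cmod (g y - g x)) \<partial>lborel)
             \<le> ennreal e * emeasure lborel (cball x r)"
    using lebesgue_points[OF g gfin] by blast
  have "AE x in lebesgue. x \<notin> Z" "AE x in lebesgue. x \<notin> N1" "AE x in lebesgue. x \<notin> N2"
    using Z(1) N1(1) N2(1)
    by (auto intro!: AE_not_in null_sets_completionI simp: negligible_iff_null_sets)
  with fg show ?thesis
  proof eventually_elim
    case (elim x)
    show ?case
      unfolding has_lebesgue_density_def
    proof (intro allI impI)
      fix B assume "shrinks_regularly B x"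
      then obtain \<epsilon> a where B: "\<And>\<nu>. B \<nu> \<in> sets borel" "\<And>\<nu>. \<epsilon> \<nu> > 0" "\<epsilon> \<longlonglongrightarrow> 0"
        "\<And>\<nu>. B \<nu> \<subseteq> ball x (\<epsilon> \<nu>)" "a > 0" "\<And>\<nu>. measure lborel (B \<nu>) \<ge> a * \<epsilon> \<nu> ^ CARD('n)"
        unfolding shrinks_regularly_def by blast
      define v where "v = measure lborel (ball (0::real^'n) 1)"
      have v: "v > 0" unfolding v_def by simp
      show "(\<lambda>\<nu>. \<mu> (B \<nu>) / complex_of_real (measure lborel (B \<nu>))) \<longlonglongrightarrow> f x"
      proof (rule metric_LIMSEQ_I)
        fix e :: real assume e: "e > 0"
        \<comment> \<open>The ball has volume \<open>v * r ^ n\<close>, at most \<open>v / a\<close>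
          times the volume of \<open>B \<nu>\<close>. The two error terms then cost
          \<open>e / 4\<close> each, which leaves room for a strict inequality.\<close>
        define e' where "e' = e * a / (4 * v)"
        have e': "e' > 0" using e v B(5) by (simp add: e'_def)
        obtain d1 where d1: "d1 > 0" "\<And>r. 0 < r \<Longrightarrow> r < d1 \<Longrightarrow>
           emeasure (total_variation \<mu>s) (cball x r) \<le> ennreal e' * emeasure lborel (cball x r)"
          using N1(2)[OF _ e', of x] elim by auto
        obtain d2 where d2: "d2 > 0" "\<And>r. 0 < r \<Longrightarrow> r < d2 \<Longrightarrow>
           (\<integral>\<^sup>+y\<in>cball x r. ennreal (cmod (g y - g x)) \<partial>lborel)
             \<le> ennreal e' * emeasure lborel (cball x r)"
          using N2(2)[OF _ e', of x] elim by auto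
        have "\<forall>\<^sub>F \<nu> in sequentially. \<epsilon> \<nu> < min d1 d2"
          using B(3) d1(1) d2(1) by (intro order_tendstoD) auto
        then obtain n0 where n0: "\<And>\<nu>. \<nu> \<ge> n0 \<Longrightarrow> \<epsilon> \<nu> < min d1 d2"
          unfolding eventually_sequentially by blast
        show "\<exists>n0. \<forall>\<nu>\<ge>n0. dist (\<mu> (B \<nu>) / complex_of_real (measure lborel (B \<nu>))) (f x) < e"
        proof (intro exI allI impI)
          fix \<nu> assume "n0 \<le> \<nu>"
          define r where "r = \<epsilon> \<nu>"
          have r: "0 < r" "r < d1" "r < d2" using n0[OF \<open>n0 \<le> \<nu>\<close>] B(2) by (auto simp: r_def)
          define m where "m = measure lborel (B \<nu>)"
          have m: "m \<ge> a * r ^ CARD('n)" "m > 0"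
            using B(6)[of \<nu>] B(5) r(1) by (auto simp: m_def r_def intro: less_le_trans[rotated])
          have [measurable]: "B \<nu> \<in> sets borel" by (rule B)
          have Bb: "B \<nu> \<in> bounded_borel"
            using B(1,4)[of \<nu>] by (auto simp: bounded_borel_def intro: bounded_subset)
          have Bc: "B \<nu> \<subseteq> cball x r" using B(4)[of \<nu>] by (auto simp: r_def)
          have vr: "emeasure lborel (cball x r) = ennreal (v * r ^ CARD('n))"
          proof -
            have "emeasure lborel (cball x r) = ennreal (measure lborel (cball x r))"
              using emeasure_lborel_cball_finite by (intro emeasure_eq_ennreal_measure) (auto simp: top.not_eq_extremum)
            also have "measure lborel (cball x r) = measure lborel (ball x r)"
              using r by (simp add: content_ball content_cball)
            also have "\<dots> = v * r ^ CARD('n)" unfolding v_def by (rule measure_ball_eq) (use r in simp)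
            finally show ?thesis .
          qed
          have "ennreal (cmod (\<mu>s (B \<nu>))) \<le> emeasure (total_variation \<mu>s) (cball x r)"
            by (rule cmod_le_total_variation[OF \<mu>s Bb Bc]) simp
          also have "\<dots> \<le> ennreal (e' * (v * r ^ CARD('n)))"
            using d1(2)[OF r(1,2)] e' by (simp add: vr ennreal_mult')
          finally have 1: "cmod (\<mu>s (B \<nu>)) \<le> e' * (v * r ^ CARD('n))"
            using e' v r by (subst (asm) ennreal_le_iff) auto
          have i1: "integrable lborel (\<lambda>y. indicator (B \<nu>) y *\<^sub>R g y)" by (rule gint[OF Bb])
          have i2: "integrable lborel (\<lambda>y. indicator (B \<nu>) y *\<^sub>R g x)"
            and i3: "(LINT y|lborel. indicator (B \<nu>) y *\<^sub>R g x) = m *\<^sub>R g x"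
          proof -
            have "integrable lborel (indicat_real (B \<nu>))"
              using Bb emeasure_bounded_finite[of "B \<nu>"] by (intro integrable_real_indicator) (auto simp: bounded_borel_def)
            then show "integrable lborel (\<lambda>y. indicator (B \<nu>) y *\<^sub>R g x)"
              "(LINT y|lborel. indicator (B \<nu>) y *\<^sub>R g x) = m *\<^sub>R g x"
              by (simp_all add: m_def)
          qed
          have "ennreal (cmod (LINT y|lborel. indicator (B \<nu>) y *\<^sub>R g y - indicator (B \<nu>) y *\<^sub>R g x))
             \<le> (\<integral>\<^sup>+y. ennreal (norm (indicator (B \<nu>) y *\<^sub>R g y - indicator (B \<nu>) y *\<^sub>R g x)) \<partial>lborel)"
            by (rule integral_norm_bound_ennreal[OF Bochner_Integration.integrable_diff[OF i1 i2]])
          also have "\<dots> \<le> (\<integral>\<^sup>+y\<in>cball x r. ennreal (cmod (g y - g x)) \<partial>lborel)"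
            using Bc by (intro nn_integral_mono) (auto simp: indicator_def)
          also have "\<dots> \<le> ennreal (e' * (v * r ^ CARD('n)))"
            using d2(2)[OF r(1,3)] e' by (simp add: vr ennreal_mult')
          finally have "cmod (LINT y|lborel. indicator (B \<nu>) y *\<^sub>R g y - indicator (B \<nu>) y *\<^sub>R g x) \<le> e' * (v * r ^ CARD('n))"
            using e' v r by (subst (asm) ennreal_le_iff) auto
          also have "(LINT y|lborel. indicator (B \<nu>) y *\<^sub>R g y - indicator (B \<nu>) y *\<^sub>R g x)
             = (LINT x:B \<nu>|lebesgue. f x) - m *\<^sub>R f x"
            using geq[OF Bb] elim by (subst Bochner_Integration.integral_diff[OF i1 i2]) (simp add: i3)
          finally have 2: "cmod ((LINT x:B \<nu>|lebesgue. f x) - m *\<^sub>R f x) \<le> e' * (v * r ^ CARD('n))" .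
          have "\<mu> (B \<nu>) - m *\<^sub>R f x = ((LINT x:B \<nu>|lebesgue. f x) - m *\<^sub>R f x) + \<mu>s (B \<nu>)"
            using eq[OF Bb] by simp
          then have "cmod (\<mu> (B \<nu>) - m *\<^sub>R f x) \<le> e' * (v * r ^ CARD('n)) + e' * (v * r ^ CARD('n))"
            using 1 2 norm_triangle_mono by metis
          also have "\<dots> = (e / 2) * (a * r ^ CARD('n))"
            using v by (simp add: e'_def)
          also have "\<dots> \<le> (e / 2) * m" using m e by (intro mult_left_mono) auto
          also have "\<dots> < e * m" using e m by simp
          finally have "cmod (\<mu> (B \<nu>) - m *\<^sub>R f x) < e * m" .
          moreover have "\<mu> (B \<nu>) / complex_of_real m - f x = (\<mu> (B \<nu>) - m *\<^sub>R f x) / complex_of_real m"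
            using m by (simp add: field_simps scaleR_conv_of_real)
          ultimately show "dist (\<mu> (B \<nu>) / complex_of_real (measure lborel (B \<nu>))) (f x) < e"
            using m(2) by (simp add: dist_norm m_def[symmetric] norm_divide divide_less_eq)
        qed
      qed
    qed
  qed
qed


section \<open>Density points\<close>

text \<open>The density condition concerns sequences, the conclusion all small radii: a failure
  would give bad radii \<open>r k < 1 / (k + 1)\<close>. Along them the balls and the larger of
  their two parts shrink regularly. The defect \<open>S\<close> is additive, so the smaller part is
  controlled by a difference.\<close>

lemma has_lebesgue_density_ball_Int:
  fixes \<mu> :: "(real^'n) set \<Rightarrow> complex"
  assumes \<mu>: "radon_additive \<mu>" and dens: "has_lebesgue_density \<mu> \<gamma> x0"
    and D: "D \<in> sets borel" and e: "e > 0"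
  shows "\<exists>d>0. \<forall>r. 0 < r \<longrightarrow> r < d \<longrightarrow>
    cmod (\<mu> (ball x0 r \<inter> D) - \<gamma> * complex_of_real (measure lborel (ball x0 r \<inter> D))) \<le> e * r ^ CARD('n)"
proof (rule ccontr)
  define S where "S B = \<mu> B - \<gamma> * complex_of_real (measure lborel B)" for B
  define v where "v = measure lborel (ball (0::real^'n) 1)"
  have v: "v > 0" unfolding v_def by simp
  have vb: "measure lborel (ball x0 r) = v * r ^ CARD('n)" if "r > 0" for r
    unfolding v_def by (rule measure_ball_eq) (use that in simp)
  assume "\<not> ?thesis"
  then have "\<exists>r. 0 < r \<and> r < d \<and> e * r ^ CARD('n) < cmod (S (ball x0 r \<inter> D))" if "d > 0" for d
    using that by (force simp: S_def not_le)
  then have "\<forall>k. \<exists>r. 0 < r \<and> r < 1 / real (Suc k) \<and> e * r ^ CARD('n) < cmod (S (ball x0 r \<inter> D))"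
    by simp
  then obtain r where r: "\<And>k. 0 < r k" "\<And>k. r k < 1 / real (Suc k)"
    "\<And>k. e * r k ^ CARD('n) < cmod (S (ball x0 (r k) \<inter> D))"
    by metis
  have r0: "r \<longlonglongrightarrow> 0"
  proof (rule tendsto_sandwich[OF _ _ tendsto_const LIMSEQ_inverse_real_of_nat])
    show "\<forall>\<^sub>F k in sequentially. 0 \<le> r k" "\<forall>\<^sub>F k in sequentially. r k \<le> inverse (real (Suc k))"
      using r by (auto intro!: always_eventually less_imp_le simp: inverse_eq_divide simp del: of_nat_Suc)
  qed
  \<comment> \<open>\<open>v / 2\<close> is the constant in the definition of regular shrinking;
    \<open>e / (2 * v)\<close> is chosen because \<open>B k\<close> has volume at most
    \<open>v * r k ^ n\<close>.\<close>
  have small: "\<forall>\<^sub>F k in sequentially. cmod (S (B k)) < e / 2 * r k ^ CARD('n)"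
    if B: "\<And>k. B k \<in> sets borel" "\<And>k. B k \<subseteq> ball x0 (r k)"
      "\<And>k. measure lborel (B k) \<ge> v / 2 * r k ^ CARD('n)" for B
  proof -
    have "shrinks_regularly B x0"
      unfolding shrinks_regularly_def
    proof (intro conjI exI[of _ r] exI[of _ "v / 2"] allI)
    qed (use B v r r0 in auto)
    then have "(\<lambda>k. \<mu> (B k) / complex_of_real (measure lborel (B k))) \<longlonglongrightarrow> \<gamma>"
      using dens by (simp add: has_lebesgue_density_def)
    then have "\<forall>\<^sub>F k in sequentially. dist (\<mu> (B k) / complex_of_real (measure lborel (B k))) \<gamma> < e / (2 * v)"
      using e v by (intro tendstoD) auto
    then show ?thesis
    proof eventually_elim
      case (elim k)
      have "0 < v / 2 * r k ^ CARD('n)" using v r(1)[of k] by simp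
      then have m: "measure lborel (B k) > 0" using B(3)[of k] by linarith
      have "S (B k) = (\<mu> (B k) / complex_of_real (measure lborel (B k)) - \<gamma>) * complex_of_real (measure lborel (B k))"
        using m by (simp add: S_def field_simps)
      then have "cmod (S (B k)) = dist (\<mu> (B k) / complex_of_real (measure lborel (B k))) \<gamma> * measure lborel (B k)"
        using m by (simp add: norm_mult dist_norm)
      also have "\<dots> < e / (2 * v) * measure lborel (B k)"
        using elim m by (rule mult_strict_right_mono)
      also have "\<dots> \<le> e / (2 * v) * measure lborel (ball x0 (r k))"
        using e v B(1,2) by (intro mult_left_mono measure_mono_fmeasurable)
          (auto simp: fmeasurable_def emeasure_lborel_ball_finite[simplified])
      also have "\<dots> = e / 2 * r k ^ CARD('n)" using v vb[OF r(1)] by simp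
      finally show ?case .
    qed
  qed
  have Sadd: "S (ball x0 \<rho>) = S (ball x0 \<rho> \<inter> D) + S (ball x0 \<rho> - D)"
    and madd: "measure lborel (ball x0 \<rho>) = measure lborel (ball x0 \<rho> \<inter> D) + measure lborel (ball x0 \<rho> - D)" for \<rho>
  proof -
    have fm: "ball x0 \<rho> \<in> fmeasurable lborel"
      by (auto simp: fmeasurable_def emeasure_lborel_ball_finite[simplified])
    show m: "measure lborel (ball x0 \<rho>) = measure lborel (ball x0 \<rho> \<inter> D) + measure lborel (ball x0 \<rho> - D)"
    proof -
      have "ball x0 \<rho> = (ball x0 \<rho> \<inter> D) \<union> (ball x0 \<rho> - D)" by blast
      moreover have "measure lborel ((ball x0 \<rho> \<inter> D) \<union> (ball x0 \<rho> - D))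
          = measure lborel (ball x0 \<rho> \<inter> D) + measure lborel (ball x0 \<rho> - D)"
        using D by (intro measure_Un2[THEN trans] fmeasurable_Int_fmeasurable fmeasurable_Diff fm)
          (auto intro!: arg_cong[where f = "measure lborel"])
      ultimately show ?thesis by simp
    qed
    have "ball x0 \<rho> \<in> bounded_borel" by (simp add: bounded_borel_def)
    then show "S (ball x0 \<rho>) = S (ball x0 \<rho> \<inter> D) + S (ball x0 \<rho> - D)"
      unfolding S_def m using radon_additive_Diff[OF \<mu> _ D, of "ball x0 \<rho>"] by (simp add: algebra_simps)
  qed
  define B where "B k = (if measure lborel (ball x0 (r k) \<inter> D) \<ge> v / 2 * r k ^ CARD('n)
      then ball x0 (r k) \<inter> D else ball x0 (r k) - D)" for k
  have "\<forall>\<^sub>F k in sequentially. cmod (S (B k)) < e / 2 * r k ^ CARD('n)"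
  proof (rule small)
    fix k
    show "B k \<in> sets borel" "B k \<subseteq> ball x0 (r k)" using D by (auto simp: B_def)
    show "v / 2 * r k ^ CARD('n) \<le> measure lborel (B k)"
      using madd[of "r k"] vb[OF r(1)[of k]] by (auto simp: B_def)
  qed
  moreover have "\<forall>\<^sub>F k in sequentially. cmod (S (ball x0 (r k))) < e / 2 * r k ^ CARD('n)"
  proof (rule small)
    show "v / 2 * r k ^ CARD('n) \<le> measure lborel (ball x0 (r k))" for k
      using vb[OF r(1)[of k]] v r(1)[of k] by simp
  qed auto
  ultimately have "\<forall>\<^sub>F k in sequentially. False"
  proof eventually_elim
    case (elim k)
    \<comment> \<open>Either \<open>B k\<close> is the intersection itself, or the defect of the
      intersection is that of the ball minus that of \<open>B k\<close>.\<close>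
    have "cmod (S (ball x0 (r k) \<inter> D)) \<le> cmod (S (B k)) + cmod (S (ball x0 (r k)))"
      using Sadd[of "r k"] norm_triangle_ineq4[of "S (ball x0 (r k))" "S (B k)"] by (auto simp: B_def)
    then show False using elim r(3)[of k] by simp
  qed
  then show False by simp
qed

text \<open>The positive part of \<open>Re (\<theta> * \<sigma>)\<close> integrates over a ball to
  the real part of \<open>\<theta>\<close> times a value of the set function
  \<open>\<mu> - \<gamma> m\<close>, taken on the intersection of the ball with the Borel set
  \<open>Q \<theta>\<close>, which does not depend on the radius. The four directions
  \<open>1\<close>, \<open>-1\<close>, \<open>\<i>\<close>, \<open>-\<i>\<close> together dominate
  \<open>cmod \<sigma>\<close>, each at a cost of \<open>e / 4\<close>.\<close>

lemma has_lebesgue_density_variation: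
  fixes \<mu> :: "(real^'n) set \<Rightarrow> complex"
  assumes \<mu>: "radon_additive \<mu>" and dens: "has_lebesgue_density \<mu> \<gamma> x0"
    and rd: "radon_density \<mu> T h s"
    and e: "e > 0"
  shows "\<exists>d>0. \<forall>r. 0 < r \<longrightarrow> r < d \<longrightarrow>
    emeasure (density T (\<lambda>y. ennreal (cmod (s y - \<gamma> * complex_of_real (h y))))) (ball x0 r) \<le> ennreal (e * r ^ CARD('n))"
proof -
  note T = radon_densityD(1)[OF rd] and h = radon_densityD(2-4)[OF rd]
    and s = radon_densityD(5)[OF rd] and ind = radon_densityD(6,7)[OF rd]
  note [measurable_cong] = T
  note [measurable] = h(1) s
  define \<sigma> where "\<sigma> y = s y - \<gamma> * complex_of_real (h y)" for y
  have [measurable]: "\<sigma> \<in> borel_measurable borel" unfolding \<sigma>_def by measurable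
  have \<sigma>: "integrable T (\<lambda>x. indicator B x * \<sigma> x)"
    "(LINT x|T. indicator B x * \<sigma> x) = \<mu> B - \<gamma> * complex_of_real (measure lborel B)"
    if B: "B \<in> bounded_borel" for B
  proof -
    have [measurable]: "B \<in> sets borel" using B by (simp add: bounded_borel_def)
    have ofr: "complex_of_real (indicat_real B x) = indicator B x" for x
      by (simp add: indicator_def)
    have "integrable lborel (\<lambda>x. complex_of_real (indicat_real B x))"
      using emeasure_bounded_finite[of B] B
      by (intro integrable_of_real integrable_real_indicator) (auto simp: bounded_borel_def)
    then have "integrable lborel (\<lambda>x. indicator B x :: complex)" by (simp only: ofr)
    then have i: "integrable T (\<lambda>x. h x *\<^sub>R (indicator B x :: complex))"
      unfolding h(3) using h(2) by (subst (asm) integrable_density) auto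
    have "(LINT x|lborel. indicator B x :: complex) = (LINT x|lborel. complex_of_real (indicator B x))"
      by (intro Bochner_Integration.integral_cong) (auto simp: indicator_def)
    also have "\<dots> = complex_of_real (measure lborel B)" by simp
    finally have "(LINT x|T. h x *\<^sub>R (indicator B x :: complex)) = complex_of_real (measure lborel B)"
      using h(2) by (subst (asm) h(3), subst (asm) integral_density) auto
    moreover have eq: "indicator B x * \<sigma> x = indicator B x * s x - \<gamma> * (h x *\<^sub>R (indicator B x :: complex))" for x
      by (simp add: \<sigma>_def scaleR_conv_of_real algebra_simps)
    ultimately show "integrable T (\<lambda>x. indicator B x * \<sigma> x)"
      "(LINT x|T. indicator B x * \<sigma> x) = \<mu> B - \<gamma> * complex_of_real (measure lborel B)"
      unfolding eq using ind[OF B] i by (simp_all del: mult_scaleR_right)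
  qed
  define Q where "Q \<theta> = {y. 0 < Re (\<theta> * \<sigma> y)}" for \<theta>
  have [measurable]: "Q \<theta> \<in> sets borel" for \<theta> unfolding Q_def by measurable
  have Q: "(\<integral>\<^sup>+y. ennreal (Re (\<theta> * \<sigma> y)) * indicator (ball x0 r) y \<partial>T)
      \<le> ennreal (cmod \<theta> * cmod (\<mu> (ball x0 r \<inter> Q \<theta>) - \<gamma> * complex_of_real (measure lborel (ball x0 r \<inter> Q \<theta>))))" for \<theta> r
  proof -
    let ?B = "ball x0 r \<inter> Q \<theta>"
    have B: "?B \<in> bounded_borel" by (auto intro!: bounded_borel_Int simp: bounded_borel_def)
    \<comment> \<open>\<open>ennreal\<close> discards the negative values, which is exactly what
      intersecting with \<open>Q \<theta>\<close> does.\<close>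
    have "ennreal (Re (\<theta> * \<sigma> y)) * indicator (ball x0 r) y = ennreal (Re (\<theta> * (indicator ?B y * \<sigma> y)))" for y
      by (auto simp: indicator_def Q_def ennreal_neg)
    then have "(\<integral>\<^sup>+y. ennreal (Re (\<theta> * \<sigma> y)) * indicator (ball x0 r) y \<partial>T)
        = (\<integral>\<^sup>+y. ennreal (Re (\<theta> * (indicator ?B y * \<sigma> y))) \<partial>T)" by simp
    also have "\<dots> = ennreal (LINT y|T. Re (\<theta> * (indicator ?B y * \<sigma> y)))"
    proof (rule nn_integral_eq_integral)
      show "integrable T (\<lambda>y. Re (\<theta> * (indicator ?B y * \<sigma> y)))"
        using \<sigma>(1)[OF B] by (intro integrable_Re integrable_mult_right) auto
      show "AE y in T. 0 \<le> Re (\<theta> * (indicator ?B y * \<sigma> y))"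
        by (intro AE_I2) (auto simp: indicator_def Q_def)
    qed
    also have "(LINT y|T. Re (\<theta> * (indicator ?B y * \<sigma> y))) = Re (\<theta> * (LINT y|T. indicator ?B y * \<sigma> y))"
      by (simp only: integral_Re[OF integrable_mult_right[OF \<sigma>(1)[OF B]]] integral_mult_right_zero)
    also have "\<dots> \<le> cmod (\<theta> * (LINT y|T. indicator ?B y * \<sigma> y))" by (rule complex_Re_le_cmod)
    finally show ?thesis unfolding \<sigma>(2)[OF B] norm_mult by (simp add: ennreal_leI order_trans)
  qed
  have "\<exists>d>0. \<forall>r. 0 < r \<longrightarrow> r < d \<longrightarrow>
      (\<integral>\<^sup>+y. ennreal (Re (\<theta> * \<sigma> y)) * indicator (ball x0 r) y \<partial>T) \<le> ennreal (e / 4 * r ^ CARD('n))"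
    if "cmod \<theta> = 1" for \<theta>
  proof -
    have "e / 4 > 0" using e by simp
    moreover have "Q \<theta> \<in> sets borel" by measurable
    ultimately obtain d where
      d: "d > 0" "\<And>r. 0 < r \<Longrightarrow> r < d \<Longrightarrow>
        cmod (\<mu> (ball x0 r \<inter> Q \<theta>) - \<gamma> * complex_of_real (measure lborel (ball x0 r \<inter> Q \<theta>))) \<le> e / 4 * r ^ CARD('n)"
      using has_lebesgue_density_ball_Int[OF \<mu> dens] by blast
    show ?thesis
    proof (intro exI[of _ d] conjI allI impI)
      fix r assume "0 < r" "r < d"
      from ennreal_leI[OF d(2)[OF this]] show "(\<integral>\<^sup>+y. ennreal (Re (\<theta> * \<sigma> y)) * indicator (ball x0 r) y \<partial>T) \<le> ennreal (e / 4 * r ^ CARD('n))"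
        using Q[of \<theta> r] that by (simp add: order_trans)
    qed (rule d)
  qed
  note * = this
  have "cmod (1) = 1" by simp
  from *[OF this] obtain d1 where d1: "d1 > 0" "\<And>r. 0 < r \<Longrightarrow> r < d1 \<Longrightarrow>
      (\<integral>\<^sup>+y. ennreal (Re ((1) * \<sigma> y)) * indicator (ball x0 r) y \<partial>T) \<le> ennreal (e / 4 * r ^ CARD('n))"
    by blast
  have "cmod (-1) = 1" by simp
  from *[OF this] obtain d2 where d2: "d2 > 0" "\<And>r. 0 < r \<Longrightarrow> r < d2 \<Longrightarrow>
      (\<integral>\<^sup>+y. ennreal (Re ((-1) * \<sigma> y)) * indicator (ball x0 r) y \<partial>T) \<le> ennreal (e / 4 * r ^ CARD('n))"
    by blast
  have "cmod (\<i>) = 1" by simp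
  from *[OF this] obtain d3 where d3: "d3 > 0" "\<And>r. 0 < r \<Longrightarrow> r < d3 \<Longrightarrow>
      (\<integral>\<^sup>+y. ennreal (Re ((\<i>) * \<sigma> y)) * indicator (ball x0 r) y \<partial>T) \<le> ennreal (e / 4 * r ^ CARD('n))"
    by blast
  have "cmod (-\<i>) = 1" by simp
  from *[OF this] obtain d4 where d4: "d4 > 0" "\<And>r. 0 < r \<Longrightarrow> r < d4 \<Longrightarrow>
      (\<integral>\<^sup>+y. ennreal (Re ((-\<i>) * \<sigma> y)) * indicator (ball x0 r) y \<partial>T) \<le> ennreal (e / 4 * r ^ CARD('n))"
    by blast
  show ?thesis
    unfolding \<sigma>_def[symmetric]
  proof (intro exI[of _ "min (min d1 d2) (min d3 d4)"] conjI allI impI)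
    fix r assume r: "0 < r" "r < min (min d1 d2) (min d3 d4)"
    have [measurable]: "ball x0 r \<in> sets borel" by simp
    have cm: "ennreal (cmod z) \<le> ennreal (Re (1 * z)) + ennreal (Re ((-1) * z)) + ennreal (Re (\<i> * z)) + ennreal (Re ((-\<i>) * z))" for z
    proof -
      have abs: "ennreal \<bar>a\<bar> = ennreal a + ennreal (- a)" for a :: real
        by (cases "a \<ge> 0") (auto simp: ennreal_neg)
      have "ennreal (cmod z) \<le> ennreal (\<bar>Re z\<bar> + \<bar>Im z\<bar>)" by (intro ennreal_leI cmod_le)
      also have "\<dots> = ennreal (Re z) + ennreal (- Re z) + ennreal (Im z) + ennreal (- Im z)"
        by (simp add: abs add.assoc)
      finally show ?thesis by (simp add: ac_simps)
    qed
    have "emeasure (density T (\<lambda>y. ennreal (cmod (\<sigma> y)))) (ball x0 r)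
        = (\<integral>\<^sup>+y. ennreal (cmod (\<sigma> y)) * indicator (ball x0 r) y \<partial>T)"
      by (subst emeasure_density) (auto simp: T)
    also have "\<dots> \<le> (\<integral>\<^sup>+y. ennreal (Re (1 * \<sigma> y)) * indicator (ball x0 r) y
        + ennreal (Re ((-1) * \<sigma> y)) * indicator (ball x0 r) y
        + ennreal (Re (\<i> * \<sigma> y)) * indicator (ball x0 r) y
        + ennreal (Re ((-\<i>) * \<sigma> y)) * indicator (ball x0 r) y \<partial>T)"
      unfolding distrib_right[symmetric] by (intro nn_integral_mono mult_right_mono cm) simp
    also have "\<dots> = (\<integral>\<^sup>+y. ennreal (Re (1 * \<sigma> y)) * indicator (ball x0 r) y \<partial>T)
        + (\<integral>\<^sup>+y. ennreal (Re ((-1) * \<sigma> y)) * indicator (ball x0 r) y \<partial>T)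
        + (\<integral>\<^sup>+y. ennreal (Re (\<i> * \<sigma> y)) * indicator (ball x0 r) y \<partial>T)
        + (\<integral>\<^sup>+y. ennreal (Re ((-\<i>) * \<sigma> y)) * indicator (ball x0 r) y \<partial>T)"
    proof -
      have "(\<integral>\<^sup>+y. F1 y + F2 y + F3 y + F4 y \<partial>T) = integral\<^sup>N T F1 + integral\<^sup>N T F2 + integral\<^sup>N T F3 + integral\<^sup>N T F4"
        if "F1 \<in> borel_measurable T" "F2 \<in> borel_measurable T" "F3 \<in> borel_measurable T" "F4 \<in> borel_measurable T" for F1 F2 F3 F4
        using that by (simp add: nn_integral_add)
      then show ?thesis by this measurable
    qed
    also have "\<dots> \<le> ennreal (e / 4 * r ^ CARD('n)) + ennreal (e / 4 * r ^ CARD('n))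
        + ennreal (e / 4 * r ^ CARD('n)) + ennreal (e / 4 * r ^ CARD('n))"
      using r by (intro add_mono d1(2) d2(2) d3(2) d4(2)) auto
    also have "\<dots> = ennreal (e * r ^ CARD('n))"
      using e r by (simp add: ennreal_plus[symmetric] del: ennreal_plus)
    finally show "emeasure (density T (\<lambda>y. ennreal (cmod (\<sigma> y)))) (ball x0 r) \<le> ennreal (e * r ^ CARD('n))" .
  qed (use d1(1) d2(1) d3(1) d4(1) in auto)
qed

section \<open>Exponential weights summed over shells\<close>

lemma summable_power_exp:
  assumes "c > (0::real)"
  shows "summable (\<lambda>j. exp (- c * real j) * real (Suc j) ^ n)"
proof (rule summable_comparison_test_ev)
  \<comment> \<open>One half of the exponent absorbs the power; the other half is left as a
    geometric series.\<close>
  have "((\<lambda>x. x ^ n / exp x) \<longlongrightarrow> 0) (at_top :: real filter)" by (rule tendsto_power_div_exp_0)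
  moreover have "filterlim (\<lambda>j. c / 2 * real (Suc j)) at_top sequentially"
    using assms by (intro filterlim_tendsto_pos_mult_at_top[OF tendsto_const]
        filterlim_compose[OF filterlim_real_sequentially filterlim_Suc]) auto
  ultimately have "(\<lambda>j. (c / 2 * real (Suc j)) ^ n / exp (c / 2 * real (Suc j))) \<longlonglongrightarrow> 0"
    by (rule filterlim_compose)
  then have "\<forall>\<^sub>F j in sequentially. (c / 2 * real (Suc j)) ^ n / exp (c / 2 * real (Suc j)) < 1"
    by (rule order_tendstoD) simp
  then show "\<forall>\<^sub>F j in sequentially. norm (exp (- c * real j) * real (Suc j) ^ n)
      \<le> (2 / c) ^ n * exp (c / 2) * exp (- c / 2) ^ j"
  proof eventually_elim
    case (elim j)
    then have "(c / 2 * real (Suc j)) ^ n \<le> exp (c / 2 * real (Suc j))"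
      by (simp add: divide_less_eq del: of_nat_Suc)
    then have "(c / 2) ^ n * real (Suc j) ^ n \<le> exp (c / 2 * real (Suc j))"
      by (simp only: power_mult_distrib)
    then have "real (Suc j) ^ n \<le> (2 / c) ^ n * exp (c / 2 * real (Suc j))"
      using assms by (simp add: power_divide field_simps del: of_nat_Suc)
    then have "exp (- c * real j) * real (Suc j) ^ n \<le> exp (- c * real j) * ((2 / c) ^ n * exp (c / 2 * real (Suc j)))"
      by (intro mult_left_mono) auto
    also have "\<dots> = (2 / c) ^ n * (exp (- c * real j) * exp (c / 2 * real (Suc j)))" by simp
    also have "exp (- c * real j) * exp (c / 2 * real (Suc j)) = exp (c / 2) * exp (- c / 2) ^ j"
      unfolding exp_of_nat_mult[symmetric] exp_add[symmetric] by (rule arg_cong[where f = exp]) (simp add: field_simps)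
    finally show ?case by simp
  qed
  show "summable (\<lambda>j. (2 / c) ^ n * exp (c / 2) * exp (- c / 2) ^ j)"
    using assms by (intro summable_mult summable_geometric) auto
qed

text \<open>The shell \<open>j \<le> t * norm (x0 - y) < j + 1\<close> is enlarged to the ball of
  radius \<open>(j + 1) / t\<close>, of measure at most \<open>\<eta> * ((j + 1) / t) ^ n\<close>.
  The resulting factor \<open>1 / t ^ n\<close> is what cancels the normalisation of the kernel.
  \<open>M\<close> stands for any function with the linear lower bound, so that the weight and a
  plain exponential are both covered.\<close>

lemma nn_integral_exp_shells:
  fixes \<rho> :: "(real^'n) measure"
  assumes sets: "sets \<rho> = sets borel"
    and c: "c > 0" and t: "t > 0" and \<eta>: "\<eta> \<ge> 0"
    and M: "\<And>u. 0 \<le> u \<Longrightarrow> c * real (nat \<lfloor>u\<rfloor>) \<le> M u"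
    and ball: "\<And>r. r > 0 \<Longrightarrow> emeasure \<rho> (ball x0 r) \<le> ennreal (\<eta> * r ^ CARD('n))"
  shows "(\<integral>\<^sup>+y. ennreal (exp (- M (t * norm (x0 - y)))) \<partial>\<rho>)
     \<le> ennreal (\<eta> / t ^ CARD('n) * (\<Sum>j. exp (- c * real j) * real (Suc j) ^ CARD('n)))"
proof -
  let ?f = "\<lambda>j y. ennreal (exp (- c * real j)) * indicator (ball x0 (real (Suc j) / t)) y"
  have [measurable]: "ball x0 r \<in> sets \<rho>" for r by (simp add: sets)
  have "(\<integral>\<^sup>+y. ennreal (exp (- M (t * norm (x0 - y)))) \<partial>\<rho>) \<le> (\<integral>\<^sup>+y. (\<Sum>j. ?f j y) \<partial>\<rho>)"
  proof (rule nn_integral_mono)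
    fix y
    define j where "j = nat \<lfloor>t * norm (x0 - y)\<rfloor>"
    have "t * norm (x0 - y) < real (Suc j)"
      using t unfolding j_def by (simp add: of_nat_nat) linarith
    then have "y \<in> ball x0 (real (Suc j) / t)" using t by (simp add: dist_norm pos_less_divide_eq mult.commute)
    moreover have "exp (- M (t * norm (x0 - y))) \<le> exp (- c * real j)"
      using M[of "t * norm (x0 - y)"] t by (simp add: j_def)
    ultimately have "ennreal (exp (- M (t * norm (x0 - y)))) \<le> ?f j y"
      by (simp add: ennreal_leI)
    also have "f j \<le> (\<Sum>j. f j)" for f :: "nat \<Rightarrow> ennreal"
      using sum_le_suminf[of f "{j}"] by simp
    note this[of "\<lambda>j. ?f j y"]
    finally show "ennreal (exp (- M (t * norm (x0 - y)))) \<le> (\<Sum>j. ?f j y)" .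
  qed
  also have "\<dots> = (\<Sum>j. ennreal (exp (- c * real j)) * emeasure \<rho> (ball x0 (real (Suc j) / t)))"
    by (subst nn_integral_suminf) (auto simp: nn_integral_cmult_indicator)
  also have "\<dots> \<le> (\<Sum>j. ennreal (\<eta> / t ^ CARD('n) * (exp (- c * real j) * real (Suc j) ^ CARD('n))))"
  proof (intro suminf_le allI)
    fix j
    have "ennreal (exp (- c * real j)) * emeasure \<rho> (ball x0 (real (Suc j) / t))
       \<le> ennreal (exp (- c * real j)) * ennreal (\<eta> * (real (Suc j) / t) ^ CARD('n))"
      using t by (intro mult_left_mono ball) auto
    also have "\<dots> = ennreal (\<eta> / t ^ CARD('n) * (exp (- c * real j) * real (Suc j) ^ CARD('n)))"
      using t \<eta> by (simp add: ennreal_mult[symmetric] power_divide field_simps)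
    finally show "ennreal (exp (- c * real j)) * emeasure \<rho> (ball x0 (real (Suc j) / t))
       \<le> ennreal (\<eta> / t ^ CARD('n) * (exp (- c * real j) * real (Suc j) ^ CARD('n)))" .
  qed auto
  also have "\<dots> = ennreal (\<Sum>j. \<eta> / t ^ CARD('n) * (exp (- c * real j) * real (Suc j) ^ CARD('n)))"
    using t \<eta> by (intro suminf_ennreal2 summable_mult summable_power_exp c) auto
  also have "(\<Sum>j. \<eta> / t ^ CARD('n) * (exp (- c * real j) * real (Suc j) ^ CARD('n)))
      = \<eta> / t ^ CARD('n) * (\<Sum>j. exp (- c * real j) * real (Suc j) ^ CARD('n))"
    by (intro suminf_mult summable_power_exp c)
  finally show ?thesis .
qed


section \<open>Sums over the integer lattice\<close>

lemma nn_integral_lborel_affine: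
  fixes u :: "real^'n \<Rightarrow> ennreal"
  assumes [measurable]: "u \<in> borel_measurable borel" and c: "c \<noteq> 0"
  shows "(\<integral>\<^sup>+x. u x \<partial>lborel) = ennreal (\<bar>c\<bar> ^ CARD('n)) * (\<integral>\<^sup>+x. u (t + c *\<^sub>R x) \<partial>lborel)"
  by (subst lborel_affine[OF c, of t]) (simp add: nn_integral_density nn_integral_distr nn_integral_cmult)

lemma integral_lborel_affine:
  fixes u :: "real^'n \<Rightarrow> complex"
  assumes u: "integrable lborel u" and c: "c \<noteq> 0"
  shows "(LINT x|lborel. u x) = \<bar>c\<bar> ^ CARD('n) *\<^sub>R (LINT x|lborel. u (t + c *\<^sub>R x))"
proof -
  have um [measurable]: "u \<in> borel_measurable borel" using u borel_measurable_integrable by fastforce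
  have "(LINT x|lborel. u x) = (LINT x|density (distr lborel borel (\<lambda>x. t + c *\<^sub>R x)) (\<lambda>_. ennreal (\<bar>c\<bar> ^ CARD('n))). u x)"
    by (subst lborel_affine[OF c, of t]) simp
  also have "\<dots> = (LINT x|distr lborel borel (\<lambda>x. t + c *\<^sub>R x). \<bar>c\<bar> ^ CARD('n) *\<^sub>R u x)"
    by (rule integral_density) auto
  also have "\<dots> = (LINT x|lborel. \<bar>c\<bar> ^ CARD('n) *\<^sub>R u (t + c *\<^sub>R x))"
    by (rule integral_distr) auto
  finally show ?thesis by simp
qed

text \<open>Stated over \<open>lebesgue\<close> because the members of the spaces \<open>V j\<close>
  are known to be Lebesgue measurable only.\<close>

lemma integral_lebesgue_scale:
  fixes u :: "real^'n \<Rightarrow> real"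
  assumes u: "u \<in> borel_measurable lebesgue" and c: "c > 0"
  shows "(LINT x|lebesgue. u x) = c ^ CARD('n) * (LINT x|lebesgue. u (c *\<^sub>R x))"
    and "(\<lambda>x. c *\<^sub>R x) \<in> lebesgue \<rightarrow>\<^sub>M (lebesgue :: (real^'n) measure)"
proof -
  have T: "(\<lambda>x::real^'n. 0 + (\<Sum>j\<in>Basis. (c * (x \<bullet> j)) *\<^sub>R j)) = (\<lambda>x. c *\<^sub>R x)"
    by (simp add: scaleR_scaleR[symmetric] scaleR_sum_right[symmetric] euclidean_representation del: scaleR_scaleR)
  have P: "(\<Prod>j\<in>(Basis :: (real^'n) set). \<bar>c\<bar>) = c ^ CARD('n)" using c by simp
  show m: "(\<lambda>x. c *\<^sub>R x) \<in> lebesgue \<rightarrow>\<^sub>M (lebesgue :: (real^'n) measure)"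
    using lebesgue_affine_measurable[of "\<lambda>_::real^'n. c" 0] c unfolding T by simp
  have "(lebesgue :: (real^'n) measure) = density (distr lebesgue lebesgue (\<lambda>x. c *\<^sub>R x)) (\<lambda>_. ennreal (c ^ CARD('n)))"
    using lebesgue_affine_euclidean[of "\<lambda>_::real^'n. c" 0] c unfolding T P by simp
  then have "(LINT x|lebesgue. u x) = (LINT x|density (distr lebesgue lebesgue (\<lambda>x. c *\<^sub>R x)) (\<lambda>_. ennreal (c ^ CARD('n))). u x)"
    by (rule arg_cong)
  also have "\<dots> = (LINT x|distr lebesgue lebesgue (\<lambda>x. c *\<^sub>R x). c ^ CARD('n) *\<^sub>R u x)"
    using u c by (intro integral_density) auto
  also have "\<dots> = (LINT x|lebesgue. c ^ CARD('n) *\<^sub>R u (c *\<^sub>R x))"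
    using u m by (intro integral_distr) auto
  finally show "(LINT x|lebesgue. u x) = c ^ CARD('n) * (LINT x|lebesgue. u (c *\<^sub>R x))" by simp
qed

text \<open>Lebesgue measure satisfies the ball bound at every radius, with \<open>\<eta>\<close>
  the volume of the unit ball; this is the shell estimate at \<open>t = 1\<close>.\<close>

lemma nn_integral_exp_norm:
  assumes "c > 0"
  shows "(\<integral>\<^sup>+y. ennreal (exp (- c * norm (x - y :: real^'n))) \<partial>lborel) < \<infinity>"
proof -
  define v where "v = measure lborel (ball (0::real^'n) 1)"
  have "(\<integral>\<^sup>+y. ennreal (exp (- (c * (1 * norm (x - y))))) \<partial>lborel)
     \<le> ennreal (v / 1 ^ CARD('n) * (\<Sum>j. exp (- c * real j) * real (Suc j) ^ CARD('n)))"
  proof (rule nn_integral_exp_shells)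
    show "c * real (nat \<lfloor>u\<rfloor>) \<le> c * u" if "0 \<le> u" for u
      using assms that by (intro mult_left_mono) (auto simp: of_nat_nat)
    show "emeasure lborel (ball x r) \<le> ennreal (v * r ^ CARD('n))" if "r > 0" for r
      using that measure_ball_eq[of r x] emeasure_lborel_ball_finite[of x r]
      by (simp add: emeasure_eq_ennreal_measure v_def)
  qed (use assms in \<open>auto simp: v_def\<close>)
  then show ?thesis by (simp add: less_top[symmetric] top_unique mult.assoc) (auto simp: top_unique)
qed

text \<open>The type argument carries the dimension, which no other argument mentions.\<close>

definition exp_integral :: "('n::finite) itself \<Rightarrow> real \<Rightarrow> real" where
  "exp_integral _ c = (LINT y|lborel. exp (- c * norm (y :: real^'n)))"

lemma exp_norm_integral:
  assumes "c > 0"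
  shows "integrable lborel (\<lambda>y. exp (- c * norm (x - y :: real^'n)))"
    and "(LINT y|lborel. exp (- c * norm (x - y :: real^'n))) = exp_integral TYPE('n) c"
    and "(\<integral>\<^sup>+y. ennreal (exp (- c * norm (x - y :: real^'n))) \<partial>lborel) = ennreal (exp_integral TYPE('n) c)"
    and "exp_integral TYPE('n) c \<ge> 0"
proof -
  have i: "integrable lborel (\<lambda>y. exp (- c * norm (x - y :: real^'n)))" for x
    using nn_integral_exp_norm[OF assms, of x] by (intro integrableI_bounded) auto
  have n: "(\<integral>\<^sup>+y. ennreal (exp (- c * norm (x - y :: real^'n))) \<partial>lborel)
      = ennreal (LINT y|lborel. exp (- c * norm (x - y :: real^'n)))" for x
    by (rule nn_integral_eq_integral[OF i]) simp
  have "(\<integral>\<^sup>+y. ennreal (exp (- c * norm (y :: real^'n))) \<partial>lborel)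
      = (\<integral>\<^sup>+y. ennreal (exp (- c * norm (x - y :: real^'n))) \<partial>lborel)"
    by (subst nn_integral_lborel_affine[of _ "-1" x]) (auto simp: norm_minus_commute)
  moreover have "(\<integral>\<^sup>+y. ennreal (exp (- c * norm (y :: real^'n))) \<partial>lborel) = ennreal (exp_integral TYPE('n) c)"
    using n[of 0] by (simp add: exp_integral_def)
  ultimately show 3: "(\<integral>\<^sup>+y. ennreal (exp (- c * norm (x - y :: real^'n))) \<partial>lborel) = ennreal (exp_integral TYPE('n) c)"
    by simp
  show 4: "exp_integral TYPE('n) c \<ge> 0" by (simp add: exp_integral_def)
  show "(LINT y|lborel. exp (- c * norm (x - y :: real^'n))) = exp_integral TYPE('n) c"
    using 3 4 n[of x] by (simp add: ennreal_inj)
  show "integrable lborel (\<lambda>y. exp (- c * norm (x - y :: real^'n)))" by (rule i)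
qed

section \<open>The integer lattice\<close>

lemma integer_points_separated:
  assumes "m \<in> integer_points" "k \<in> integer_points" "m \<noteq> k"
  shows "1 \<le> norm (m - k)"
proof -
  obtain i where i: "m $ i \<noteq> k $ i" using assms(3) by (auto simp: vec_eq_iff)
  have "m $ i - k $ i \<in> \<int>" using assms(1,2) by (auto simp: integer_points_def)
  then have "1 \<le> \<bar>m $ i - k $ i\<bar>" using i by (intro Ints_nonzero_abs_ge1) auto
  also have "\<dots> \<le> norm (m - k)" using component_le_norm_cart[of "m - k" i] by simp
  finally show ?thesis .
qed

lemma integer_points_add: "m \<in> integer_points \<Longrightarrow> k \<in> integer_points \<Longrightarrow> m + k \<in> integer_points"
  and integer_points_diff: "m \<in> integer_points \<Longrightarrow> k \<in> integer_points \<Longrightarrow> m - k \<in> integer_points"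
  by (auto simp: integer_points_def)

lemma integer_point_near: "\<exists>m\<in>integer_points. norm (x - m :: real^'n) \<le> real CARD('n)"
proof
  let ?m = "(\<chi> i. of_int \<lfloor>x $ i\<rfloor>) :: real^'n"
  show "?m \<in> integer_points" by (simp add: integer_points_def)
  have "norm (x - ?m) \<le> (\<Sum>i\<in>UNIV. \<bar>(x - ?m) $ i\<bar>)" by (rule norm_le_l1_cart)
  also have "\<dots> \<le> (\<Sum>i\<in>(UNIV :: 'n set). 1)"
  proof (rule sum_mono)
    fix i
    have "0 \<le> x $ i - of_int \<lfloor>x $ i\<rfloor>" "x $ i - of_int \<lfloor>x $ i\<rfloor> \<le> 1" by linarith+
    then show "\<bar>(x - ?m) $ i\<bar> \<le> 1" by simp
  qed
  finally show "norm (x - ?m) \<le> real CARD('n)" by simp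
qed

text \<open>Comparison with an integral: balls of radius 1/2 about lattice points are disjoint, and
  on each of them the exponential falls by a factor of at most \<open>exp (c / 2)\<close> below its
  value at the centre. The bound is uniform in \<open>x\<close>, which makes the kernel estimates
  uniform.\<close>

lemma integer_points_exp_sum_bounded:
  assumes c: "c > 0"
  shows "\<exists>S\<ge>0. \<forall>x :: real^'n. \<forall>F. finite F \<longrightarrow> F \<subseteq> integer_points \<longrightarrow> (\<Sum>m\<in>F. exp (- c * norm (x - m))) \<le> S"
proof -
  define v where "v = measure lborel (ball (0::real^'n) (1/2))"
  have v: "v > 0" unfolding v_def by simp
  have vb: "emeasure lborel (ball (m::real^'n) (1/2)) = ennreal v" for m
  proof -
    have "measure lborel (ball m (1/2)) = v"
      unfolding v_def by (subst (1 2) measure_ball_eq) auto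
    then show ?thesis
      using emeasure_lborel_ball_finite[of m "1/2"] by (simp add: emeasure_eq_ennreal_measure)
  qed
  let ?I = "exp_integral TYPE('n) c"
  have "(\<Sum>m\<in>F. exp (- c * norm (x - m))) \<le> exp (c / 2) * ?I / v"
    if F: "finite F" "F \<subseteq> integer_points" for x :: "real^'n" and F
  proof -
    define \<rho> where "\<rho> = density lborel (\<lambda>y. ennreal (exp (- c * norm (x - y))))"
    have \<rho>: "emeasure \<rho> B = (\<integral>\<^sup>+y. ennreal (exp (- c * norm (x - y))) * indicator B y \<partial>lborel)" if "B \<in> sets borel" for B
      unfolding \<rho>_def using that by (subst emeasure_density) auto
    have dis: "disjoint_family_on (\<lambda>m. ball m (1/2)) F"
    proof (unfold disjoint_family_on_def, intro ballI impI)
      fix m k assume "m \<in> F" "k \<in> F" "m \<noteq> k"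
      then have "1 \<le> dist m k" using integer_points_separated[of m k] F(2) by (auto simp: dist_norm)
      then show "ball m (1/2) \<inter> ball k (1/2) = {}"
        by (intro disjoint_ballI) simp
    qed
    have "ennreal (exp (- c / 2) * v * (\<Sum>m\<in>F. exp (- c * norm (x - m))))
        = (\<Sum>m\<in>F. ennreal (exp (- c / 2) * v * exp (- c * norm (x - m))))"
      using v by (subst sum_ennreal) (auto simp: sum_distrib_left)
    also have "\<dots> \<le> (\<Sum>m\<in>F. emeasure \<rho> (ball m (1/2)))"
    proof (rule sum_mono)
      fix m assume "m \<in> F"
      have "ennreal (exp (- c / 2) * v * exp (- c * norm (x - m))) = ennreal (exp (- c / 2) * exp (- c * norm (x - m))) * emeasure lborel (ball m (1/2))"
        using v by (simp add: vb ennreal_mult[symmetric] mult.commute mult.left_commute)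
      also have "\<dots> = (\<integral>\<^sup>+y. ennreal (exp (- c / 2) * exp (- c * norm (x - m))) * indicator (ball m (1/2)) y \<partial>lborel)"
        by (simp add: nn_integral_cmult_indicator)
      also have "\<dots> \<le> emeasure \<rho> (ball m (1/2))"
        unfolding \<rho>[OF borel_open[OF open_ball]]
      proof (rule nn_integral_mono)
        fix y
        show "ennreal (exp (- c / 2) * exp (- c * norm (x - m))) * indicator (ball m (1/2)) y
          \<le> ennreal (exp (- c * norm (x - y))) * indicator (ball m (1/2)) y"
        proof (cases "y \<in> ball m (1/2)")
          case True
          have "norm (x - y) \<le> norm (x - m) + norm (m - y)" using norm_triangle_ineq[of "x - m" "m - y"] by simp
          then have "c * norm (x - y) \<le> c * (norm (x - m) + 1/2)"
            using True c by (intro mult_left_mono) (auto simp: dist_norm)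
          then show ?thesis using True by (simp add: exp_add[symmetric] ennreal_leI algebra_simps)
        qed simp
      qed
      finally show "ennreal (exp (- c / 2) * v * exp (- c * norm (x - m))) \<le> emeasure \<rho> (ball m (1/2))" .
    qed
    also have "\<dots> = emeasure \<rho> (\<Union>m\<in>F. ball m (1/2))"
      using F(1) dis by (intro sum_emeasure) (auto simp: \<rho>_def)
    also have "\<dots> \<le> emeasure \<rho> UNIV" by (intro emeasure_mono) (auto simp: \<rho>_def)
    also have "\<dots> = ennreal ?I" by (subst \<rho>) (simp_all add: exp_norm_integral(3)[OF c, simplified])
    finally have "exp (- c / 2) * v * (\<Sum>m\<in>F. exp (- c * norm (x - m))) \<le> ?I"
      by (subst (asm) ennreal_le_iff) (rule exp_norm_integral(4)[OF c])
    then show ?thesis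
      using v by (simp add: field_simps exp_minus)
  qed
  moreover have "exp (c / 2) * ?I / v \<ge> 0" using v exp_norm_integral(4)[OF c, where 'n='n] by simp
  ultimately show ?thesis by blast
qed

lemma integer_points_exp_summable:
  assumes c: "c > 0"
  shows "\<exists>S\<ge>0. \<forall>x :: real^'n. \<forall>A \<subseteq> integer_points. (\<lambda>m. exp (- c * norm (x - m))) summable_on A
    \<and> (\<Sum>\<^sub>\<infinity>m\<in>A. exp (- c * norm (x - m))) \<le> S"
proof -
  obtain S where S: "S \<ge> 0" "\<And>x F. finite F \<Longrightarrow> F \<subseteq> integer_points \<Longrightarrow> (\<Sum>m\<in>F. exp (- c * norm (x - m :: real^'n))) \<le> S"
    using integer_points_exp_sum_bounded[OF c] by blast
  have "(\<lambda>m. exp (- c * norm (x - m))) summable_on A \<and> (\<Sum>\<^sub>\<infinity>m\<in>A. exp (- c * norm (x - m))) \<le> S"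
    if A: "A \<subseteq> integer_points" for A and x :: "real^'n"
  proof
    show "(\<lambda>m. exp (- c * norm (x - m))) summable_on A"
      using A S(2) by (intro nonneg_bdd_above_summable_on) (auto intro!: bdd_aboveI[of _ S])
    then show "(\<Sum>\<^sub>\<infinity>m\<in>A. exp (- c * norm (x - m))) \<le> S"
      by (rule infsum_le_finite_sums) (use A S(2) in auto)
  qed
  with S(1) show ?thesis by blast
qed

text \<open>Each lattice point of the ball contributes at least \<open>exp (- R)\<close> to a sum
  that is bounded independently of the finite set chosen.\<close>

lemma finite_integer_points_ball: "finite (integer_points \<inter> ball (0::real^'n) R)"
proof -
  obtain S where S: "S \<ge> 0" "\<And>x F. finite F \<Longrightarrow> F \<subseteq> integer_points \<Longrightarrow> (\<Sum>m\<in>F. exp (- 1 * norm (x - m :: real^'n))) \<le> S"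
    using integer_points_exp_sum_bounded[of 1, where 'n='n] by auto
  obtain C :: nat where C: "S * exp R \<le> real C" using real_arch_simple by blast
  have "card G \<le> C" if G: "G \<subseteq> integer_points \<inter> ball 0 R" "finite G" for G :: "(real^'n) set"
  proof -
    have "real (card G) * exp (- R) = (\<Sum>m\<in>G. exp (- R))" by simp
    also have "\<dots> \<le> (\<Sum>m\<in>G. exp (- 1 * norm (0 - m)))" using G by (intro sum_mono) auto
    also have "\<dots> \<le> S" using G by (intro S(2)) auto
    finally have "real (card G) \<le> S * exp R" by (simp add: exp_minus field_simps)
    with C show ?thesis by linarith
  qed
  then show ?thesis using finite_if_finite_subsets_card_bdd by blast
qed

text \<open>An enumeration turns \<open>infsum\<close> over the lattice into an ordinary series,
  which can be shown measurable and integrated term by term.\<close>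

lemma integer_points_enumeration: "\<exists>e :: nat \<Rightarrow> real^'n. bij_betw e UNIV integer_points"
proof -
  have "integer_points = (\<Union>k::nat. integer_points \<inter> ball (0::real^'n) (real k))"
    by (auto simp: reals_Archimedean2)
  moreover have "countable (\<Union>k::nat. integer_points \<inter> ball (0::real^'n) (real k))"
    by (rule countable_UN[OF countableI_type countable_finite[OF finite_integer_points_ball]])
  ultimately have "countable (integer_points :: (real^'n) set)" by metis
  moreover have "infinite (integer_points :: (real^'n) set)"
  proof
    assume "finite (integer_points :: (real^'n) set)"
    moreover have "range (\<lambda>k::nat. (\<chi> i. real k) :: real^'n) \<subseteq> integer_points"
      by (auto simp: integer_points_def)
    ultimately have "finite (range (\<lambda>k::nat. (\<chi> i. real k) :: real^'n))" by (rule finite_subset[rotated])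
    moreover have "inj (\<lambda>k::nat. (\<chi> i. real k) :: real^'n)"
      by (auto simp: inj_def vec_eq_iff)
    ultimately show False using finite_imageD infinite_UNIV_nat by blast
  qed
  ultimately show ?thesis using bij_betw_from_nat_into by blast
qed


section \<open>Approximation in a multiresolution analysis\<close>

lemma L2_borel_measurable: "f \<in> L2 \<Longrightarrow> f \<in> borel_measurable lebesgue"
  by (simp add: L2_def)

lemma L2_inner_integrable:
  assumes "f \<in> L2" "g \<in> L2"
  shows "integrable lebesgue (\<lambda>x. f x * cnj (g x))"
proof (rule Bochner_Integration.integrable_bound)
  note [measurable] = assms[THEN L2_borel_measurable]
  show "integrable lebesgue (\<lambda>x. (cmod (f x))\<^sup>2 + (cmod (g x))\<^sup>2)"
    using assms by (auto simp: L2_def)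
  show "(\<lambda>x. f x * cnj (g x)) \<in> borel_measurable lebesgue"
    using assms[THEN L2_borel_measurable]
    by (intro borel_measurable_times borel_measurable_continuous_on[where f = cnj]) (auto intro: continuous_intros)
  have "a * b \<le> a\<^sup>2 + b\<^sup>2" if "0 \<le> a" "0 \<le> b" for a b :: real
    using sum_squares_bound[of a b] mult_nonneg_nonneg[OF that] by simp
  then show "AE x in lebesgue. norm (f x * cnj (g x)) \<le> norm ((cmod (f x))\<^sup>2 + (cmod (g x))\<^sup>2)"
    by (simp add: norm_mult)
qed

lemma L2_add:
  assumes "f \<in> L2" "g \<in> L2"
  shows "(\<lambda>x. f x + g x) \<in> L2"
proof -
  have [measurable]: "f \<in> borel_measurable lebesgue" "g \<in> borel_measurable lebesgue"
    using assms L2_borel_measurable by auto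
  have "integrable lebesgue (\<lambda>x. (cmod (f x + g x))\<^sup>2)"
  proof (rule Bochner_Integration.integrable_bound)
    show "integrable lebesgue (\<lambda>x. 2 * (cmod (f x))\<^sup>2 + 2 * (cmod (g x))\<^sup>2)"
      using assms by (auto simp: L2_def)
    have "(cmod (a + b))\<^sup>2 \<le> 2 * (cmod a)\<^sup>2 + 2 * (cmod b)\<^sup>2" for a b
    proof -
      have "(cmod (a + b))\<^sup>2 \<le> (cmod a + cmod b)\<^sup>2" by (intro power_mono norm_triangle_ineq) auto
      also have "\<dots> \<le> 2 * (cmod a)\<^sup>2 + 2 * (cmod b)\<^sup>2"
        using sum_squares_bound[of "cmod a" "cmod b"] by (simp add: power2_sum)
      finally show ?thesis .
    qed
    then show "AE x in lebesgue. norm ((cmod (f x + g x))\<^sup>2) \<le> norm (2 * (cmod (f x))\<^sup>2 + 2 * (cmod (g x))\<^sup>2)"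
      by simp
  qed measurable
  then show ?thesis by (simp add: L2_def)
qed

lemma L2_scale:
  assumes "f \<in> L2"
  shows "(\<lambda>x. a * f x) \<in> L2"
proof -
  have [measurable]: "f \<in> borel_measurable lebesgue" using assms L2_borel_measurable by auto
  have "integrable lebesgue (\<lambda>x. (cmod a)\<^sup>2 * (cmod (f x))\<^sup>2)"
    using assms by (auto simp: L2_def)
  then show ?thesis by (simp add: L2_def norm_mult power_mult_distrib)
qed

lemma L2_diff:
  assumes "f \<in> L2" "g \<in> L2"
  shows "(\<lambda>x. f x - g x) \<in> L2"
  using L2_add[OF assms(1) L2_scale[OF assms(2), of "-1"]] by simp

lemma L2_sum:
  assumes "\<And>i. i \<in> F \<Longrightarrow> f i \<in> L2"
  shows "(\<lambda>x. \<Sum>i\<in>F. a i * f i x) \<in> L2"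
  using assms
proof (induction F rule: infinite_finite_induct)
  case (insert i F)
  then show ?case using L2_add[OF L2_scale[of "f i" "a i"], of "\<lambda>x. \<Sum>i\<in>F. a i * f i x"] by simp
qed (simp_all add: L2_def)

lemma L2_inner_diff_left: "f \<in> L2 \<Longrightarrow> g \<in> L2 \<Longrightarrow> h \<in> L2 \<Longrightarrow>
    L2_inner (\<lambda>x. f x - g x) h = L2_inner f h - L2_inner g h"
  unfolding L2_inner_def left_diff_distrib
  by (intro Bochner_Integration.integral_diff L2_inner_integrable)

lemma L2_inner_sum_left:
  assumes "\<And>i. i \<in> F \<Longrightarrow> f i \<in> L2" "h \<in> L2"
  shows "L2_inner (\<lambda>x. \<Sum>i\<in>F. a i * f i x) h = (\<Sum>i\<in>F. a i * L2_inner (f i) h)"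
proof -
  have "L2_inner (\<lambda>x. \<Sum>i\<in>F. a i * f i x) h = (LINT x|lebesgue. (\<Sum>i\<in>F. a i * (f i x * cnj (h x))))"
    unfolding L2_inner_def by (simp add: sum_distrib_right mult.assoc)
  also have "\<dots> = (\<Sum>i\<in>F. (LINT x|lebesgue. a i * (f i x * cnj (h x))))"
    using assms by (intro Bochner_Integration.integral_sum integrable_mult_right L2_inner_integrable) auto
  finally show ?thesis by (simp add: L2_inner_def)
qed

lemma L2_inner_sum_right:
  assumes "\<And>i. i \<in> F \<Longrightarrow> f i \<in> L2" "h \<in> L2"
  shows "L2_inner h (\<lambda>x. \<Sum>i\<in>F. a i * f i x) = (\<Sum>i\<in>F. cnj (a i) * L2_inner h (f i))"
proof -
  have "L2_inner h (\<lambda>x. \<Sum>i\<in>F. a i * f i x) = (LINT x|lebesgue. (\<Sum>i\<in>F. cnj (a i) * (h x * cnj (f i x))))"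
    unfolding L2_inner_def by (simp add: sum_distrib_left mult_ac)
  also have "\<dots> = (\<Sum>i\<in>F. (LINT x|lebesgue. cnj (a i) * (h x * cnj (f i x))))"
    using assms by (intro Bochner_Integration.integral_sum integrable_mult_right L2_inner_integrable) auto
  finally show ?thesis by (simp add: L2_inner_def)
qed

lemma L2_norm_power2: "(L2_norm f)\<^sup>2 = (LINT x|lebesgue. (cmod (f x))\<^sup>2)"
  unfolding L2_norm_def by (simp add: integral_nonneg_AE)

lemma L2_norm_power2_orthogonal:
  assumes "f \<in> L2" "g \<in> L2" "L2_inner f g = 0"
  shows "(L2_norm (\<lambda>x. f x + g x))\<^sup>2 = (L2_norm f)\<^sup>2 + (L2_norm g)\<^sup>2"
proof -
  have i: "integrable lebesgue (\<lambda>x. f x * cnj (g x))" by (rule L2_inner_integrable[OF assms(1,2)])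
  have eq: "(cmod (f x + g x))\<^sup>2 = (cmod (f x))\<^sup>2 + (cmod (g x))\<^sup>2 + 2 * Re (f x * cnj (g x))" for x
    by (simp add: cmod_power2 power2_sum algebra_simps)
  have "(LINT x|lebesgue. Re (f x * cnj (g x))) = Re (L2_inner f g)"
    unfolding L2_inner_def by (rule integral_Re[OF i])
  then have "(LINT x|lebesgue. 2 * Re (f x * cnj (g x))) = 0"
    using assms(3) by (simp del: times_complex.sel)
  moreover have "(LINT x|lebesgue. (cmod (f x))\<^sup>2 + (cmod (g x))\<^sup>2 + 2 * Re (f x * cnj (g x)))
     = (LINT x|lebesgue. (cmod (f x))\<^sup>2) + (LINT x|lebesgue. (cmod (g x))\<^sup>2) + (LINT x|lebesgue. 2 * Re (f x * cnj (g x)))"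
    using assms(1,2) integrable_Re[OF i]
    by (subst Bochner_Integration.integral_add Bochner_Integration.integral_add, auto simp: L2_def simp del: times_complex.sel)+
  ultimately show ?thesis unfolding L2_norm_power2 eq by simp
qed

text \<open>The residual of the projection onto the span over \<open>F'\<close> is orthogonal to
  that span, so by Pythagoras no combination does better, in particular none indexed by the smaller
  \<open>F\<close>. This allows the index set to be enlarged to all lattice points of a ball without
  spoiling a given approximation.\<close>

lemma L2_best_approximation:
  assumes e: "\<And>i. i \<in> F' \<Longrightarrow> e i \<in> L2"
    and orth: "\<And>i j. i \<in> F' \<Longrightarrow> j \<in> F' \<Longrightarrow> L2_inner (e i) (e j) = (if i = j then 1 else 0)"
    and F: "finite F'" "F \<subseteq> F'" and f: "f \<in> L2"
  shows "(L2_norm (\<lambda>x. f x - (\<Sum>i\<in>F'. L2_inner f (e i) * e i x)))\<^sup>2 \<le> (L2_norm (\<lambda>x. f x - (\<Sum>i\<in>F. d i * e i x)))\<^sup>2"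
proof -
  define p where "p = (\<lambda>x. \<Sum>i\<in>F'. L2_inner f (e i) * e i x)"
  define b where "b i = L2_inner f (e i) - (if i \<in> F then d i else 0)" for i
  define s where "s = (\<lambda>x. \<Sum>i\<in>F'. b i * e i x)"
  have p: "p \<in> L2" and s: "s \<in> L2" unfolding p_def s_def using e by (auto intro: L2_sum)
  have "L2_inner (\<lambda>x. f x - p x) (e k) = 0" if "k \<in> F'" for k
  proof -
    have "L2_inner p (e k) = (\<Sum>i\<in>F'. L2_inner f (e i) * L2_inner (e i) (e k))"
      unfolding p_def using e that by (intro L2_inner_sum_left) auto
    also have "\<dots> = (\<Sum>i\<in>F'. if i = k then L2_inner f (e i) else 0)"
      using orth that by (intro sum.cong) auto
    also have "\<dots> = L2_inner f (e k)" using F that by simp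
    finally show ?thesis using L2_inner_diff_left[OF f p e[OF that]] by simp
  qed
  then have orth0: "L2_inner (\<lambda>x. f x - p x) s = 0"
    unfolding s_def using e L2_diff[OF f p] by (subst L2_inner_sum_right) auto
  have sum_eq: "f x - p x + s x = f x - (\<Sum>i\<in>F. d i * e i x)" for x
  proof -
    have "(\<Sum>i\<in>F'. (if i \<in> F then d i else 0) * e i x) = (\<Sum>i\<in>F. d i * e i x)"
      using F by (intro sum.mono_neutral_cong_right) auto
    then show ?thesis by (simp add: p_def s_def b_def left_diff_distrib sum_subtractf)
  qed
  have "(L2_norm (\<lambda>x. f x - (\<Sum>i\<in>F. d i * e i x)))\<^sup>2 = (L2_norm (\<lambda>x. f x - p x))\<^sup>2 + (L2_norm s)\<^sup>2"
    using L2_norm_power2_orthogonal[OF L2_diff[OF f p] s orth0] by (simp only: sum_eq)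
  then show ?thesis by (simp add: p_def)
qed

lemma L2_norm_power2_diff_le:
  assumes "f \<in> L2" "g \<in> L2" "h \<in> L2"
  shows "(L2_norm (\<lambda>x. f x - h x))\<^sup>2 \<le> 2 * (L2_norm (\<lambda>x. f x - g x))\<^sup>2 + 2 * (L2_norm (\<lambda>x. g x - h x))\<^sup>2"
proof -
  have "(cmod (f x - h x))\<^sup>2 \<le> 2 * (cmod (f x - g x))\<^sup>2 + 2 * (cmod (g x - h x))\<^sup>2" for x
  proof -
    have "(cmod (f x - h x))\<^sup>2 \<le> (cmod (f x - g x) + cmod (g x - h x))\<^sup>2"
      using norm_triangle_ineq[of "f x - g x" "g x - h x"] by (intro power_mono) auto
    also have "\<dots> \<le> 2 * (cmod (f x - g x))\<^sup>2 + 2 * (cmod (g x - h x))\<^sup>2"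
      using sum_squares_bound[of "cmod (f x - g x)" "cmod (g x - h x)"] by (simp add: power2_sum)
    finally show ?thesis .
  qed
  then have "(LINT x|lebesgue. (cmod (f x - h x))\<^sup>2) \<le> (LINT x|lebesgue. 2 * (cmod (f x - g x))\<^sup>2 + 2 * (cmod (g x - h x))\<^sup>2)"
    using L2_diff[OF assms(1,3)] L2_diff[OF assms(1,2)] L2_diff[OF assms(2,3)]
    by (intro integral_mono) (auto simp: L2_def)
  also have "\<dots> = 2 * (L2_norm (\<lambda>x. f x - g x))\<^sup>2 + 2 * (L2_norm (\<lambda>x. g x - h x))\<^sup>2"
    unfolding L2_norm_power2 using L2_diff[OF assms(1,2)] L2_diff[OF assms(2,3)]
    by (subst Bochner_Integration.integral_add) (auto simp: L2_def)
  finally show ?thesis by (simp add: L2_norm_power2)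
qed

lemma indicator_ball_L2: "indicator (ball (0::real^'n) R) \<in> L2"
proof -
  have "(\<lambda>x. (cmod (indicator (ball (0::real^'n) R) x))\<^sup>2) = indicat_real (ball 0 R)"
  proof
    fix x :: "real^'n"
    show "(cmod (indicator (ball 0 R) x))\<^sup>2 = indicat_real (ball 0 R) x"
      by (cases "x \<in> ball 0 R") (simp_all del: mem_ball_0)
  qed
  moreover have "integrable lborel (indicat_real (ball (0::real^'n) R))"
    by (rule integrable_real_indicator) (simp_all add: emeasure_lborel_ball_finite[simplified])
  then have "integrable lebesgue (indicat_real (ball (0::real^'n) R))"
    by (subst integrable_completion) (auto dest: borel_measurable_integrable)
  moreover have "(indicator (ball (0::real^'n) R) :: _ \<Rightarrow> complex) \<in> borel_measurable lebesgue"
    by (intro borel_measurable_indicator) auto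
  ultimately show ?thesis by (simp add: L2_def)
qed

section \<open>Consequences of the multiresolution axioms\<close>

lemma MRA_D:
  assumes "MRA V"
  shows "L2_closed_subspace (V j)" "V j \<subseteq> V (j + 1)"
    "f \<in> V j \<longleftrightarrow> (\<lambda>x. f (2 *\<^sub>R x)) \<in> V (j + 1)" "L2_closure (\<Union>j. V j) = L2"
proof -
  note * = assms[unfolded MRA_def]
  show "L2_closed_subspace (V j)" by (rule *[THEN conjunct1, rule_format])
  show "V j \<subseteq> V (j + 1)" by (rule *[THEN conjunct2, THEN conjunct1, rule_format])
  show "f \<in> V j \<longleftrightarrow> (\<lambda>x. f (2 *\<^sub>R x)) \<in> V (j + 1)"
    by (rule *[THEN conjunct2, THEN conjunct2, THEN conjunct1, rule_format])
  show "L2_closure (\<Union>j. V j) = L2"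
    by (rule *[THEN conjunct2, THEN conjunct2, THEN conjunct2, THEN conjunct2, THEN conjunct2, THEN conjunct1])
qed

lemma MRA_scale:
  fixes V :: "int \<Rightarrow> ((real^'n) \<Rightarrow> complex) set"
  assumes "MRA V"
  shows "f \<in> V 0 \<longleftrightarrow> (\<lambda>x. f (2 ^ J *\<^sub>R x)) \<in> V (int J)"
proof (induction J)
  case (Suc J)
  have *: "(\<lambda>x. f (2 ^ J *\<^sub>R x)) \<in> V (int J) \<longleftrightarrow> (\<lambda>x. f (2 ^ J *\<^sub>R (2 *\<^sub>R x))) \<in> V (int J + 1)"
    by (rule MRA_D(3)[OF assms])
  have "int (Suc J) = int J + 1" "2 ^ Suc J *\<^sub>R x = 2 ^ J *\<^sub>R (2 *\<^sub>R x)" for x :: "real^'n"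
    by simp_all
  then show ?case using Suc * by (simp only:)
qed simp

lemma MRA_mono:
  assumes "MRA V" "i \<le> j" shows "V i \<subseteq> V j"
  using assms(2)
proof (induction j rule: int_ge_induct)
  case (step j)
  then show ?case using MRA_D(2)[OF assms(1), of j] by blast
qed simp

text \<open>Zooming out: the unit ball is within \<open>\<epsilon>\<close> of some \<open>V j\<close>, so at scale \<open>R = 2 ^ j\<close> the ball of
  radius \<open>R\<close> is relatively close to \<open>V 0\<close>.\<close>

lemma MRA_ball_approximation:
  fixes \<phi> :: "real^'n \<Rightarrow> complex"
  assumes V: "MRA V" and \<phi>: "scaling_function V \<phi>" and \<epsilon>: "\<epsilon> > 0"
  shows "\<exists>R\<ge>R0. \<exists>F d. finite F \<and> F \<subseteq> integer_points \<and>
     (L2_norm (\<lambda>x. indicator (ball 0 R) x - (\<Sum>m\<in>F. d m * \<phi> (x - m))))\<^sup>2 \<le> \<epsilon> * R ^ CARD('n)"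
proof -
  have sub: "L2_closed_subspace (V j)" for j by (rule MRA_D(1)[OF V])
  have VL2: "V j \<subseteq> L2" for j using sub by (simp add: L2_closed_subspace_def)
  have onb: "L2_orthonormal_basis integer_points (\<lambda>m x. \<phi> (x - m)) (V 0)"
    using \<phi> by (simp add: scaling_function_def)
  let ?f = "indicator (ball (0::real^'n) 1) :: _ \<Rightarrow> complex"
  have "?f \<in> L2_closure (\<Union>j. V j)" using indicator_ball_L2 by (simp add: MRA_D(4)[OF V])
  \<comment> \<open>Two errors of squared size \<open>\<epsilon> / 4\<close>, relative to
    \<open>R ^ n\<close>, each enter with a factor 2 and add up to
    \<open>\<epsilon>\<close>.\<close>
  moreover define \<delta> where "\<delta> = sqrt (\<epsilon> / 4)"
  have \<delta>: "\<delta> > 0" using \<epsilon> by (simp add: \<delta>_def)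
  ultimately obtain h j where h: "h \<in> V j" "L2_norm (\<lambda>x. ?f x - h x) < \<delta>"
    unfolding L2_closure_def by blast
  obtain J0 :: nat where J0: "R0 < 2 ^ J0" using real_arch_pow[of 2 R0] by auto
  \<comment> \<open>One exponent serves both requirements, \<open>V j \<subseteq> V J\<close> and
    \<open>R \<ge> R0\<close>.\<close>
  define J where "J = max (nat j) J0"
  define R where "R = (2::real) ^ J"
  have "J0 \<le> J" by (simp add: J_def)
  then have "(2::real) ^ J0 \<le> 2 ^ J" by (intro power_increasing) auto
  then have R: "R0 \<le> R" "R > 0" using J0 unfolding R_def by (linarith, simp)
  have "j \<le> int J" by (simp add: J_def)
  then have hJ: "h \<in> V (int J)" using MRA_mono[OF V] h(1) by blast
  \<comment> \<open>Dilation by \<open>R\<close> carries \<open>V J\<close> back to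
    \<open>V 0\<close> and the unit ball to the ball of radius \<open>R\<close>; squared norms are
    multiplied by \<open>R ^ n\<close>.\<close>
  define h' where "h' = (\<lambda>x. h ((1 / R) *\<^sub>R x))"
  have "(\<lambda>x. h' (2 ^ J *\<^sub>R x)) = h" using R by (simp add: h'_def R_def)
  then have h': "h' \<in> V 0" using MRA_scale[OF V, of h' J] hJ by simp
  have hL2: "h \<in> L2" "h' \<in> L2" using hJ h' VL2 by blast+
  let ?fR = "indicator (ball (0::real^'n) R) :: _ \<Rightarrow> complex"
  have fR: "?fR x = ?f ((1 / R) *\<^sub>R x)" for x
    using R by (simp add: indicator_def)
  have "(L2_norm (\<lambda>x. ?fR x - h' x))\<^sup>2 = (LINT x|lebesgue. (cmod (?f ((1 / R) *\<^sub>R x) - h ((1 / R) *\<^sub>R x)))\<^sup>2)"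
    unfolding L2_norm_power2 fR h'_def ..
  also have "\<dots> = R ^ CARD('n) * (LINT x|lebesgue. (cmod (?f x - h x))\<^sup>2)"
  proof -
    have "(\<lambda>x. (cmod (?f x - h x))\<^sup>2) \<in> borel_measurable lebesgue"
      using L2_diff[OF indicator_ball_L2 hL2(1)] by (auto simp: L2_def)
    then have "(LINT x|lebesgue. (cmod (?f x - h x))\<^sup>2)
      = (1 / R) ^ CARD('n) * (LINT x|lebesgue. (cmod (?f ((1 / R) *\<^sub>R x) - h ((1 / R) *\<^sub>R x)))\<^sup>2)"
      by (rule integral_lebesgue_scale) (use R in simp)
    then show ?thesis using R by (simp add: power_divide)
  qed
  also have "\<dots> \<le> R ^ CARD('n) * (\<epsilon> / 4)"
  proof -
    have "0 \<le> L2_norm (\<lambda>x. ?f x - h x)" by (simp add: L2_norm_def integral_nonneg_AE)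
    then have "(L2_norm (\<lambda>x. ?f x - h x))\<^sup>2 \<le> \<delta>\<^sup>2" using h(2) by (intro power_mono) auto
    then show ?thesis using \<epsilon> R by (intro mult_left_mono) (auto simp: L2_norm_power2 \<delta>_def)
  qed
  finally have 1: "(L2_norm (\<lambda>x. ?fR x - h' x))\<^sup>2 \<le> R ^ CARD('n) * (\<epsilon> / 4)" .
  have "h' \<in> L2_closure {(\<lambda>x. \<Sum>i\<in>F. c i * \<phi> (x - i)) | F c. finite F \<and> F \<subseteq> integer_points}"
    using h' onb by (simp add: L2_orthonormal_basis_def)
  moreover define \<delta>' where "\<delta>' = sqrt (R ^ CARD('n) * (\<epsilon> / 4))"
  have \<delta>': "\<delta>' > 0" using \<epsilon> R by (simp add: \<delta>'_def)
  ultimately obtain F d where F: "finite F" "F \<subseteq> integer_points"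
    "L2_norm (\<lambda>x. h' x - (\<Sum>i\<in>F. d i * \<phi> (x - i))) < \<delta>'"
    unfolding L2_closure_def by blast
  define s where "s = (\<lambda>x. \<Sum>i\<in>F. d i * \<phi> (x - i))"
  have s: "s \<in> L2" unfolding s_def using onb F(2) by (intro L2_sum) (auto simp: L2_orthonormal_basis_def)
  have "0 \<le> L2_norm (\<lambda>x. h' x - s x)" by (simp add: L2_norm_def integral_nonneg_AE)
  then have "(L2_norm (\<lambda>x. h' x - s x))\<^sup>2 \<le> \<delta>'\<^sup>2" using F(3) by (intro power_mono) (auto simp: s_def)
  then have 2: "(L2_norm (\<lambda>x. h' x - s x))\<^sup>2 \<le> R ^ CARD('n) * (\<epsilon> / 4)" using \<epsilon> R by (simp add: \<delta>'_def)
  have "(L2_norm (\<lambda>x. ?fR x - s x))\<^sup>2 \<le> \<epsilon> * R ^ CARD('n)"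
    using L2_norm_power2_diff_le[OF indicator_ball_L2 hL2(2) s, of R] 1 2 by (simp add: field_simps)
  then show ?thesis using R F(1,2) unfolding s_def by blast
qed


section \<open>The projection kernel\<close>

text \<open>The form in which the decay of \<open>\<phi>\<close> enters the multiresolution
  argument. The rate is written as \<open>2 * c\<close> because it is spent twice: one
  \<open>c\<close> on decay in \<open>x - y\<close>, the other on summability over the
  lattice.\<close>

locale exp_decay =
  fixes \<phi> :: "real^'n \<Rightarrow> complex" and c D :: real
  assumes c: "c > 0" and D: "D \<ge> 0" and cont: "continuous_on UNIV \<phi>"
    and decay: "cmod (\<phi> x) \<le> D * exp (- (2 * c) * norm x)"
begin

lemma borel_measurable_phi [measurable]: "\<phi> \<in> borel_measurable borel"
  using cont by (rule borel_measurable_continuous_onI)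

lemma decay1: "cmod (\<phi> x) \<le> D * exp (- c * norm x)"
proof -
  have "D * exp (- (2 * c) * norm x) \<le> D * exp (- c * norm x)"
    using c D by (intro mult_left_mono) auto
  then show ?thesis using decay[of x] by linarith
qed

lemma prod_bound:
  "cmod (\<phi> x) * cmod (\<phi> y) \<le> D\<^sup>2 * exp (- c * norm (x - y)) * exp (- c * norm x)"
proof -
  have "cmod (\<phi> x) * cmod (\<phi> y) \<le> (D * exp (- (2 * c) * norm x)) * (D * exp (- (2 * c) * norm y))"
    using decay D by (intro mult_mono) auto
  also have "\<dots> = D\<^sup>2 * exp (- (2 * c) * norm x - (2 * c) * norm y)"
    by (simp add: power2_eq_square exp_diff exp_minus field_simps)
  also have "\<dots> \<le> D\<^sup>2 * exp (- c * norm (x - y) - c * norm x)"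
  proof -
    have "c * norm (x - y) \<le> c * (norm x + norm y)" "0 \<le> c * norm y"
      using c by (auto intro!: mult_left_mono norm_triangle_ineq4)
    then show ?thesis by (intro mult_left_mono) (auto simp: algebra_simps)
  qed
  also have "\<dots> = D\<^sup>2 * exp (- c * norm (x - y)) * exp (- c * norm x)"
    by (simp add: exp_diff exp_minus field_simps)
  finally show ?thesis .
qed

lemma integrable_translate: "integrable lborel (\<lambda>y. \<phi> (y - m))"
proof (rule Bochner_Integration.integrable_bound)
  show "integrable lborel (\<lambda>y. D * exp (- c * norm (m - y)))"
    by (intro integrable_mult_right exp_norm_integral(1) c)
  show "AE y in lborel. norm (\<phi> (y - m)) \<le> norm (D * exp (- c * norm (m - y)))"
    using decay1 D by (auto simp: norm_minus_commute)
qed measurable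

lemma integral_translate: "(LINT y|lborel. \<phi> (y - m)) = (LINT y|lborel. \<phi> y)"
  using integral_lborel_affine[OF integrable_translate[of m], of 1 m] by simp

lemma phi_L2: "(\<lambda>x. \<phi> (x - m)) \<in> L2"
proof -
  have "integrable lborel (\<lambda>x. (cmod (\<phi> (x - m)))\<^sup>2)"
  proof (rule Bochner_Integration.integrable_bound)
    show "integrable lborel (\<lambda>x. D * cmod (\<phi> (x - m)))"
      by (intro integrable_mult_right integrable_norm integrable_translate)
    have "cmod (\<phi> x) \<le> D" for x
    proof -
      have "D * exp (- c * norm x) \<le> D * 1" using c D by (intro mult_left_mono) auto
      then show ?thesis using decay1[of x] by simp
    qed
    then show "AE x in lborel. norm ((cmod (\<phi> (x - m)))\<^sup>2) \<le> norm (D * cmod (\<phi> (x - m)))"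
      using D by (auto simp: power2_eq_square intro!: mult_right_mono)
  qed measurable
  moreover have "(\<lambda>x. \<phi> (x - m)) \<in> borel_measurable lborel" by measurable
  then have "(\<lambda>x. \<phi> (x - m)) \<in> borel_measurable lebesgue" by (rule measurable_completion)
  ultimately show ?thesis by (simp add: L2_def integrable_completion)
qed

text \<open>This is the integral of \<open>q0 \<phi> x\<close>, already taken term by term: every
  translate of \<open>\<phi>\<close> has the same integral. The series is the definition because
  periodicity and continuity can be read off from it.\<close>

definition G :: "real^'n \<Rightarrow> complex" where
  "G x = (\<Sum>\<^sub>\<infinity>m\<in>integer_points. \<phi> (x - m) * cnj (LINT y|lborel. \<phi> y))"

lemma abs_summable_translates:
  assumes "A \<subseteq> integer_points"
  shows "(\<lambda>m. norm (\<phi> (x - m) * a)) summable_on A"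
proof (rule Infinite_Sum.abs_summable_on_comparison_test')
  show "(\<lambda>m. (D * cmod a) * exp (- c * norm (x - m))) summable_on A"
    using integer_points_exp_summable[OF c] assms by (intro summable_on_cmult_right) blast
  show "norm (\<phi> (x - m) * a) \<le> (D * cmod a) * exp (- c * norm (x - m))" for m
    using mult_right_mono[OF decay1[of "x - m"], of "cmod a"] by (simp add: norm_mult mult_ac)
qed

lemma abs_summable_q0: "(\<lambda>m. norm (\<phi> (x - m) * cnj (\<phi> (y - m)))) summable_on integer_points"
proof (rule Infinite_Sum.abs_summable_on_comparison_test')
  show "(\<lambda>m. (D * D) * exp (- c * norm (x - m))) summable_on integer_points"
    using integer_points_exp_summable[OF c] by (intro summable_on_cmult_right) blast
  fix m
  have "cmod (\<phi> (y - m)) \<le> D * exp (- c * norm (y - m))" by (rule decay1)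
  also have "\<dots> \<le> D * 1" using c D by (intro mult_left_mono) auto
  finally have "cmod (\<phi> (x - m)) * cmod (\<phi> (y - m)) \<le> (D * exp (- c * norm (x - m))) * D"
    using decay1[of "x - m"] D by (intro mult_mono) auto
  then show "norm (\<phi> (x - m) * cnj (\<phi> (y - m))) \<le> (D * D) * exp (- c * norm (x - m))"
    by (simp add: norm_mult mult_ac)
qed

lemma sums_infsum_integer_points:
  assumes e: "bij_betw e (UNIV :: nat set) integer_points"
    and "(\<lambda>m. norm (f m :: complex)) summable_on (integer_points :: (real^'n) set)"
  shows "(\<lambda>k. f (e k)) sums (\<Sum>\<^sub>\<infinity>m\<in>integer_points. f m)" "summable (\<lambda>k. norm (f (e k)))"
proof -
  have "(f has_sum (\<Sum>\<^sub>\<infinity>m\<in>integer_points. f m)) integer_points"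
    using assms(2) abs_summable_summable by (intro has_sum_infsum) blast
  then have "((\<lambda>k. f (e k)) has_sum (\<Sum>\<^sub>\<infinity>m\<in>integer_points. f m)) UNIV"
    using has_sum_reindex_bij_betw[OF e] by blast
  then show "(\<lambda>k. f (e k)) sums (\<Sum>\<^sub>\<infinity>m\<in>integer_points. f m)" by (rule has_sum_imp_sums)
  have "(\<lambda>k. norm (f (e k))) summable_on UNIV"
    using assms(2) summable_on_reindex_bij_betw[OF e, of "\<lambda>m. norm (f m)"] by blast
  then show "summable (\<lambda>k. norm (f (e k)))" by (rule summable_on_imp_summable)
qed

text \<open>Sum and integral are exchanged because the norms of the terms integrate to
  \<open>cmod (\<phi> (x - m))\<close> times the integral of \<open>cmod (\<phi> y)\<close>, a
  summable family in \<open>m\<close>.\<close>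

lemma integral_q0:
  "q0 \<phi> x \<in> borel_measurable borel"
  "(LINT y|lborel. q0 \<phi> x y) = G x"
proof -
  obtain e :: "nat \<Rightarrow> real^'n" where e: "bij_betw e UNIV integer_points"
    using integer_points_enumeration by blast
  have q0: "(\<lambda>k. \<phi> (x - e k) * cnj (\<phi> (y - e k))) sums q0 \<phi> x y"
    and q0s: "summable (\<lambda>k. norm (\<phi> (x - e k) * cnj (\<phi> (y - e k))))" for y
    unfolding q0_def using sums_infsum_integer_points[OF e abs_summable_q0] by auto
  have G: "(\<lambda>k. \<phi> (x - e k) * cnj (LINT y|lborel. \<phi> y)) sums G x"
    unfolding G_def using sums_infsum_integer_points[OF e abs_summable_translates[OF order_refl]] by auto
  have ts: "summable (\<lambda>k. cmod (\<phi> (x - e k)))"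
    using sums_infsum_integer_points(2)[OF e abs_summable_translates[OF order_refl, of x 1]] by simp
  have cnjm [measurable]: "(\<lambda>y. cnj (\<phi> (y - m))) \<in> borel_measurable borel" for m
    by (rule borel_measurable_continuous_on[where f = cnj]) (auto intro: continuous_intros)
  have q0_eq: "q0 \<phi> x = (\<lambda>y. \<Sum>k. \<phi> (x - e k) * cnj (\<phi> (y - e k)))"
    using q0 by (auto simp: sums_iff)
  show "q0 \<phi> x \<in> borel_measurable borel"
    unfolding q0_eq by measurable
  have int: "integrable lborel (\<lambda>y. \<phi> (x - m) * cnj (\<phi> (y - m)))" for m
    by (intro integrable_mult_right integrable_cnj integrable_translate)
  have tn: "(LINT y|lborel. cmod (\<phi> (y - m))) = (LINT y|lborel. cmod (\<phi> y))" for m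
  proof -
    have "integrable lborel (\<lambda>y. complex_of_real (cmod (\<phi> (y - m))))" for m
      by (intro integrable_of_real integrable_norm integrable_translate)
    from integral_lborel_affine[OF this[of m], of 1 m] show ?thesis by simp
  qed
  have "(LINT y|lborel. q0 \<phi> x y) = (\<Sum>k. LINT y|lborel. \<phi> (x - e k) * cnj (\<phi> (y - e k)))"
    unfolding q0_eq
  proof (rule integral_suminf)
    show "AE y in lborel. summable (\<lambda>k. norm (\<phi> (x - e k) * cnj (\<phi> (y - e k))))" using q0s by simp
    have "(LINT y|lborel. norm (\<phi> (x - e k) * cnj (\<phi> (y - e k)))) = cmod (\<phi> (x - e k)) * (LINT y|lborel. cmod (\<phi> y))" for k
      by (simp add: norm_mult tn)
    then show "summable (\<lambda>k. LINT y|lborel. norm (\<phi> (x - e k) * cnj (\<phi> (y - e k))))"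
      using ts by (simp add: summable_mult2)
  qed (rule int)
  also have "\<dots> = (\<Sum>k. \<phi> (x - e k) * cnj (LINT y|lborel. \<phi> y))"
    by (simp add: integral_translate)
  also have "\<dots> = G x" using G by (simp add: sums_iff)
  finally show "(LINT y|lborel. q0 \<phi> x y) = G x" .
qed

lemma G_periodic:
  assumes "k \<in> integer_points"
  shows "G (x + k) = G x"
proof -
  have "bij_betw (\<lambda>m. m - k) integer_points integer_points"
    by (rule bij_betw_byWitness[where f' = "\<lambda>m. m + k"])
       (use assms in \<open>auto intro: integer_points_diff integer_points_add\<close>)
  from infsum_reindex_bij_betw[OF this, of "\<lambda>m. \<phi> (x - m) * cnj (LINT y|lborel. \<phi> y)"]
  show ?thesis unfolding G_def by (simp add: algebra_simps)
qed

text \<open>Weierstrass test on a ball about the origin with \<open>x\<close> in its interior: there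
  \<open>norm m\<close> exceeds \<open>norm (y - m)\<close> by a bounded amount at most, so the
  terms have a common summable majorant.\<close>

lemma G_isCont: "isCont G x"
proof -
  let ?a = "cnj (LINT y|lborel. \<phi> y)"
  define B where "B = ball (0::real^'n) (norm x + 1)"
  have "uniform_limit B (\<lambda>F y. \<Sum>m\<in>F. \<phi> (y - m) * ?a) (\<lambda>y. \<Sum>\<^sub>\<infinity>m\<in>integer_points. \<phi> (y - m) * ?a)
      (finite_subsets_at_top integer_points)"
  proof (rule Weierstrass_m_test_general)
    show "(\<lambda>m. (D * cmod ?a * exp (c * (norm x + 1))) * exp (- c * norm (0 - m))) summable_on integer_points"
      using integer_points_exp_summable[OF c] by (intro summable_on_cmult_right) blast
    fix m y :: "real^'n" assume "y \<in> B"
    then have "norm y \<le> norm x + 1" by (simp add: B_def)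
    moreover have "norm m \<le> norm (y - m) + norm y" using norm_triangle_ineq4[of y "y - m"] by simp
    ultimately have "c * norm m \<le> c * (norm (y - m) + (norm x + 1))" using c by (intro mult_left_mono) auto
    then have "exp (- c * norm (y - m)) \<le> exp (c * (norm x + 1)) * exp (- c * norm (0 - m))"
      by (simp add: exp_add[symmetric] algebra_simps)
    then have "D * exp (- c * norm (y - m)) \<le> D * (exp (c * (norm x + 1)) * exp (- c * norm (0 - m)))"
      using D by (rule mult_left_mono)
    then have "cmod (\<phi> (y - m)) \<le> D * (exp (c * (norm x + 1)) * exp (- c * norm (0 - m)))"
      using decay1[of "y - m"] by linarith
    then have "cmod (\<phi> (y - m)) * cmod ?a \<le> D * (exp (c * (norm x + 1)) * exp (- c * norm (0 - m))) * cmod ?a"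
      by (rule mult_right_mono) simp
    then show "norm (\<phi> (y - m) * ?a) \<le> (D * cmod ?a * exp (c * (norm x + 1))) * exp (- c * norm (0 - m))"
      by (simp only: norm_mult mult_ac)
  qed
  then have "continuous_on B (\<lambda>y. \<Sum>\<^sub>\<infinity>m\<in>integer_points. \<phi> (y - m) * ?a)"
  proof (rule uniform_limit_theorem[rotated])
    have "continuous_on B (\<lambda>y. \<phi> (y - m))" for m
      by (rule continuous_on_compose2[OF cont]) (auto intro: continuous_intros)
    then show "\<forall>\<^sub>F F in finite_subsets_at_top integer_points. continuous_on B (\<lambda>y. \<Sum>m\<in>F. \<phi> (y - m) * ?a)"
      by (intro always_eventually allI continuous_intros) auto
  qed simp
  then have "continuous_on B G" unfolding G_def[abs_def] .
  moreover have "x \<in> interior B" by (simp add: B_def)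
  ultimately show ?thesis by (rule continuous_on_interior)
qed

text \<open>For \<open>norm x < R / 2\<close> there are two errors. A coefficient differs from the
  full integral by an integral over \<open>norm y \<ge> R\<close>, and a lattice point outside
  \<open>F\<close> has \<open>norm m \<ge> R\<close>. In both cases the distance to \<open>x\<close>
  is at least \<open>R / 2\<close>, and part of the decay at that distance yields
  \<open>exp (- c * R / 4)\<close>. \<open>F\<close> may exceed the lattice points of the ball
  because it will also contain the index set of a given approximation.\<close>

lemma partial_projection_close_to_G:
  obtains K where "K \<ge> 0" "\<And>R F x. R > 0 \<Longrightarrow> finite F \<Longrightarrow> F \<subseteq> integer_points \<Longrightarrow> integer_points \<inter> ball 0 R \<subseteq> F \<Longrightarrow>
     x \<in> ball 0 (R / 2) \<Longrightarrow> cmod ((\<Sum>m\<in>F. L2_inner (indicator (ball 0 R)) (\<lambda>x. \<phi> (x - m)) * \<phi> (x - m)) - G x)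
        \<le> K * exp (- c * R / 4)"
proof -
  let ?I = "LINT y|lborel. \<phi> y"
  obtain S where S: "S \<ge> 0" "\<And>x A. A \<subseteq> integer_points \<Longrightarrow> (\<lambda>m. exp (- c * norm (x - m))) summable_on A \<and>
      (\<Sum>\<^sub>\<infinity>m\<in>A. exp (- c * norm (x - m :: real^'n))) \<le> S"
    using integer_points_exp_summable[OF c, where 'n='n] by blast
  define E where "E = exp_integral TYPE('n) (c / 2)"
  have E: "E \<ge> 0" unfolding E_def using c by (intro exp_norm_integral(4)) simp
  define K where "K = D\<^sup>2 * E * S + D * cmod ?I * S"
  have "cmod ((\<Sum>m\<in>F. L2_inner (indicator (ball 0 R)) (\<lambda>x. \<phi> (x - m)) * \<phi> (x - m)) - G x) \<le> K * exp (- c * R / 4)"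
    if R: "R > 0" and F: "finite F" "F \<subseteq> integer_points" "integer_points \<inter> ball 0 R \<subseteq> F"
      and x: "x \<in> ball 0 (R / 2)" for R F x
  proof -
    define a where "a m = L2_inner (indicator (ball 0 R)) (\<lambda>x. \<phi> (x - m))" for m
    have cnjm [measurable]: "(\<lambda>y. cnj (\<phi> (y - m))) \<in> borel_measurable borel" for m
      by (rule borel_measurable_continuous_on[where f = cnj]) (auto intro: continuous_intros)
    have am: "a m = (LINT y|lborel. indicator (ball 0 R) y *\<^sub>R cnj (\<phi> (y - m)))" for m
    proof -
      have "a m = (LINT y|lebesgue. indicator (ball 0 R) y *\<^sub>R cnj (\<phi> (y - m)))"
        unfolding a_def L2_inner_def by (intro Bochner_Integration.integral_cong) (auto simp: indicator_def)
      moreover have "(\<lambda>y. indicat_real (ball 0 R) y *\<^sub>R cnj (\<phi> (y - m))) \<in> borel_measurable lborel"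
        by (intro borel_measurable_scaleR borel_measurable_indicator) auto
      ultimately show ?thesis by (simp add: integral_completion)
    qed
    have diff: "cnj ?I - a m = (LINT y|lborel. indicator (- ball 0 R) y *\<^sub>R cnj (\<phi> (y - m)))" for m
    proof -
      have i: "integrable lborel (\<lambda>y. cnj (\<phi> (y - m)))" by (intro integrable_cnj integrable_translate)
      have "cnj ?I = (LINT y|lborel. cnj (\<phi> (y - m)))" by (simp add: integral_translate)
      then have "cnj ?I - a m = (LINT y|lborel. cnj (\<phi> (y - m)) - indicator (ball 0 R) y *\<^sub>R cnj (\<phi> (y - m)))"
        unfolding am using i
        by (subst Bochner_Integration.integral_diff) (auto intro!: integrable_mult_indicator)
      also have "\<dots> = (LINT y|lborel. indicator (- ball 0 R) y *\<^sub>R cnj (\<phi> (y - m)))"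
        by (intro Bochner_Integration.integral_cong) (auto simp: indicator_def)
      finally show ?thesis .
    qed
    have t1: "cmod ((a m - cnj ?I) * \<phi> (x - m)) \<le> D\<^sup>2 * E * exp (- c * R / 4) * exp (- c * norm (x - m))" for m
    proof -
      have "cmod ((a m - cnj ?I) * \<phi> (x - m)) = cmod (\<phi> (x - m) * (cnj ?I - a m))"
        by (simp add: norm_mult norm_minus_commute)
      also have "\<phi> (x - m) * (cnj ?I - a m) = (LINT y|lborel. \<phi> (x - m) * (indicator (- ball 0 R) y *\<^sub>R cnj (\<phi> (y - m))))"
        unfolding diff by (rule integral_mult_right_zero[symmetric])
      also have "cmod \<dots> \<le> (LINT y|lborel. D\<^sup>2 * exp (- c * R / 4) * exp (- c * norm (x - m)) * exp (- (c / 2) * norm (x - y)))"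
      proof (rule order_trans[OF integral_norm_bound integral_mono])
        show "integrable lborel (\<lambda>y. norm (\<phi> (x - m) * (indicator (- ball 0 R) y *\<^sub>R cnj (\<phi> (y - m)))))"
          by (intro integrable_norm integrable_mult_right integrable_mult_indicator integrable_cnj integrable_translate) auto
        show "integrable lborel (\<lambda>y. D\<^sup>2 * exp (- c * R / 4) * exp (- c * norm (x - m)) * exp (- (c / 2) * norm (x - y)))"
          using c by (intro integrable_mult_right exp_norm_integral(1)) auto
        fix y
        show "norm (\<phi> (x - m) * (indicator (- ball 0 R) y *\<^sub>R cnj (\<phi> (y - m))))
          \<le> D\<^sup>2 * exp (- c * R / 4) * exp (- c * norm (x - m)) * exp (- (c / 2) * norm (x - y))"
        proof (cases "y \<in> ball 0 R")
          case False
          then have "R \<le> norm y" by simp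
          moreover have "norm y \<le> norm x + norm (x - y)" using norm_triangle_ineq4[of x "x - y"] by simp
          ultimately have "R / 2 \<le> norm (x - y)" using x by simp
          then have "c * (R / 2) \<le> c * norm (x - y)" using c by (intro mult_left_mono) auto
          \<comment> \<open>Half of the exponent gives smallness in \<open>R\<close>, the other half
            keeps the integral over \<open>y\<close> finite.\<close>
          then have "exp (- c * norm (x - y)) \<le> exp (- c * R / 4) * exp (- (c / 2) * norm (x - y))"
            by (simp add: exp_add[symmetric])
          then have "D\<^sup>2 * exp (- c * norm (x - m)) * exp (- c * norm (x - y))
             \<le> D\<^sup>2 * exp (- c * norm (x - m)) * (exp (- c * R / 4) * exp (- (c / 2) * norm (x - y)))"
            by (intro mult_left_mono) auto
          moreover have "cmod (\<phi> (x - m)) * cmod (\<phi> (y - m)) \<le> D\<^sup>2 * exp (- c * norm (x - y)) * exp (- c * norm (x - m))"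
            using prod_bound[of "x - m" "y - m"] by simp
          ultimately show ?thesis using False by (simp add: norm_mult mult_ac)
        qed simp
      qed
      also have "\<dots> = D\<^sup>2 * exp (- c * R / 4) * exp (- c * norm (x - m)) * E"
        unfolding E_def using c by (subst integral_mult_right_zero, subst exp_norm_integral(2)) auto
      finally show ?thesis by (simp only: mult_ac)
    qed
    have sumA: "cmod (\<Sum>m\<in>F. (a m - cnj ?I) * \<phi> (x - m)) \<le> D\<^sup>2 * E * S * exp (- c * R / 4)"
    proof -
      have "cmod (\<Sum>m\<in>F. (a m - cnj ?I) * \<phi> (x - m)) \<le> (\<Sum>m\<in>F. D\<^sup>2 * E * exp (- c * R / 4) * exp (- c * norm (x - m)))"
        by (rule order_trans[OF norm_sum sum_mono[OF t1]])
      also have "\<dots> = D\<^sup>2 * E * exp (- c * R / 4) * (\<Sum>m\<in>F. exp (- c * norm (x - m)))"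
        by (simp add: sum_distrib_left)
      also have "\<dots> \<le> D\<^sup>2 * E * exp (- c * R / 4) * S"
        using S(2)[OF F(2), of x] F(1) E by (intro mult_left_mono) auto
      finally show ?thesis by (simp only: mult_ac)
    qed
    let ?T = "integer_points - F"
    have sumB: "cmod (\<Sum>\<^sub>\<infinity>m\<in>?T. \<phi> (x - m) * cnj ?I) \<le> D * cmod ?I * S * exp (- c * R / 4)"
    proof -
      have sT: "(\<lambda>m. (D * cmod ?I * exp (- c * R / 4)) * exp (- c * norm (x - m))) summable_on ?T"
        using S(2)[of ?T x] by (intro summable_on_cmult_right) auto
      have "cmod (\<Sum>\<^sub>\<infinity>m\<in>?T. \<phi> (x - m) * cnj ?I) \<le> (\<Sum>\<^sub>\<infinity>m\<in>?T. norm (\<phi> (x - m) * cnj ?I))"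
        by (rule norm_infsum_bound[OF abs_summable_translates]) auto
      also have "\<dots> \<le> (\<Sum>\<^sub>\<infinity>m\<in>?T. (D * cmod ?I * exp (- c * R / 4)) * exp (- c * norm (x - m)))"
      proof (rule infsum_mono[OF abs_summable_translates sT])
        fix m assume m: "m \<in> ?T"
        then have "R \<le> norm m" using F(3) by auto
        moreover have "norm m \<le> norm x + norm (x - m)" using norm_triangle_ineq4[of x "x - m"] by simp
        ultimately have "R / 2 \<le> norm (x - m)" using x by simp
        then have "c * (R / 4) \<le> c * norm (x - m)" using c R by (intro mult_left_mono) auto
        then have "exp (- (2 * c) * norm (x - m)) \<le> exp (- c * R / 4) * exp (- c * norm (x - m))"
          by (simp add: exp_add[symmetric])
        then have "D * exp (- (2 * c) * norm (x - m)) \<le> D * (exp (- c * R / 4) * exp (- c * norm (x - m)))"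
          using D by (rule mult_left_mono)
        then have "cmod (\<phi> (x - m)) \<le> D * (exp (- c * R / 4) * exp (- c * norm (x - m)))"
          using decay[of "x - m"] by linarith
        then have "cmod (\<phi> (x - m)) * cmod ?I \<le> D * (exp (- c * R / 4) * exp (- c * norm (x - m))) * cmod ?I"
          by (rule mult_right_mono) simp
        then show "norm (\<phi> (x - m) * cnj ?I) \<le> (D * cmod ?I * exp (- c * R / 4)) * exp (- c * norm (x - m))"
          by (simp only: norm_mult complex_mod_cnj mult_ac)
      qed auto
      also have "\<dots> = (D * cmod ?I * exp (- c * R / 4)) * (\<Sum>\<^sub>\<infinity>m\<in>?T. exp (- c * norm (x - m)))"
        by (rule infsum_cmult_right')
      also have "\<dots> \<le> (D * cmod ?I * exp (- c * R / 4)) * S"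
        using S(2)[of ?T x] D by (intro mult_left_mono) auto
      finally show ?thesis by (simp only: mult_ac)
    qed
    have "G x = (\<Sum>m\<in>F. \<phi> (x - m) * cnj ?I) + (\<Sum>\<^sub>\<infinity>m\<in>?T. \<phi> (x - m) * cnj ?I)"
    proof -
      have "integer_points = F \<union> ?T" using F(2) by blast
      then have "G x = (\<Sum>\<^sub>\<infinity>m\<in>F \<union> ?T. \<phi> (x - m) * cnj ?I)" unfolding G_def by simp
      also have "\<dots> = (\<Sum>\<^sub>\<infinity>m\<in>F. \<phi> (x - m) * cnj ?I) + (\<Sum>\<^sub>\<infinity>m\<in>?T. \<phi> (x - m) * cnj ?I)"
        using F by (intro infsum_Un_disjoint abs_summable_summable[OF abs_summable_translates]) auto
      finally show ?thesis using F(1) by simp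
    qed
    then have split: "(\<Sum>m\<in>F. a m * \<phi> (x - m)) - G x
        = (\<Sum>m\<in>F. (a m - cnj ?I) * \<phi> (x - m)) - (\<Sum>\<^sub>\<infinity>m\<in>?T. \<phi> (x - m) * cnj ?I)"
      by (simp add: algebra_simps sum_subtractf)
    have "cmod ((\<Sum>m\<in>F. a m * \<phi> (x - m)) - G x)
        \<le> D\<^sup>2 * E * S * exp (- c * R / 4) + D * cmod ?I * S * exp (- c * R / 4)"
      unfolding split by (rule order_trans[OF norm_triangle_ineq4 add_mono[OF sumA sumB]])
    then show ?thesis unfolding a_def K_def by (simp only: distrib_right)
  qed
  moreover have "K \<ge> 0" using D E S(1) by (simp add: K_def)
  ultimately show thesis by (intro that)
qed

text \<open>If \<open>G x1 \<noteq> 1\<close>, then \<open>cmod (1 - G y)\<close> is at least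
  \<open>\<eta>\<close> on disjoint balls about the points \<open>x1 + m\<close>. Counting the
  relevant \<open>m\<close> bounds the integral of its square over \<open>ball 0 (R / 2)\<close>
  below by \<open>\<kappa> * R ^ n\<close>, while the approximation bounds it above by half of that
  once \<open>R\<close> is large.\<close>

lemma G_eq_1:
  assumes V: "MRA V" and \<phi>: "scaling_function V \<phi>"
  shows "G x1 = 1"
proof (rule ccontr)
  assume ne: "G x1 \<noteq> 1"
  let ?n = "CARD('n)"
  define v where "v = measure lborel (ball (0::real^'n) 1)"
  have v: "v > 0" unfolding v_def by simp
  have vb: "emeasure lborel (ball (x::real^'n) r) = ennreal (v * r ^ ?n)" if "r \<ge> 0" for x r
    using measure_ball_eq[OF that, of x] emeasure_lborel_ball_finite[of x r]
    by (simp add: emeasure_eq_ennreal_measure v_def)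
  define \<eta> where "\<eta> = cmod (1 - G x1) / 2"
  have \<eta>: "\<eta> > 0" using ne by (simp add: \<eta>_def)
  obtain d where d: "d > 0" "\<And>y. dist y x1 < d \<Longrightarrow> dist (G y) (G x1) < \<eta>"
    using G_isCont[of x1] \<eta> unfolding continuous_at_eps_delta by blast
  \<comment> \<open>At most 1/2, so that the translates by distinct lattice points are
    disjoint.\<close>
  define r0 where "r0 = min d (1/2)"
  have r0: "0 < r0" "r0 \<le> d" "r0 \<le> 1/2" using d by (auto simp: r0_def)
  have low: "\<eta> \<le> cmod (1 - G y)" if "m \<in> integer_points" "y \<in> ball (x1 + m) r0" for m y
  proof -
    have "dist (y - m) x1 < d" using that(2) r0 by (simp add: dist_norm norm_minus_commute algebra_simps)
    then have "dist (G (y - m)) (G x1) < \<eta>" by (rule d(2))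
    moreover have "G (y - m) = G y" using G_periodic[OF that(1), of "y - m"] by simp
    ultimately have "cmod (G y - G x1) < \<eta>" by (simp add: dist_norm)
    moreover have "cmod (1 - G x1) \<le> cmod (1 - G y) + cmod (G y - G x1)"
      using norm_triangle_ineq[of "1 - G y" "G y - G x1"] by simp
    ultimately show ?thesis by (simp add: \<eta>_def)
  qed
  obtain K where K: "K \<ge> 0" "\<And>R F x. R > 0 \<Longrightarrow> finite F \<Longrightarrow> F \<subseteq> integer_points \<Longrightarrow> integer_points \<inter> ball 0 R \<subseteq> F \<Longrightarrow>
     x \<in> ball 0 (R / 2) \<Longrightarrow> cmod ((\<Sum>m\<in>F. L2_inner (indicator (ball 0 R)) (\<lambda>x. \<phi> (x - m)) * \<phi> (x - m)) - G x)
        \<le> K * exp (- c * R / 4)"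
    by (rule partial_projection_close_to_G, rule that, assumption+)
  \<comment> \<open>At least \<open>(R / (8 * n)) ^ n\<close> lattice points are counted, each with
    a ball of volume \<open>v * r0 ^ n\<close> on which the integrand is at least the square of
    \<open>\<eta>\<close>; \<open>\<kappa>\<close> is this product without the factor
    \<open>R ^ n\<close>.\<close>
  define \<kappa> where "\<kappa> = (1 / (8 * real ?n)) ^ ?n * \<eta>\<^sup>2 * v * r0 ^ ?n"
  have \<kappa>: "\<kappa> > 0" using \<eta> v r0 by (simp add: \<kappa>_def)
  \<comment> \<open>The three lower bounds serve the lattice count, the inclusion of the balls about
    \<open>x1 + m\<close> in \<open>ball 0 (R / 2)\<close>, and the smallness of the error
    \<open>\<delta>\<close>.\<close>
  define R0 where "R0 = max (8 * real ?n) (max (4 * (norm x1 + 1)) (16 * K\<^sup>2 * v / (c * \<kappa>)))"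
  \<comment> \<open>The factor 2 from squaring a sum turns \<open>\<kappa> / 8\<close> into
    \<open>\<kappa> / 4\<close>; the error \<open>\<delta>\<close> adds another
    \<open>\<kappa> / 4\<close>.\<close>
  have "\<kappa> / 8 > 0" using \<kappa> by simp
  from MRA_ball_approximation[OF V \<phi> this, of R0] obtain R F d' where R: "R \<ge> R0" and F: "finite F" "F \<subseteq> integer_points"
    and N: "(L2_norm (\<lambda>x. indicator (ball 0 R) x - (\<Sum>m\<in>F. d' m * \<phi> (x - m))))\<^sup>2 \<le> \<kappa> / 8 * R ^ ?n"
    by blast
  have R': "R \<ge> 8 * real ?n" "R \<ge> 4 * (norm x1 + 1)" "R \<ge> 16 * K\<^sup>2 * v / (c * \<kappa>)"
    using R by (auto simp: R0_def)
  have "0 < 4 * (norm x1 + 1)" by (simp add: add_nonneg_pos)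
  then have Rpos: "R > 0" using R'(2) by (rule less_le_trans)
  \<comment> \<open>\<open>F\<close> comes from the density of the spaces and is unrelated to the
    ball, whereas closeness to \<open>G\<close> requires all lattice points of the ball; the union
    has both properties.\<close>
  define F' where "F' = F \<union> (integer_points \<inter> ball 0 R)"
  have F': "finite F'" "F' \<subseteq> integer_points" "F \<subseteq> F'" "integer_points \<inter> ball 0 R \<subseteq> F'"
    using F finite_integer_points_ball by (auto simp: F'_def)
  define P where "P x = (\<Sum>m\<in>F'. L2_inner (indicator (ball 0 R)) (\<lambda>x. \<phi> (x - m)) * \<phi> (x - m))" for x
  have [measurable]: "P \<in> borel_measurable borel" unfolding P_def[abs_def] by measurable
  have [measurable]: "G \<in> borel_measurable borel"
    by (intro borel_measurable_continuous_onI continuous_at_imp_continuous_on ballI G_isCont)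
  have onb: "L2_orthonormal_basis integer_points (\<lambda>m x. \<phi> (x - m)) (V 0)"
    using \<phi> by (simp add: scaling_function_def)
  let ?f = "indicator (ball 0 R) :: real^'n \<Rightarrow> complex"
  have "(L2_norm (\<lambda>x. ?f x - P x))\<^sup>2 \<le> (L2_norm (\<lambda>x. ?f x - (\<Sum>m\<in>F. d' m * \<phi> (x - m))))\<^sup>2"
    unfolding P_def
  proof (rule L2_best_approximation)
    fix m k assume "m \<in> F'" "k \<in> F'"
    then show "L2_inner (\<lambda>x. \<phi> (x - m)) (\<lambda>x. \<phi> (x - k)) = (if m = k then 1 else 0)"
      using onb F'(2) unfolding L2_orthonormal_basis_def by blast
  qed (use F' phi_L2 indicator_ball_L2 in auto)
  then have N': "(L2_norm (\<lambda>x. ?f x - P x))\<^sup>2 \<le> \<kappa> / 8 * R ^ ?n" using N by linarith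
  have PL2: "(\<lambda>x. ?f x - P x) \<in> L2"
    unfolding P_def by (intro L2_diff indicator_ball_L2 L2_sum phi_L2)
  have int: "(\<integral>\<^sup>+x. ennreal ((cmod (?f x - P x))\<^sup>2) \<partial>lborel) \<le> ennreal (\<kappa> / 8 * R ^ ?n)"
  proof -
    have "(\<integral>\<^sup>+x. ennreal ((cmod (?f x - P x))\<^sup>2) \<partial>lborel) = (\<integral>\<^sup>+x. ennreal ((cmod (?f x - P x))\<^sup>2) \<partial>lebesgue)"
      by (simp add: nn_integral_completion)
    also have "\<dots> = ennreal ((L2_norm (\<lambda>x. ?f x - P x))\<^sup>2)"
      unfolding L2_norm_power2 using PL2 by (intro nn_integral_eq_integral) (auto simp: L2_def)
    also have "\<dots> \<le> ennreal (\<kappa> / 8 * R ^ ?n)" using N' by (rule ennreal_leI)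
    finally show ?thesis .
  qed
  define \<delta> where "\<delta> = K * exp (- c * R / 4)"
  have \<delta>: "\<delta> \<ge> 0" using K by (simp add: \<delta>_def)
  let ?B = "ball (0::real^'n) (R / 2)"
  have "(\<integral>\<^sup>+x. ennreal ((cmod (1 - G x))\<^sup>2) * indicator ?B x \<partial>lborel)
     \<le> (\<integral>\<^sup>+x. 2 * ennreal ((cmod (?f x - P x))\<^sup>2) + ennreal (2 * \<delta>\<^sup>2) * indicator ?B x \<partial>lborel)"
  proof (rule nn_integral_mono)
    fix x
    show "ennreal ((cmod (1 - G x))\<^sup>2) * indicator ?B x \<le> 2 * ennreal ((cmod (?f x - P x))\<^sup>2) + ennreal (2 * \<delta>\<^sup>2) * indicator ?B x"
    proof (cases "x \<in> ?B")
      case True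
      then have f1: "?f x = 1" using Rpos by (simp add: indicator_def)
      have "cmod (P x - G x) \<le> \<delta>"
        unfolding P_def \<delta>_def by (rule K(2)[OF Rpos F'(1,2,4) True])
      then have "cmod (1 - G x) \<le> cmod (?f x - P x) + \<delta>"
        using norm_triangle_ineq[of "1 - P x" "P x - G x"] by (simp add: f1)
      then have "(cmod (1 - G x))\<^sup>2 \<le> (cmod (?f x - P x) + \<delta>)\<^sup>2" by (intro power_mono) auto
      also have "\<dots> \<le> 2 * (cmod (?f x - P x))\<^sup>2 + 2 * \<delta>\<^sup>2"
        using sum_squares_bound[of "cmod (?f x - P x)" \<delta>] by (simp add: power2_sum)
      finally have "ennreal ((cmod (1 - G x))\<^sup>2) \<le> ennreal (2 * (cmod (?f x - P x))\<^sup>2 + 2 * \<delta>\<^sup>2)" by (rule ennreal_leI)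
      also have "\<dots> = 2 * ennreal ((cmod (?f x - P x))\<^sup>2) + ennreal (2 * \<delta>\<^sup>2)"
        by (simp add: ennreal_plus ennreal_mult')
      finally show ?thesis using True by simp
    qed simp
  qed
  also have "\<dots> = 2 * (\<integral>\<^sup>+x. ennreal ((cmod (?f x - P x))\<^sup>2) \<partial>lborel) + ennreal (2 * \<delta>\<^sup>2) * emeasure lborel ?B"
  proof -
    have [measurable]: "?B \<in> sets borel" "ball (0::real^'n) R \<in> sets borel" by auto
    have m1: "(\<lambda>x. ennreal ((cmod (?f x - P x))\<^sup>2)) \<in> borel_measurable lborel" by measurable
    have m2: "(\<lambda>x. ennreal (2 * \<delta>\<^sup>2) * indicator ?B x) \<in> borel_measurable lborel" by measurable
    show ?thesis
      using m1 m2 by (simp add: nn_integral_add nn_integral_cmult nn_integral_cmult_indicator del: ennreal_mult'')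
  qed
  also have "\<dots> \<le> 2 * ennreal (\<kappa> / 8 * R ^ ?n) + ennreal (2 * \<delta>\<^sup>2) * ennreal (v * (R / 2) ^ ?n)"
    using int vb[of "R / 2" 0] Rpos by (intro add_mono mult_left_mono) auto
  also have "\<dots> = ennreal (2 * (\<kappa> / 8 * R ^ ?n) + 2 * \<delta>\<^sup>2 * (v * (R / 2) ^ ?n))"
  proof -
    have "2 * ennreal a + ennreal b * ennreal d = ennreal (2 * a + b * d)" if "0 \<le> a" "0 \<le> b" "0 \<le> d" for a b d
    proof -
      have "2 * ennreal a = ennreal (2 * a)" using that by (simp add: ennreal_mult')
      then show ?thesis using that by (simp add: ennreal_mult[symmetric] ennreal_plus[symmetric] del: ennreal_plus)
    qed
    then show ?thesis by this (use \<kappa> v Rpos in auto)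
  qed
  finally have upper: "(\<integral>\<^sup>+x. ennreal ((cmod (1 - G x))\<^sup>2) * indicator ?B x \<partial>lborel)
     \<le> ennreal (2 * (\<kappa> / 8 * R ^ ?n) + 2 * \<delta>\<^sup>2 * (v * (R / 2) ^ ?n))" .
  define L where "L = integer_points \<inter> ball (0::real^'n) (R / 4)"
  have Lf: "finite L" unfolding L_def by (rule finite_integer_points_ball)
  have cardL: "(R / (8 * real ?n)) ^ ?n \<le> real (card L)"
  proof -
    \<comment> \<open>Points of the ball of radius \<open>R / 8\<close> lie within \<open>n\<close>
      of a lattice point, whose norm is then below \<open>R / 4\<close> since
      \<open>n \<le> R / 8\<close>. Comparing volumes yields the count.\<close>
    let ?U = "\<Union>m\<in>L. cball m (real ?n)"
    have sub: "ball 0 (R / 8) \<subseteq> ?U"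
    proof
      fix x :: "real^'n" assume x: "x \<in> ball 0 (R / 8)"
      obtain m where m: "m \<in> integer_points" "norm (x - m) \<le> real ?n" using integer_point_near by blast
      have "norm m \<le> norm x + norm (x - m)" using norm_triangle_ineq4[of x "x - m"] by simp
      also have "\<dots> < R / 8 + R / 8" using x m R'(1) by simp
      finally have "m \<in> L" using m by (simp add: L_def)
      then show "x \<in> ?U" using m(2) by (auto simp: dist_norm norm_minus_commute)
    qed
    have "v * (R / 8) ^ ?n = measure lborel (ball (0::real^'n) (R / 8))"
      unfolding v_def by (rule measure_ball_eq[symmetric]) (use Rpos in simp)
    also have "\<dots> \<le> measure lborel ?U"
    proof (rule measure_mono_fmeasurable[OF sub])
      have "compact ?U" using Lf by (intro compact_UN) auto
      then show "?U \<in> fmeasurable lborel"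
        using emeasure_bounded_finite[OF compact_imp_bounded] by (intro fmeasurableI) (auto dest: borel_compact)
    qed simp
    also have "\<dots> \<le> (\<Sum>m\<in>L. measure lborel (cball m (real ?n)))"
      by (rule measure_UNION_le[OF Lf]) simp
    also have "\<dots> = (\<Sum>m\<in>L. v * real ?n ^ ?n)"
    proof (rule sum.cong[OF refl])
      fix m :: "real^'n"
      have "measure lborel (cball m (real ?n)) = measure lborel (ball m (real ?n))"
        by (simp add: content_ball content_cball)
      also have "\<dots> = v * real ?n ^ ?n" unfolding v_def by (rule measure_ball_eq) simp
      finally show "measure lborel (cball m (real ?n)) = v * real ?n ^ ?n" .
    qed
    finally have "(R / 8) ^ ?n \<le> real (card L) * real ?n ^ ?n" using v by simp
    then show ?thesis by (simp add: power_divide power_mult_distrib field_simps)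
  qed
  have disj: "disjoint_family_on (\<lambda>m. ball (x1 + m) r0) L"
  proof (unfold disjoint_family_on_def, intro ballI impI)
    fix m k assume "m \<in> L" "k \<in> L" "m \<noteq> k"
    then have "1 \<le> dist (x1 + m) (x1 + k)"
      using integer_points_separated[of m k] by (auto simp: dist_norm L_def)
    then show "ball (x1 + m) r0 \<inter> ball (x1 + k) r0 = {}"
      using r0 by (intro disjoint_ballI) simp
  qed
  let ?W = "\<Union>m\<in>L. ball (x1 + m) r0"
  have "ennreal (real (card L) * (\<eta>\<^sup>2 * v * r0 ^ ?n)) = ennreal (\<eta>\<^sup>2) * (\<Sum>m\<in>L. ennreal (v * r0 ^ ?n))"
    using v r0 by (simp add: ennreal_mult'[symmetric] ennreal_of_nat_eq_real_of_nat mult_ac)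
  also have "(\<Sum>m\<in>L. ennreal (v * r0 ^ ?n)) = (\<Sum>m\<in>L. emeasure lborel (ball (x1 + m) r0))"
    using vb r0 by simp
  also have "\<dots> = emeasure lborel ?W"
    using Lf disj by (intro sum_emeasure) auto
  also have "ennreal (\<eta>\<^sup>2) * emeasure lborel ?W = (\<integral>\<^sup>+x. ennreal (\<eta>\<^sup>2) * indicator ?W x \<partial>lborel)"
    by (rule nn_integral_cmult_indicator[symmetric]) (auto intro!: borel_open open_UN)
  also have "\<dots> \<le> (\<integral>\<^sup>+x. ennreal ((cmod (1 - G x))\<^sup>2) * indicator ?B x \<partial>lborel)"
  proof (rule nn_integral_mono)
    fix y
    show "ennreal (\<eta>\<^sup>2) * indicator ?W y \<le> ennreal ((cmod (1 - G y))\<^sup>2) * indicator ?B y"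
    proof (cases "y \<in> ?W")
      case True
      then obtain m where m: "m \<in> L" "y \<in> ball (x1 + m) r0" by blast
      have "norm y \<le> norm x1 + norm m + norm (y - (x1 + m))"
        using norm_triangle_ineq[of "x1 + m" "y - (x1 + m)"] norm_triangle_ineq[of x1 m] by simp
      also have "\<dots> < norm x1 + R / 4 + 1 / 2"
        using m r0 by (simp add: L_def dist_norm norm_minus_commute)
      also have "\<dots> < R / 2" using R'(2) by simp
      finally have "y \<in> ?B" by simp
      moreover have "\<eta>\<^sup>2 \<le> (cmod (1 - G y))\<^sup>2"
        using low[OF _ m(2)] m(1) \<eta> by (intro power_mono) (auto simp: L_def)
      ultimately show ?thesis using True by (simp add: ennreal_leI)
    qed simp
  qed
  also note upper
  finally have "real (card L) * (\<eta>\<^sup>2 * v * r0 ^ ?n) \<le> 2 * (\<kappa> / 8 * R ^ ?n) + 2 * \<delta>\<^sup>2 * (v * (R / 2) ^ ?n)"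
    using \<kappa> v Rpos by (subst (asm) ennreal_le_iff) auto
  moreover have "\<kappa> * R ^ ?n \<le> real (card L) * (\<eta>\<^sup>2 * v * r0 ^ ?n)"
  proof -
    have "\<kappa> * R ^ ?n = (R / (8 * real ?n)) ^ ?n * (\<eta>\<^sup>2 * v * r0 ^ ?n)"
      by (simp add: \<kappa>_def power_divide)
    also have "\<dots> \<le> real (card L) * (\<eta>\<^sup>2 * v * r0 ^ ?n)"
      using cardL v r0 by (intro mult_right_mono) auto
    finally show ?thesis .
  qed
  moreover have "2 * \<delta>\<^sup>2 * (v * (R / 2) ^ ?n) \<le> \<kappa> / 4 * R ^ ?n"
  proof -
    \<comment> \<open>Bounding the exponential below by its argument gives a condition on
      \<open>R\<close> in closed form, the third entry of \<open>R0\<close>.\<close>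
    have "c * R / 2 \<le> exp (c * R / 2)" using exp_ge_add_one_self[of "c * R / 2"] by linarith
    moreover have "c * R > 0" using c Rpos by simp
    ultimately have "exp (- (c * R / 2)) \<le> 2 / (c * R)" by (simp add: exp_minus field_simps)
    then have "K\<^sup>2 * exp (- (c * R / 2)) \<le> K\<^sup>2 * (2 / (c * R))" by (rule mult_left_mono) simp
    moreover have "\<delta>\<^sup>2 = K\<^sup>2 * exp (- (c * R / 2))"
      by (simp add: \<delta>_def power_mult_distrib power2_eq_square exp_add[symmetric])
    ultimately have "2 * \<delta>\<^sup>2 * v \<le> 2 * (K\<^sup>2 * (2 / (c * R))) * v"
      using v by (intro mult_right_mono) auto
    also have "\<dots> = 4 * K\<^sup>2 * v / (c * R)" by simp
    also have "\<dots> \<le> \<kappa> / 4" using R'(3) c \<kappa> Rpos by (simp add: field_simps)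
    finally have "2 * \<delta>\<^sup>2 * v * (R / 2) ^ ?n \<le> \<kappa> / 4 * (R / 2) ^ ?n"
      using Rpos by (intro mult_right_mono) auto
    also have "\<dots> \<le> \<kappa> / 4 * R ^ ?n"
      using Rpos \<kappa> by (intro mult_left_mono power_mono) auto
    finally show ?thesis by (simp add: mult.assoc)
  qed
  ultimately have "\<kappa> * R ^ ?n \<le> \<kappa> / 2 * R ^ ?n" by simp
  moreover have "\<kappa> * R ^ ?n > 0" using \<kappa> Rpos by simp
  ultimately show False by simp
qed

end


section \<open>Weights and the main theorem\<close>

locale weight =
  fixes M :: "real \<Rightarrow> real"
  assumes M_nonneg: "\<And>t. t \<ge> 0 \<Longrightarrow> M t \<ge> 0"
    and M_cont: "continuous_on {0..} M"
    and M_incr: "strict_mono_on {0..} M"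
    and M_superadd: "\<And>t s. t \<ge> 0 \<Longrightarrow> s \<ge> 0 \<Longrightarrow> M t + M s \<le> M (t + s)"
    and M_double: "\<And>t s. t \<ge> 0 \<Longrightarrow> s \<ge> 0 \<Longrightarrow> M (t + s) \<le> M (2 * t) + M (2 * s)"
begin

section \<open>Growth of the weight\<close>

lemma M_mono: "0 \<le> s \<Longrightarrow> s \<le> t \<Longrightarrow> M s \<le> M t"
  using strict_mono_onD[OF M_incr, of s t] by (cases "s = t") auto

lemma M_0: "M 0 = 0"
  using M_superadd[of 0 0] M_nonneg[of 0] by simp

lemma M_1: "M 1 > 0"
  using strict_mono_onD[OF M_incr, of 0 1] M_0 by simp

text \<open>Superadditivity sums unit steps, so \<open>M\<close> grows at least linearly with slope
  \<open>M 1\<close>, up to rounding. The slope is positive because \<open>M\<close> increases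
  strictly from \<open>M 0 = 0\<close>; it is the rate used in the exponential estimates.\<close>

lemma M_floor: "0 \<le> u \<Longrightarrow> M 1 * real (nat \<lfloor>u\<rfloor>) \<le> M u"
proof -
  assume u: "0 \<le> u"
  have "M 1 * real j \<le> M (real j)" for j
  proof (induction j)
    case (Suc j)
    then show ?case using M_superadd[of "real j" 1] by (simp add: algebra_simps)
  qed (simp add: M_0)
  then have "M 1 * real (nat \<lfloor>u\<rfloor>) \<le> M (real (nat \<lfloor>u\<rfloor>))" .
  also have "\<dots> \<le> M u" using u by (intro M_mono) (auto simp: of_nat_nat)
  finally show ?thesis .
qed

lemma M_linear: "0 \<le> u \<Longrightarrow> M 1 * u - M 1 \<le> M u"
proof -
  assume u: "0 \<le> u"
  have "u \<le> real (nat \<lfloor>u\<rfloor>) + 1" using u by linarith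
  then have "M 1 * u \<le> M 1 * (real (nat \<lfloor>u\<rfloor>) + 1)" using M_1 by (intro mult_left_mono) auto
  then show ?thesis using M_floor[OF u] by (simp add: distrib_left)
qed

lemma borel_measurable_M_norm [measurable]:
  "0 \<le> a \<Longrightarrow> (\<lambda>y::real^'n. M (a * norm (y - x))) \<in> borel_measurable borel"
  by (intro borel_measurable_continuous_onI continuous_on_compose2[OF M_cont] continuous_intros) auto

text \<open>A change of centre from the origin to \<open>x\<close>. The doubling condition charges a
  factor 2 inside \<open>M\<close>, which is why scales \<open>t \<ge> 2 * K\<close> are considered
  later.\<close>

lemma M_shift:
  fixes x y :: "'a::real_normed_vector"
  assumes "0 \<le> a"
  shows "M (a * norm y) \<le> M (2 * a * norm (x - y)) + M (2 * a * norm x)"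
proof -
  have "a * norm y \<le> a * norm (x - y) + a * norm x"
    using norm_triangle_ineq4[of x "x - y"] assms by (simp add: distrib_left[symmetric] mult_left_mono add.commute)
  then have "M (a * norm y) \<le> M (a * norm (x - y) + a * norm x)" using assms by (intro M_mono) auto
  also have "\<dots> \<le> M (2 * (a * norm (x - y))) + M (2 * (a * norm x))" using assms by (intro M_double) auto
  finally show ?thesis by (simp add: mult.assoc)
qed

text \<open>Near \<open>x0\<close> the local bound with a small \<open>\<eta>\<close> goes through
  the shell estimate, whose \<open>1 / t ^ n\<close> cancels the prefactor. Away from
  \<open>x0\<close> only the finite weighted mass of \<open>\<rho>\<close> is available; there the
  kernel is at most the weight times a factor exponentially small in \<open>t\<close>.\<close>

lemma weighted_kernel_tendsto_0:
  fixes \<rho> :: "(real^'n) measure"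
  assumes sets: "sets \<rho> = sets borel" and K: "K \<ge> 0"
    and fin: "(\<integral>\<^sup>+y. ennreal (exp (- M (K * norm y))) \<partial>\<rho>) < \<infinity>"
    and loc: "\<And>e. e > 0 \<Longrightarrow> \<exists>d>0. \<forall>r. 0 < r \<longrightarrow> r < d \<longrightarrow> emeasure \<rho> (ball x0 r) \<le> ennreal (e * r ^ CARD('n))"
    and e: "e > 0"
  shows "\<forall>\<^sub>F t in at_top. ennreal (t ^ CARD('n)) * (\<integral>\<^sup>+y. ennreal (exp (- M (t * norm (x0 - y)))) \<partial>\<rho>) \<le> ennreal e"
proof -
  let ?n = "CARD('n)"
  note [measurable_cong] = sets
  define c where "c = M 1"
  have c: "c > 0" unfolding c_def by (rule M_1)
  define S where "S = (\<Sum>j. exp (- c * real j) * real (Suc j) ^ ?n)"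
  have S: "S \<ge> 0" unfolding S_def by (intro suminf_nonneg summable_power_exp c) auto
  \<comment> \<open>\<open>S + 1\<close> in place of \<open>S\<close> keeps the denominator
    positive; the other half of \<open>e\<close> is reserved for the region away from
    \<open>x0\<close>.\<close>
  define \<eta> where "\<eta> = e / (2 * (S + 1))"
  have \<eta>: "\<eta> > 0" using e S by (simp add: \<eta>_def)
  obtain d where d: "d > 0" "\<And>r. 0 < r \<Longrightarrow> r < d \<Longrightarrow> emeasure \<rho> (ball x0 r) \<le> ennreal (\<eta> * r ^ ?n)"
    using loc[OF \<eta>] by blast
  define \<delta> where "\<delta> = d / 2"
  have \<delta>: "0 < \<delta>" "\<delta> < d" using d by (auto simp: \<delta>_def)
  have [measurable]: "ball x0 r \<in> sets borel" for r by simp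
  have [measurable]: "(\<lambda>y::real^'n. M (a * norm (x0 - y))) \<in> borel_measurable borel" if "0 \<le> a" for a
    using borel_measurable_M_norm[OF that, of x0] by (simp add: norm_minus_commute)
  have [measurable]: "(\<lambda>y::real^'n. M (K * norm y)) \<in> borel_measurable borel"
    using borel_measurable_M_norm[OF K, of 0] by simp
  define I where "I = enn2real (\<integral>\<^sup>+y. ennreal (exp (- M (K * norm y))) \<partial>\<rho>)"
  have I: "(\<integral>\<^sup>+y. ennreal (exp (- M (K * norm y))) \<partial>\<rho>) = ennreal I"
    using fin by (simp add: I_def less_top)
  \<comment> \<open>The shell estimate asks for the ball bound at every radius. After restriction to
    \<open>ball x0 \<delta>\<close>, the measure of a larger ball is that of
    \<open>ball x0 \<delta>\<close>, where the bound is already known.\<close>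
  define \<rho>1 where "\<rho>1 = density \<rho> (indicator (ball x0 \<delta>))"
  have near: "ennreal (t ^ ?n) * (\<integral>\<^sup>+y. ennreal (exp (- M (t * norm (x0 - y)))) * indicator (ball x0 \<delta>) y \<partial>\<rho>) \<le> ennreal (e / 2)"
    if t: "t > 0" for t
  proof -
    have "(\<integral>\<^sup>+y. ennreal (exp (- M (t * norm (x0 - y)))) * indicator (ball x0 \<delta>) y \<partial>\<rho>)
      = (\<integral>\<^sup>+y. ennreal (exp (- M (t * norm (x0 - y)))) \<partial>\<rho>1)"
      unfolding \<rho>1_def using t by (subst nn_integral_density) (auto simp: mult.commute)
    also have "\<dots> \<le> ennreal (\<eta> / t ^ ?n * S)"
      unfolding S_def
    proof (rule nn_integral_exp_shells)
      show "sets \<rho>1 = sets borel" by (simp add: \<rho>1_def sets)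
      show "c * real (nat \<lfloor>u\<rfloor>) \<le> M u" if "0 \<le> u" for u unfolding c_def by (rule M_floor[OF that])
      fix r :: real assume r: "r > 0"
      have "emeasure \<rho>1 (ball x0 r) = emeasure \<rho> (ball x0 \<delta> \<inter> ball x0 r)"
        unfolding \<rho>1_def by (subst emeasure_density) (auto simp: indicator_inter_arith[symmetric] sets intro!: borel_measurable_indicator)
      also have "\<dots> \<le> emeasure \<rho> (ball x0 (min \<delta> r))"
        by (intro emeasure_mono) (auto simp: sets)
      also have "\<dots> \<le> ennreal (\<eta> * min \<delta> r ^ ?n)" using \<delta> r by (intro d(2)) auto
      also have "\<dots> \<le> ennreal (\<eta> * r ^ ?n)"
        using \<eta> \<delta> r by (intro ennreal_leI mult_left_mono power_mono) auto
      finally show "emeasure \<rho>1 (ball x0 r) \<le> ennreal (\<eta> * r ^ ?n)" .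
    qed (use c t \<eta> in auto)
    finally have "ennreal (t ^ ?n) * (\<integral>\<^sup>+y. ennreal (exp (- M (t * norm (x0 - y)))) * indicator (ball x0 \<delta>) y \<partial>\<rho>)
       \<le> ennreal (t ^ ?n) * ennreal (\<eta> / t ^ ?n * S)" by (rule mult_left_mono) simp
    also have "\<dots> = ennreal (\<eta> * S)" using t \<eta> S by (simp add: ennreal_mult[symmetric])
    also have "\<dots> \<le> ennreal (e / 2)"
    proof (rule ennreal_leI)
      have "\<eta> * S \<le> \<eta> * (S + 1)" using \<eta> by simp
      also have "\<dots> = e / 2"
      proof -
        have "e / (2 * s) * s = e / 2" if "s \<noteq> 0" for s :: real using that by simp
        moreover have "S + 1 \<noteq> 0" using S by linarith
        ultimately show ?thesis unfolding \<eta>_def by blast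
      qed
      finally show "\<eta> * S \<le> e / 2" .
    qed
    finally show ?thesis .
  qed
  \<comment> \<open>The constant collects the shift by \<open>2 * K\<close> in the linear bound, the
    rounding loss \<open>c\<close>, the change of centre and the weighted mass; none of these
    depends on \<open>t\<close>.\<close>
  define A where "A t = t ^ ?n * exp (- (c * \<delta>) * t) * (exp (2 * K * c * \<delta> + c + M (2 * K * norm x0)) * I)" for t
  have far: "ennreal (t ^ ?n) * (\<integral>\<^sup>+y. ennreal (exp (- M (t * norm (x0 - y)))) * indicator (- ball x0 \<delta>) y \<partial>\<rho>) \<le> ennreal (A t)"
    if t: "t > 0" "t \<ge> 2 * K" for t
  proof -
    define w where "w = exp (- (c * \<delta>) * t) * exp (2 * K * c * \<delta> + c + M (2 * K * norm x0))"
    have "(\<integral>\<^sup>+y. ennreal (exp (- M (t * norm (x0 - y)))) * indicator (- ball x0 \<delta>) y \<partial>\<rho>)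
      \<le> (\<integral>\<^sup>+y. ennreal w * ennreal (exp (- M (K * norm y))) \<partial>\<rho>)"
    proof (rule nn_integral_mono)
      fix y
      show "ennreal (exp (- M (t * norm (x0 - y)))) * indicator (- ball x0 \<delta>) y \<le> ennreal w * ennreal (exp (- M (K * norm y)))"
      proof (cases "y \<in> ball x0 \<delta>")
        case False
        define r where "r = norm (x0 - y)"
        have r: "r \<ge> \<delta>" using False by (simp add: r_def dist_norm)
        have "M (2 * K * r) + M ((t - 2 * K) * r) \<le> M (2 * K * r + (t - 2 * K) * r)"
          using r \<delta> K t by (intro M_superadd) auto
        also have "2 * K * r + (t - 2 * K) * r = t * r" by (simp add: algebra_simps)
        finally have 1: "M (2 * K * r) + M ((t - 2 * K) * r) \<le> M (t * r)" .
        have "c * ((t - 2 * K) * \<delta>) \<le> c * ((t - 2 * K) * r)"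
          using r c t by (intro mult_left_mono) auto
        also have "\<dots> \<le> M ((t - 2 * K) * r) + c"
          using M_linear[of "(t - 2 * K) * r"] t r \<delta> by (simp add: c_def)
        finally have 2: "c * ((t - 2 * K) * \<delta>) \<le> M ((t - 2 * K) * r) + c" .
        have 3: "M (K * norm y) \<le> M (2 * K * r) + M (2 * K * norm x0)"
          unfolding r_def by (rule M_shift[OF K])
        have "- M (t * r) \<le> - (c * \<delta>) * t + (2 * K * c * \<delta> + c + M (2 * K * norm x0)) + (- M (K * norm y))"
          using 1 2 3 by (simp add: algebra_simps)
        then have "exp (- M (t * r)) \<le> w * exp (- M (K * norm y))"
          unfolding w_def exp_add[symmetric] by simp
        then show ?thesis using False by (simp add: r_def w_def ennreal_mult[symmetric] ennreal_leI)
      qed simp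
    qed
    also have "\<dots> = ennreal w * ennreal I" by (subst nn_integral_cmult) (auto simp: I)
    finally have "ennreal (t ^ ?n) * (\<integral>\<^sup>+y. ennreal (exp (- M (t * norm (x0 - y)))) * indicator (- ball x0 \<delta>) y \<partial>\<rho>)
      \<le> ennreal (t ^ ?n) * (ennreal w * ennreal I)" by (rule mult_left_mono) simp
    also have "\<dots> = ennreal (A t)"
      using t by (simp add: A_def w_def I_def ennreal_mult[symmetric] mult.assoc)
    finally show ?thesis .
  qed
  have "(A \<longlongrightarrow> 0) at_top"
  proof -
    have "((\<lambda>x::real. x ^ ?n / exp x) \<longlongrightarrow> 0) at_top" by (rule tendsto_power_div_exp_0)
    moreover have "filterlim (\<lambda>t. c * \<delta> * t) at_top at_top"
      using c \<delta> by (intro filterlim_tendsto_pos_mult_at_top[OF tendsto_const]) (auto intro: filterlim_ident)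
    ultimately have "((\<lambda>t. (c * \<delta> * t) ^ ?n / exp (c * \<delta> * t)) \<longlongrightarrow> 0) at_top"
      by (rule filterlim_compose)
    from tendsto_mult_right_zero[OF this, of "exp (2 * K * c * \<delta> + c + M (2 * K * norm x0)) * I / (c * \<delta>) ^ ?n"]
    show ?thesis
      using c \<delta> unfolding A_def[abs_def]
      by (simp add: power_mult_distrib exp_minus field_simps)
  qed
  then have "\<forall>\<^sub>F t in at_top. A t < e / 2" using e by (intro order_tendstoD) auto
  moreover have "\<forall>\<^sub>F t in at_top. t > 0 \<and> t \<ge> 2 * K"
    by (intro eventually_conj eventually_gt_at_top eventually_ge_at_top)
  ultimately show ?thesis
  proof eventually_elim
    case (elim t)
    have "(\<integral>\<^sup>+y. ennreal (exp (- M (t * norm (x0 - y)))) \<partial>\<rho>)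
      = (\<integral>\<^sup>+y. ennreal (exp (- M (t * norm (x0 - y)))) * indicator (ball x0 \<delta>) y
           + ennreal (exp (- M (t * norm (x0 - y)))) * indicator (- ball x0 \<delta>) y \<partial>\<rho>)"
      by (intro nn_integral_cong) (simp add: indicator_def)
    also have "\<dots> = (\<integral>\<^sup>+y. ennreal (exp (- M (t * norm (x0 - y)))) * indicator (ball x0 \<delta>) y \<partial>\<rho>)
       + (\<integral>\<^sup>+y. ennreal (exp (- M (t * norm (x0 - y)))) * indicator (- ball x0 \<delta>) y \<partial>\<rho>)"
      using elim by (intro nn_integral_add) measurable
    finally have "ennreal (t ^ ?n) * (\<integral>\<^sup>+y. ennreal (exp (- M (t * norm (x0 - y)))) \<partial>\<rho>) \<le> ennreal (e / 2) + ennreal (A t)"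
      using near[of t] far[of t] elim by (simp add: distrib_left add_mono)
    also have "\<dots> \<le> ennreal (e / 2) + ennreal (e / 2)"
      using elim by (intro add_left_mono ennreal_leI) auto
    also have "\<dots> = ennreal e" using e by (simp add: ennreal_plus[symmetric] del: ennreal_plus)
    finally show ?case .
  qed
qed

section \<open>Bounds for the scaling function and the projection kernel\<close>

lemma phi_weight_bound:
  fixes \<phi> :: "real^'n \<Rightarrow> complex"
  assumes cont: "continuous_on UNIV \<phi>"
    and dec: "((\<lambda>x. complex_of_real (exp (M (norm (4 *\<^sub>R x)))) * \<phi> x) \<longlongrightarrow> 0) at_infinity"
  shows "\<exists>D\<ge>0. \<forall>x. cmod (\<phi> x) \<le> D * exp (- M (4 * norm x))"
proof -
  have "\<forall>\<^sub>F x in at_infinity. cmod (complex_of_real (exp (M (norm (4 *\<^sub>R x)))) * \<phi> x) < 1"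
    using dec tendsto_norm_zero order_tendstoD(2) zero_less_one by blast
  then obtain b where b: "\<And>x. norm x \<ge> b \<Longrightarrow> cmod (complex_of_real (exp (M (norm (4 *\<^sub>R x)))) * \<phi> x) < 1"
    unfolding eventually_at_infinity by blast
  define b' where "b' = max b 0"
  have "compact (\<phi> ` cball 0 b')"
    by (intro compact_continuous_image continuous_on_subset[OF cont]) auto
  then obtain B where B: "\<And>x. x \<in> cball 0 b' \<Longrightarrow> cmod (\<phi> x) \<le> B"
    using compact_imp_bounded bounded_iff by (metis image_eqI)
  have "B \<ge> 0" using B[of 0] by (simp add: b'_def order_trans[OF norm_ge_zero])
  define D where "D = max 1 (B * exp (M (4 * b')))"
  have "cmod (\<phi> x) \<le> D * exp (- M (4 * norm x))" for x
  proof (cases "norm x \<le> b'")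
    case True
    then have "exp (- M (4 * b')) \<le> exp (- M (4 * norm x))" by (simp add: M_mono)
    then have "D * exp (- M (4 * b')) \<le> D * exp (- M (4 * norm x))" by (intro mult_left_mono) (auto simp: D_def)
    moreover have "B * exp (M (4 * b')) * exp (- M (4 * b')) \<le> D * exp (- M (4 * b'))"
      by (intro mult_right_mono) (auto simp: D_def)
    moreover have "B * exp (M (4 * b')) * exp (- M (4 * b')) = B" by (simp add: mult.assoc exp_add[symmetric])
    ultimately show ?thesis using B[of x] True by simp
  next
    case False
    then have "norm x \<ge> b" by (simp add: b'_def)
    from b[OF this] have "exp (M (4 * norm x)) * cmod (\<phi> x) < 1" by (simp add: norm_mult)
    then have "cmod (\<phi> x) \<le> 1 * exp (- M (4 * norm x))" by (simp add: exp_minus field_simps)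
    also have "\<dots> \<le> D * exp (- M (4 * norm x))" by (intro mult_right_mono) (auto simp: D_def)
    finally show ?thesis .
  qed
  moreover have "D \<ge> 0" by (simp add: D_def)
  ultimately show ?thesis by blast
qed

text \<open>The factor \<open>exp (M 1)\<close> absorbs the rounding loss in the linear lower bound
  for \<open>M\<close>; the slope \<open>4 * M 1\<close> obtained there leaves room for the rate
  \<open>2 * M 1\<close>.\<close>

lemma exp_decay_phi:
  fixes \<phi> :: "real^'n \<Rightarrow> complex"
  assumes cont: "continuous_on UNIV \<phi>" and D: "D \<ge> 0" "\<And>x. cmod (\<phi> x) \<le> D * exp (- M (4 * norm x))"
  shows "exp_decay \<phi> (M 1) (D * exp (M 1))"
proof
  fix x :: "real^'n"
  have "2 * M 1 * norm x - M 1 \<le> M (4 * norm x)"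
  proof -
    have "0 \<le> M 1 * norm x" "M 1 * (4 * norm x) = 4 * (M 1 * norm x)" "2 * M 1 * norm x = 2 * (M 1 * norm x)"
      using M_1 by auto
    then show ?thesis using M_linear[of "4 * norm x"] by simp
  qed
  then have "exp (- M (4 * norm x)) \<le> exp (M 1) * exp (- (2 * M 1) * norm x)"
    by (simp add: exp_add[symmetric])
  then have "D * exp (- M (4 * norm x)) \<le> D * (exp (M 1) * exp (- (2 * M 1) * norm x))"
    using D(1) by (rule mult_left_mono)
  then show "cmod (\<phi> x) \<le> D * exp (M 1) * exp (- (2 * M 1) * norm x)"
    using D(2)[of x] by (simp add: mult.assoc)
qed (use M_1 cont D in auto)

text \<open>Doubling bounds \<open>M (norm (x - y))\<close> by
  \<open>M (2 * norm x) + M (2 * norm y)\<close>, and superadditivity makes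
  \<open>M (4 * norm x)\<close> at least twice \<open>M (2 * norm x)\<close>: one copy pays for the
  separation, the other grows linearly and makes the lattice sum converge. This is the origin of the
  dilation 4.\<close>

lemma q0_bound:
  fixes \<phi> :: "real^'n \<Rightarrow> complex"
  assumes cont: "continuous_on UNIV \<phi>" and D': "D \<ge> 0" "\<And>x. cmod (\<phi> x) \<le> D * exp (- M (4 * norm x))"
  shows "\<exists>C\<ge>0. \<forall>x y. cmod (q0 \<phi> x y) \<le> C * exp (- M (norm (x - y)))"
proof -
  obtain S where S: "S \<ge> 0" "\<And>x A. A \<subseteq> integer_points \<Longrightarrow> (\<lambda>m. exp (- M 1 * norm (x - m))) summable_on A \<and>
      (\<Sum>\<^sub>\<infinity>m\<in>A. exp (- M 1 * norm (x - m :: real^'n))) \<le> S"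
    using integer_points_exp_summable[OF M_1, where 'n='n] by blast
  interpret exp_decay \<phi> "M 1" "D * exp (M 1)" by (rule exp_decay_phi[OF assms])
  define C where "C = D\<^sup>2 * exp (M 1)"
  have prod: "cmod (\<phi> x) * cmod (\<phi> y) \<le> C * exp (- M (norm (x - y))) * exp (- M 1 * norm x)" for x y
  proof -
    have "cmod (\<phi> x) * cmod (\<phi> y) \<le> (D * exp (- M (4 * norm x))) * (D * exp (- M (4 * norm y)))"
      using D' by (intro mult_mono) auto
    also have "\<dots> = D\<^sup>2 * exp (- M (4 * norm x) - M (4 * norm y))"
      by (simp add: power2_eq_square exp_diff exp_minus field_simps)
    also have "\<dots> \<le> D\<^sup>2 * exp (M 1 - M (norm (x - y)) - M 1 * norm x)"
    proof -
      have "M (norm (x - y)) \<le> M (norm x + norm y)" by (intro M_mono norm_triangle_ineq4) simp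
      also have "\<dots> \<le> M (2 * norm x) + M (2 * norm y)" by (rule M_double) auto
      finally have "M (norm (x - y)) \<le> M (2 * norm x) + M (2 * norm y)" .
      moreover have "M (2 * norm x) + M (2 * norm x) \<le> M (4 * norm x)"
        using M_superadd[of "2 * norm x" "2 * norm x"] by simp
      moreover have "M (2 * norm y) \<le> M (4 * norm y)" by (rule M_mono) auto
      moreover have "M 1 * norm x - M 1 \<le> M (2 * norm x)"
      proof -
        have "0 \<le> M 1 * norm x" "M 1 * (2 * norm x) = 2 * (M 1 * norm x)"
          using M_1 by auto
        then show ?thesis using M_linear[of "2 * norm x"] by simp
      qed
      ultimately show ?thesis by (intro mult_left_mono) auto
    qed
    also have "\<dots> = C * exp (- M (norm (x - y))) * exp (- M 1 * norm x)"
      by (simp add: C_def exp_diff exp_minus exp_add field_simps)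
    finally show ?thesis .
  qed
  have "cmod (q0 \<phi> x y) \<le> C * S * exp (- M (norm (x - y)))" for x y
  proof -
    let ?a = "C * exp (- M (norm (x - y)))"
    have "cmod (q0 \<phi> x y) \<le> (\<Sum>\<^sub>\<infinity>m\<in>integer_points. norm (\<phi> (x - m) * cnj (\<phi> (y - m))))"
      unfolding q0_def by (rule norm_infsum_bound[OF abs_summable_q0])
    also have "\<dots> \<le> (\<Sum>\<^sub>\<infinity>m\<in>integer_points. ?a * exp (- M 1 * norm (x - m)))"
    proof (rule infsum_mono[OF abs_summable_q0])
      show "(\<lambda>m. ?a * exp (- M 1 * norm (x - m))) summable_on integer_points"
        using S(2)[OF order_refl, of x] by (intro summable_on_cmult_right) blast
      show "norm (\<phi> (x - m) * cnj (\<phi> (y - m))) \<le> ?a * exp (- M 1 * norm (x - m))" for m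
        using prod[of "x - m" "y - m"] by (simp add: norm_mult)
    qed
    also have "\<dots> = ?a * (\<Sum>\<^sub>\<infinity>m\<in>integer_points. exp (- M 1 * norm (x - m)))" by (rule infsum_cmult_right')
    also have "\<dots> \<le> ?a * S" using S(2)[OF order_refl, of x] by (intro mult_left_mono) (auto simp: C_def)
    finally show ?thesis by (simp only: mult_ac)
  qed
  moreover have "C * S \<ge> 0" using S by (simp add: C_def)
  ultimately show ?thesis by blast
qed

text \<open>On a bounded set the weight is bounded below by a positive constant, so its integral
  controls the mass there.\<close>

lemma total_variation_locally_finite:
  fixes \<mu> :: "(real^'n) set \<Rightarrow> complex"
  assumes k: "k \<ge> 0"
    and growth: "(\<integral>\<^sup>+ x. ennreal (exp (- M (k * norm x))) \<partial>total_variation \<mu>) < \<infinity>"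
    and B: "B \<in> bounded_borel"
  shows "emeasure (total_variation \<mu>) B < \<infinity>"
proof -
  have Bb: "B \<in> sets borel" "bounded B" using B by (auto simp: bounded_borel_def)
  then obtain r where r: "\<And>x. x \<in> B \<Longrightarrow> norm x \<le> r" unfolding bounded_iff by blast
  \<comment> \<open>For empty \<open>B\<close> the bound \<open>r\<close> may be negative, where
    nothing is known about \<open>M\<close>.\<close>
  define w where "w = exp (- M (k * max r 0))"
  have "ennreal w * emeasure (total_variation \<mu>) B = (\<integral>\<^sup>+ x. ennreal w * indicator B x \<partial>total_variation \<mu>)"
    using Bb by (intro nn_integral_cmult_indicator[symmetric]) simp
  also have "\<dots> \<le> (\<integral>\<^sup>+ x. ennreal (exp (- M (k * norm x))) \<partial>total_variation \<mu>)"
  proof (rule nn_integral_mono)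
    fix x
    show "ennreal w * indicator B x \<le> ennreal (exp (- M (k * norm x)))"
    proof (cases "x \<in> B")
      case True
      then have "k * norm x \<le> k * max r 0" using r[OF True] k by (intro mult_left_mono) auto
      then have "M (k * norm x) \<le> M (k * max r 0)" using k by (intro M_mono) auto
      then show ?thesis using True by (simp add: w_def ennreal_leI)
    qed simp
  qed
  also note growth
  finally show ?thesis by (auto simp: w_def ennreal_mult_less_top)
qed

end


section \<open>Convergence of the kernel integrals at density points\<close>

lemma q_eq: "q \<phi> lam x y = complex_of_real ((2 powr lam) ^ CARD('n)) * q0 \<phi> ((2 powr lam) *\<^sub>R x) ((2 powr lam) *\<^sub>R (y :: real^'n))"
  unfolding q_def by (simp add: powr_realpow[symmetric] powr_powr mult.commute)

theorem corollary4p5: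
  fixes M :: "real \<Rightarrow> real"
    and V :: "int \<Rightarrow> ((real^'n) \<Rightarrow> complex) set"
    and \<phi> :: "(real^'n) \<Rightarrow> complex"
    and \<mu> :: "(real^'n) set \<Rightarrow> complex"
    and k :: real
  assumes M_nonneg: "\<And>t. t \<ge> 0 \<Longrightarrow> M t \<ge> 0"
    and M_cont: "continuous_on {0..} M"
    and M_incr: "strict_mono_on {0..} M"
    and M_superadd: "\<And>t s. t \<ge> 0 \<Longrightarrow> s \<ge> 0 \<Longrightarrow> M t + M s \<le> M (t + s)"
    and M_double: "\<And>t s. t \<ge> 0 \<Longrightarrow> s \<ge> 0 \<Longrightarrow> M (t + s) \<le> M (2 * t) + M (2 * s)"
    and V_MRA: "MRA V"
    and \<phi>_scaling: "scaling_function V \<phi>"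
    and \<phi>_cont: "continuous_on UNIV \<phi>"
    and \<phi>_decay: "\<And>l :: nat.
      ((\<lambda>x. complex_of_real (exp (M (norm (real l *\<^sub>R x)))) * \<phi> x) \<longlongrightarrow> 0) at_infinity"
    and \<mu>_radon: "complex_radon_measure \<mu>"
    and k_nonneg: "k \<ge> 0"
    and \<mu>_growth:
      "(\<integral>\<^sup>+ x. ennreal (exp (- M (norm (k *\<^sub>R x)))) \<partial>total_variation \<mu>) < \<infinity>"
  shows "(\<forall>x0 \<gamma>. has_lebesgue_density \<mu> \<gamma> x0 \<longrightarrow>
             ((\<lambda>lam. q_measure \<phi> lam \<mu> x0) \<longlongrightarrow> \<gamma>) at_top) \<and>
         (\<exists>f \<mu>s. lebesgue_decomposition \<mu> f \<mu>s) \<and>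
         (\<forall>f \<mu>s. lebesgue_decomposition \<mu> f \<mu>s \<longrightarrow>
             (AE x0 in lebesgue.
                has_lebesgue_density \<mu> (f x0) x0 \<and>
                ((\<lambda>lam. q_measure \<phi> lam \<mu> x0) \<longlongrightarrow> f x0) at_top))"
proof -
  interpret weight M
    by unfold_locales (fact M_nonneg M_cont M_incr M_superadd M_double)+
  let ?n = "CARD('n)"
  have \<mu>: "radon_additive \<mu>" using \<mu>_radon by (simp add: complex_radon_measure_eq)
  have growth: "(\<integral>\<^sup>+ x. ennreal (exp (- M (k * norm x))) \<partial>total_variation \<mu>) < \<infinity>"
    using \<mu>_growth k_nonneg by simp
  have fin: "emeasure (total_variation \<mu>) B < \<infinity>" if "B \<in> bounded_borel" for B
    by (rule total_variation_locally_finite[OF k_nonneg growth that])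
  obtain D where D: "D \<ge> 0" "\<And>x. cmod (\<phi> x) \<le> D * exp (- M (4 * norm x))"
    using phi_weight_bound[OF \<phi>_cont] \<phi>_decay[of 4] by auto
  interpret decay: exp_decay \<phi> "M 1" "D * exp (M 1)" by (rule exp_decay_phi[OF \<phi>_cont D])
  obtain C where C: "C \<ge> 0" "\<And>x y. cmod (q0 \<phi> x y) \<le> C * exp (- M (norm (x - y)))"
    using q0_bound[OF \<phi>_cont D] by auto
  have q0_meas [measurable]: "q0 \<phi> x \<in> borel_measurable borel" for x by (rule decay.integral_q0(1))
  have q0_int: "(LINT y|lborel. q0 \<phi> x y) = 1" for x
    using decay.integral_q0(2) decay.G_eq_1[OF V_MRA \<phi>_scaling] by simp
  have q_meas [measurable]: "q \<phi> lam x \<in> borel_measurable borel" for lam x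
    unfolding q_eq[abs_def] by measurable
  have q_bound: "cmod (q \<phi> lam x y) \<le> C * (2 powr lam) ^ ?n * exp (- M (2 powr lam * norm (x - y)))" for lam x y
  proof -
    have "norm (2 powr lam *\<^sub>R x - 2 powr lam *\<^sub>R y) = 2 powr lam * norm (x - y)"
      by (simp add: scaleR_diff_right[symmetric])
    then have "cmod (q0 \<phi> (2 powr lam *\<^sub>R x) (2 powr lam *\<^sub>R y)) \<le> C * exp (- M (2 powr lam * norm (x - y)))"
      using C(2)[of "2 powr lam *\<^sub>R x" "2 powr lam *\<^sub>R y"] by simp
    then have "(2 powr lam) ^ ?n * cmod (q0 \<phi> (2 powr lam *\<^sub>R x) (2 powr lam *\<^sub>R y))
       \<le> (2 powr lam) ^ ?n * (C * exp (- M (2 powr lam * norm (x - y))))" by (rule mult_left_mono) simp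
    moreover have "cmod (complex_of_real ((2 powr lam) ^ ?n)) = (2 powr lam) ^ ?n"
      by (simp only: norm_of_real abs_of_nonneg[OF zero_le_power[OF powr_ge_zero]])
    ultimately show ?thesis unfolding q_eq norm_mult by (simp only: mult_ac)
  qed
  \<comment> \<open>For \<open>k = 0\<close> the weight is constant and has infinite Lebesgue
    integral; a positive \<open>K \<ge> k\<close> makes it integrable for Lebesgue measure and for
    the total variation alike.\<close>
  define K where "K = k + 1"
  have K: "K > 0" "k \<le> K" using k_nonneg by (auto simp: K_def)
  have [measurable]: "(\<lambda>y::real^'n. M (a * norm (x - y))) \<in> borel_measurable borel" if "0 \<le> a" for a x
    using borel_measurable_M_norm[OF that, of x] by (simp add: norm_minus_commute)
  have MK [measurable]: "(\<lambda>y::real^'n. M (K * norm y)) \<in> borel_measurable borel"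
    using borel_measurable_M_norm[of K 0] K by simp
  have finTV: "(\<integral>\<^sup>+ y. ennreal (exp (- M (K * norm y))) \<partial>total_variation \<mu>) < \<infinity>"
  proof -
    have "(\<integral>\<^sup>+ y. ennreal (exp (- M (K * norm y))) \<partial>total_variation \<mu>)
        \<le> (\<integral>\<^sup>+ y. ennreal (exp (- M (k * norm y))) \<partial>total_variation \<mu>)"
      using K k_nonneg by (intro nn_integral_mono ennreal_leI) (auto intro!: M_mono mult_right_mono)
    then show ?thesis using growth by (rule order_le_less_trans)
  qed
  have finL: "(\<integral>\<^sup>+ y. ennreal (exp (- M (K * norm y))) \<partial>(lborel :: (real^'n) measure)) < \<infinity>"
  proof -
    have "(\<integral>\<^sup>+ y. ennreal (exp (- M (K * norm y))) \<partial>(lborel :: (real^'n) measure))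
       \<le> (\<integral>\<^sup>+ y. ennreal (exp (M 1)) * ennreal (exp (- (M 1 * K) * norm (0 - y :: real^'n))) \<partial>lborel)"
    proof (rule nn_integral_mono)
      fix y :: "real^'n"
      have "M 1 * (K * norm y) - M 1 \<le> M (K * norm y)" using K by (intro M_linear) simp
      then show "ennreal (exp (- M (K * norm y))) \<le> ennreal (exp (M 1)) * ennreal (exp (- (M 1 * K) * norm (0 - y)))"
        by (simp add: ennreal_mult[symmetric] exp_add[symmetric] ennreal_leI mult.assoc)
    qed
    also have "\<dots> = ennreal (exp (M 1)) * (\<integral>\<^sup>+ y. ennreal (exp (- (M 1 * K) * norm (0 - y :: real^'n))) \<partial>lborel)"
      by (rule nn_integral_cmult) simp
    also have "\<dots> < \<infinity>"
      using nn_integral_exp_norm[of "M 1 * K" "0 :: real^'n"] M_1 K by (simp add: ennreal_mult_less_top)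
    finally show ?thesis .
  qed
  \<comment> \<open>From the scale \<open>2 * K\<close> on, the kernel is dominated by a multiple of
    the weight and hence integrable against both measures; smaller \<open>lam\<close> do not affect
    the limit.\<close>
  have q_dom: "cmod (q \<phi> lam x y) \<le> C * (2 powr lam) ^ ?n * exp (M (2 * K * norm x)) * exp (- M (K * norm y))"
    if "2 powr lam \<ge> 2 * K" for lam x y
  proof -
    have "M (K * norm y) \<le> M (2 * K * norm (x - y)) + M (2 * K * norm x)" using K by (intro M_shift) simp
    moreover have "M (2 * K * norm (x - y)) \<le> M (2 powr lam * norm (x - y))"
      using that K by (intro M_mono mult_right_mono) auto
    ultimately have "exp (- M (2 powr lam * norm (x - y))) \<le> exp (M (2 * K * norm x)) * exp (- M (K * norm y))"
      by (simp add: exp_add[symmetric])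
    then have "C * (2 powr lam) ^ ?n * exp (- M (2 powr lam * norm (x - y)))
       \<le> C * (2 powr lam) ^ ?n * (exp (M (2 * K * norm x)) * exp (- M (K * norm y)))"
      using C by (intro mult_left_mono) auto
    then show ?thesis using q_bound[of lam x y] by (simp add: mult.assoc)
  qed
  have q_fin: "(\<integral>\<^sup>+ y. ennreal (cmod (q \<phi> lam x y)) \<partial>N) < \<infinity>"
    if lam: "2 powr lam \<ge> 2 * K" and N: "sets N = sets borel" "(\<integral>\<^sup>+ y. ennreal (exp (- M (K * norm y))) \<partial>N) < \<infinity>"
    for lam x and N :: "(real^'n) measure"
  proof -
    note [measurable_cong] = N(1)
    let ?a = "C * (2 powr lam) ^ ?n * exp (M (2 * K * norm x))"
    have "(\<integral>\<^sup>+ y. ennreal (cmod (q \<phi> lam x y)) \<partial>N) \<le> (\<integral>\<^sup>+ y. ennreal ?a * ennreal (exp (- M (K * norm y))) \<partial>N)"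
      using q_dom[OF lam] C(1) by (intro nn_integral_mono) (simp add: ennreal_mult[symmetric] ennreal_leI)
    also have "\<dots> = ennreal ?a * (\<integral>\<^sup>+ y. ennreal (exp (- M (K * norm y))) \<partial>N)"
      by (rule nn_integral_cmult) measurable
    also have "\<dots> < \<infinity>" using N(2) by (simp add: ennreal_mult_less_top)
    finally show ?thesis .
  qed
  have q_int: "(LINT y|lborel. q \<phi> lam x y) = 1" for lam x
  proof -
    let ?t = "2 powr lam"
    have "integrable lborel (q0 \<phi> (?t *\<^sub>R x))"
    \<comment> \<open>A function that is not integrable has integral 0 by convention, whereas this
      integral is 1.\<close>
    proof (rule ccontr)
      assume "\<not> integrable lborel (q0 \<phi> (?t *\<^sub>R x))"
      then have "(LINT y|lborel. q0 \<phi> (?t *\<^sub>R x) y) = 0" by (rule not_integrable_integral_eq)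
      then show False using q0_int[of "?t *\<^sub>R x"] by simp
    qed
    from integral_lborel_affine[OF this, of ?t 0]
    have "1 = ?t ^ ?n *\<^sub>R (LINT y|lborel. q0 \<phi> (?t *\<^sub>R x) (?t *\<^sub>R y))" by (simp add: q0_int)
    then show ?thesis unfolding q_eq by (simp add: scaleR_conv_of_real)
  qed
  obtain T h s where rd: "radon_density \<mu> T h s"
    and s_bound: "\<And>u. u \<in> borel_measurable borel \<Longrightarrow>
       (\<integral>\<^sup>+x. u x * ennreal (cmod (s x)) \<partial>T) \<le> 4 * (\<integral>\<^sup>+x. u x \<partial>total_variation \<mu>)"
    and s_int: "\<And>g. g \<in> borel_measurable borel \<Longrightarrow> (\<integral>\<^sup>+x. ennreal (cmod (g x)) \<partial>total_variation \<mu>) < \<infinity> \<Longrightarrow>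
       integrable T (\<lambda>x. g x * s x) \<and> integral_radon \<mu> g = (LINT x|T. g x * s x)"
    by (rule radon_representation[OF \<mu> fin], assumption, rule that, assumption+)
  note T = radon_densityD(1)[OF rd] and h = radon_densityD(2-4)[OF rd] and s = radon_densityD(5)[OF rd]
  note [measurable_cong] = T
  note [measurable] = h(1) s
  have main: "((\<lambda>lam. q_measure \<phi> lam \<mu> x0) \<longlongrightarrow> \<gamma>) at_top" if dens: "has_lebesgue_density \<mu> \<gamma> x0" for x0 \<gamma>
  proof (rule tendstoI)
    fix e :: real assume e: "e > 0"
    define \<sigma> where "\<sigma> y = s y - \<gamma> * complex_of_real (h y)" for y
    have [measurable]: "\<sigma> \<in> borel_measurable borel" unfolding \<sigma>_def by measurable
    \<comment> \<open>This takes the place of the total variation of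
      \<open>\<mu> - \<gamma> m\<close>. It may be infinite; its weighted mass is finite.\<close>
    define \<rho> where "\<rho> = density T (\<lambda>y. ennreal (cmod (\<sigma> y)))"
    have \<rho>: "sets \<rho> = sets borel" by (simp add: \<rho>_def T)
    have \<rho>fin: "(\<integral>\<^sup>+y. ennreal (exp (- M (K * norm y))) \<partial>\<rho>) < \<infinity>"
    proof -
      let ?u = "\<lambda>y::real^'n. ennreal (exp (- M (K * norm y)))"
      have "(\<integral>\<^sup>+y. ?u y \<partial>\<rho>) = (\<integral>\<^sup>+y. ?u y * ennreal (cmod (\<sigma> y)) \<partial>T)"
        unfolding \<rho>_def by (subst nn_integral_density) (auto simp: mult.commute)
      also have "\<dots> \<le> (\<integral>\<^sup>+y. ?u y * ennreal (cmod (s y)) + ennreal (cmod \<gamma>) * (ennreal (h y) * ?u y) \<partial>T)"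
      proof (rule nn_integral_mono)
        fix y
        have "cmod (\<sigma> y) \<le> cmod (s y) + cmod \<gamma> * h y"
          using norm_triangle_ineq4[of "s y" "\<gamma> * complex_of_real (h y)"] h(2)[of y] by (simp add: \<sigma>_def norm_mult)
        then have "ennreal (cmod (\<sigma> y)) \<le> ennreal (cmod (s y)) + ennreal (cmod \<gamma>) * ennreal (h y)"
          using h(2)[of y] by (simp add: ennreal_mult[symmetric] ennreal_plus[symmetric] ennreal_leI del: ennreal_plus)
        then have "?u y * ennreal (cmod (\<sigma> y)) \<le> ?u y * (ennreal (cmod (s y)) + ennreal (cmod \<gamma>) * ennreal (h y))"
          by (rule mult_left_mono) simp
        then show "?u y * ennreal (cmod (\<sigma> y)) \<le> ?u y * ennreal (cmod (s y)) + ennreal (cmod \<gamma>) * (ennreal (h y) * ?u y)"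
          by (simp only: distrib_left mult_ac)
      qed
      also have "\<dots> = (\<integral>\<^sup>+y. ?u y * ennreal (cmod (s y)) \<partial>T) + ennreal (cmod \<gamma>) * (\<integral>\<^sup>+y. ennreal (h y) * ?u y \<partial>T)"
        by (simp add: nn_integral_add nn_integral_cmult)
      also have "(\<integral>\<^sup>+y. ennreal (h y) * ?u y \<partial>T) = (\<integral>\<^sup>+y. ?u y \<partial>lborel)"
        unfolding h(3) by (subst nn_integral_density) auto
      also have "(\<integral>\<^sup>+y. ?u y * ennreal (cmod (s y)) \<partial>T) + ennreal (cmod \<gamma>) * (\<integral>\<^sup>+y. ?u y \<partial>lborel)
         \<le> 4 * (\<integral>\<^sup>+y. ?u y \<partial>total_variation \<mu>) + ennreal (cmod \<gamma>) * (\<integral>\<^sup>+y. ?u y \<partial>lborel)"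
        by (intro add_right_mono s_bound) measurable
      also have "\<dots> < \<infinity>"
        using finTV finL by (simp add: ennreal_mult_less_top)
      finally show ?thesis .
    qed
    \<comment> \<open>\<open>C + 1\<close> keeps the denominator positive, and the factor 2 leaves a
      strict inequality after multiplication by \<open>C\<close>.\<close>
    have "e / (2 * (C + 1)) > 0" using e C by simp
    from weighted_kernel_tendsto_0[OF \<rho> _ \<rho>fin _ this, of x0]
    have ev: "\<forall>\<^sub>F t in at_top. ennreal (t ^ ?n) * (\<integral>\<^sup>+y. ennreal (exp (- M (t * norm (x0 - y)))) \<partial>\<rho>) \<le> ennreal (e / (2 * (C + 1)))"
      using K has_lebesgue_density_variation[OF \<mu> dens rd] by (auto simp: \<rho>_def \<sigma>_def)
    have lim: "filterlim (\<lambda>lam::real. 2 powr lam) at_top at_top"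
      unfolding powr_def
      using filterlim_compose[OF exp_at_top filterlim_tendsto_pos_mult_at_top[OF tendsto_const _ filterlim_ident], of "ln 2"]
      by (simp add: mult.commute)
    have "\<forall>\<^sub>F lam in at_top. ennreal ((2 powr lam) ^ ?n) * (\<integral>\<^sup>+y. ennreal (exp (- M (2 powr lam * norm (x0 - y)))) \<partial>\<rho>) \<le> ennreal (e / (2 * (C + 1)))"
      by (rule eventually_compose_filterlim[OF ev lim])
    moreover have "\<forall>\<^sub>F lam in at_top. 2 powr lam \<ge> 2 * K"
      by (rule eventually_compose_filterlim[OF eventually_ge_at_top lim])
    ultimately show "\<forall>\<^sub>F lam in at_top. dist (q_measure \<phi> lam \<mu> x0) \<gamma> < e"
    proof eventually_elim
      case (elim lam)
      let ?g = "q \<phi> lam x0"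
      have i1: "integrable T (\<lambda>y. ?g y * s y)" "q_measure \<phi> lam \<mu> x0 = (LINT y|T. ?g y * s y)"
        using s_int[OF q_meas q_fin[OF elim(2) sets_total_variation finTV]] by (auto simp: q_measure_def)
      have "integrable lborel ?g"
        using q_fin[OF elim(2) sets_lborel finL] by (intro integrableI_bounded) auto
      then have i2: "integrable T (\<lambda>y. h y *\<^sub>R ?g y)"
        using h(2) unfolding h(3) by (subst (asm) integrable_density) auto
      have "(LINT y|lborel. ?g y) = (LINT y|T. h y *\<^sub>R ?g y)"
        unfolding h(3) using h(2) by (intro integral_density) auto
      \<comment> \<open>Lebesgue measure is \<open>T\<close> with density \<open>h\<close>, so
        \<open>\<gamma>\<close> equals \<open>\<gamma>\<close> times an integral against
        \<open>T\<close> and can be subtracted under the integral sign.\<close>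
      then have one: "(LINT y|T. h y *\<^sub>R ?g y) = 1" using q_int by simp
      have eq: "?g y * \<sigma> y = ?g y * s y - \<gamma> * (h y *\<^sub>R ?g y)" for y
        by (simp add: \<sigma>_def scaleR_conv_of_real algebra_simps)
      have i3: "integrable T (\<lambda>y. ?g y * \<sigma> y)"
        unfolding eq using i1(1) i2 by (intro Bochner_Integration.integrable_diff integrable_mult_right)
      have "q_measure \<phi> lam \<mu> x0 - \<gamma> = (LINT y|T. ?g y * \<sigma> y)"
        unfolding eq using i1 i2 one by (simp del: mult_scaleR_right)
      then have "ennreal (dist (q_measure \<phi> lam \<mu> x0) \<gamma>) \<le> (\<integral>\<^sup>+y. ennreal (norm (?g y * \<sigma> y)) \<partial>T)"
        using integral_norm_bound_ennreal[OF i3] by (simp add: dist_norm)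
      also have "\<dots> \<le> (\<integral>\<^sup>+y. (ennreal C * ennreal ((2 powr lam) ^ ?n)) * (ennreal (cmod (\<sigma> y)) * ennreal (exp (- M (2 powr lam * norm (x0 - y))))) \<partial>T)"
      proof (rule nn_integral_mono)
        fix y
        have "norm (?g y * \<sigma> y) \<le> C * (2 powr lam) ^ ?n * exp (- M (2 powr lam * norm (x0 - y))) * cmod (\<sigma> y)"
          unfolding norm_mult by (rule mult_right_mono[OF q_bound]) simp
        then show "ennreal (norm (?g y * \<sigma> y)) \<le> (ennreal C * ennreal ((2 powr lam) ^ ?n)) * (ennreal (cmod (\<sigma> y)) * ennreal (exp (- M (2 powr lam * norm (x0 - y)))))"
          using C(1) by (simp add: ennreal_mult[symmetric] ennreal_leI mult_ac del: norm_mult)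
      qed
      also have "\<dots> = ennreal C * (ennreal ((2 powr lam) ^ ?n) * (\<integral>\<^sup>+y. ennreal (exp (- M (2 powr lam * norm (x0 - y)))) \<partial>\<rho>))"
        unfolding \<rho>_def by (subst nn_integral_cmult, measurable, subst nn_integral_density) (auto simp: mult.assoc)
      also have "\<dots> \<le> ennreal C * ennreal (e / (2 * (C + 1)))"
        by (rule mult_left_mono[OF elim(1)]) simp
      also have "\<dots> = ennreal (C * (e / (2 * (C + 1))))"
        using C(1) e by (intro ennreal_mult[symmetric]) auto
      finally have "dist (q_measure \<phi> lam \<mu> x0) \<gamma> \<le> C * (e / (2 * (C + 1)))"
        using C e by (subst (asm) ennreal_le_iff) auto
      also have "\<dots> < e"
      proof -
        have "C * (e / (2 * (C + 1))) \<le> (C + 1) * (e / (2 * (C + 1)))" using C e by (intro mult_right_mono) auto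
        also have "\<dots> = e / 2"
        proof -
          have "a * (e / (2 * a)) = e / 2" if "a \<noteq> 0" for a :: real using that by simp
          moreover have "C + 1 \<noteq> 0" using C by linarith
          ultimately show ?thesis by blast
        qed
        also have "\<dots> < e" using e by simp
        finally show ?thesis .
      qed
      finally show ?case .
    qed
  qed
  have "AE x0 in lebesgue. has_lebesgue_density \<mu> (f x0) x0 \<and> ((\<lambda>lam. q_measure \<phi> lam \<mu> x0) \<longlongrightarrow> f x0) at_top"
    if "lebesgue_decomposition \<mu> f \<mu>s" for f \<mu>s
    using AE_has_lebesgue_density[OF \<mu>_radon that fin] main by (auto elim: eventually_mono)
  with main lebesgue_decomposition_exists[OF \<mu>_radon fin] show ?thesis by blast
qed

end
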